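(* Let $\mathcal{F}$ be a fixed finite set of graphs. The problem Connected Secluded $\mathcal{F}$-Free Subgraph can be solved in time $2^{2^{2^{\mathcal{O}(t\log t)}}}\cdot n^{\mathcal{O}(1)}$, where $n=|V(G)|$ and the constants hidden in the $\mathcal{O}$-notation may depend on $\mathcal{F}$.
   Context: All graphs are finite, simple and undirected. For $U\subseteq V(G)$, $N_G(U)=\left(\bigcup_{v\in U}N_G(v)\right)\setminus U$ is the open neighborhood of $U$. A set $U$ is $t$-secluded if $|N_G(U)|\le t$; an induced subgraph $H$ of $G$ is $t$-secluded if $V(H)$ is. A graph is $\mathcal{F}$-free if it has no induced subgraph isomorphic to a member of $\mathcal{F}$. Connected Secluded $\mathcal{F}$-Free Subgraph: given a graph $G$, a weight function $\omega\colon V(G)\to\mathbb{Z}_{>0}$, a nonnegative integer $t$ and a positive integer $w$, decide whether $G$ contains a connected $t$-secluded induced subgraph $H$ that is $\mathcal{F}$-free and satisfies $\omega(V(H))=\sum_{v\in V(H)}\omega(v)\ge w$. *)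

theory Defs
  imports "Graph_Theory.Graph_Theory" "HOL-Library.Landau_Symbols"
begin

text \<open>
  A finite simple undirected graph is a \<^const>\<open>pair_graph\<close>, i.e. a finite loop-free digraph
  with a symmetric arc relation: the edge \<open>uv\<close> is the pair of arcs \<open>(u, v)\<close> and \<open>(v, u)\<close>.
\<close>

definition open_neighborhood :: "'v pair_pre_digraph \<Rightarrow> 'v set \<Rightarrow> 'v set" where
  "open_neighborhood G U = (\<Union>v\<in>U. {u. v \<rightarrow>\<^bsub>with_proj G\<^esub> u}) - U"

definition secluded :: "nat \<Rightarrow> 'v pair_pre_digraph \<Rightarrow> 'v set \<Rightarrow> bool" where
  "secluded t G U \<longleftrightarrow> card (open_neighborhood G U) \<le> t"

definition induced_free :: "'a pair_pre_digraph set \<Rightarrow> 'v pair_pre_digraph \<Rightarrow> bool" where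
  "induced_free \<F> G \<longleftrightarrow>
     \<not> (\<exists>(H :: 'v pair_pre_digraph) (F :: 'a pair_pre_digraph).
          F \<in> \<F> \<and> induced_subgraph (with_proj H) (with_proj G) \<and> digraph_iso (with_proj H) (with_proj F))"

definition connected_secluded_free_subgraph ::
  "'a pair_pre_digraph set \<Rightarrow> 'v pair_pre_digraph \<Rightarrow> ('v \<Rightarrow> nat) \<Rightarrow> nat \<Rightarrow> nat \<Rightarrow> bool" where
  "connected_secluded_free_subgraph \<F> G \<omega> t w \<longleftrightarrow>
     (\<exists>H :: 'v pair_pre_digraph. induced_subgraph (with_proj H) (with_proj G) \<and>
        Digraph_Component.connected (with_proj H) \<and>
        secluded t G (pverts H) \<and> induced_free \<F> H \<and> (\<Sum>v\<in>pverts H. \<omega> v) \<ge> w)"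

text \<open>
  Running time is the number of steps of a unit-cost random access machine. Registers hold
  natural numbers, and the arithmetic is addition and truncated subtraction only: unit-cost
  multiplication would make the machine unreasonably powerful.
\<close>

datatype ram_instr =
    Const nat nat
  | Add nat nat nat
  | Sub nat nat nat
  | Load nat nat
  | Store nat nat
  | Jump nat
  | JumpZero nat nat

type_synonym ram_program = "ram_instr list"
type_synonym ram_memory = "nat \<Rightarrow> nat"
type_synonym ram_config = "nat \<times> ram_memory"

fun ram_exec :: "ram_instr \<Rightarrow> ram_config \<Rightarrow> ram_config" where
  "ram_exec (Const i c) (pc, M) = (Suc pc, M(i := c))"
| "ram_exec (Add i j k) (pc, M) = (Suc pc, M(i := M j + M k))"
| "ram_exec (Sub i j k) (pc, M) = (Suc pc, M(i := M j - M k))"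
| "ram_exec (Load i j) (pc, M) = (Suc pc, M(i := M (M j)))"
| "ram_exec (Store i j) (pc, M) = (Suc pc, M(M i := M j))"
| "ram_exec (Jump l) (pc, M) = (l, M)"
| "ram_exec (JumpZero i l) (pc, M) = (if M i = 0 then l else Suc pc, M)"

text \<open>The machine halts, and stays put, once the program counter leaves the program.\<close>

definition ram_step :: "ram_program \<Rightarrow> ram_config \<Rightarrow> ram_config" where
  "ram_step P c = (if fst c < length P then ram_exec (P ! fst c) c else c)"

text \<open>
  Started on memory \<open>M\<close>, the program halts after at most \<open>k\<close> steps, and its answer in
  register 0 is 1 if \<open>b\<close> holds and 0 otherwise.
\<close>

definition ram_answers :: "ram_program \<Rightarrow> ram_memory \<Rightarrow> nat \<Rightarrow> bool \<Rightarrow> bool" where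
  "ram_answers P M k b \<longleftrightarrow>
     (let (pc, M') = (ram_step P ^^ k) (0, M)
      in length P \<le> pc \<and> M' 0 = (if b then 1 else 0))"

text \<open>
  Input layout for a graph with vertex set \<open>{..<n}\<close>: registers 0, 1, 2 hold \<open>n\<close>, \<open>t\<close>, \<open>w\<close>;
  they are followed by the \<open>n\<close> weights, one per register, and then by the adjacency matrix,
  row by row. All other registers are 0.
\<close>

definition encode_instance ::
  "nat \<Rightarrow> nat pair_pre_digraph \<Rightarrow> (nat \<Rightarrow> nat) \<Rightarrow> nat \<Rightarrow> nat \<Rightarrow> ram_memory" where
  "encode_instance n G \<omega> t w =
     (\<lambda>a. let xs = [n, t, w] @ map \<omega> [0..<n] @
                   concat (map (\<lambda>u. map (\<lambda>v. if u \<rightarrow>\<^bsub>with_proj G\<^esub> v then 1 else 0) [0..<n]) [0..<n])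
          in if a < length xs then xs ! a else 0)"

end

theory Submission imports Defs begin

text \<open>
  Let \<open>C\<close> be an inclusion-maximal solution containing a guessed vertex. The search maintains a set
  \<open>S \<subseteq> C\<close> and a set \<open>T\<close> disjoint from \<open>C\<close>, and compares \<open>C\<close> with the minimum vertex cuts between
  them: the closest one \<open>Rmin\<close>, the furthest one \<open>Rmax\<close>, and a chain of levels in between. If \<open>C\<close>
  leaves \<open>Rmax\<close>, a neighbour of \<open>Rmax\<close> belongs to \<open>C\<close> and joins \<open>S\<close>. If \<open>Rmin\<close> is not contained in
  \<open>C\<close>, then by submodularity and maximality \<open>C \<union> Rmin\<close> contains a forbidden tuple, one of whose entries
  in \<open>Rmin\<close> lies outside \<open>C\<close> and joins \<open>T\<close>. Both moves increase \<open>lam S T \<le> t\<close>. Otherwise either all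
  levels lie in \<open>C\<close>, and \<open>C\<close> is itself a level, or \<open>S\<close> becomes the last level inside \<open>C\<close>; then a
  boundary vertex is fixed in \<open>T\<close>, or passing to the next level makes the previous case apply.

  No step needs to know \<open>C\<close>. Up to exchange, a forbidden tuple is determined by its equality and
  adjacency pattern and by its entries on the boundary of the cut, so the lexicographically first
  tuple of the guessed kind serves as well. Hence \<open>6 * t + 1\<close> steps suffice, each described by a
  constant number of digits of size \<open>O(t)\<close>, and the sequences of digits are enumerated by their code.

  The search is written in a small loop language in which loop bounds are values that the loop body
  never changes; such programs compile to the machine with a polynomial step count. A fixed prelude
  first moves the low input registers out of the way of the compiled code.
\<close>

section \<open>Minimum vertex cuts\<close>

text \<open>The obstacle: the index of the last level inside \<open>C\<close> may be as large as
  \<open>n\<close>, while a guess may only use digits bounded in terms of \<open>t\<close>. A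
  forbidden tuple has \<open>c\<close> entries, and a vertex of \<open>Rmax\<close> lies on the
  boundary of at most one level, so among \<open>c + 1\<close> consecutive levels one has a boundary
  free of the tuple. At that level no boundary entry has to be named, and the pattern alone
  describes the part of the tuple to be replaced. The first level containing a tuple of that pattern
  is computable without knowing \<open>C\<close>, lies beyond the last level inside \<open>C\<close>
  and exceeds its index by at most \<open>c + 1\<close>; this difference is the offset digit.

  The step count comes from the potential \<open>lam S T + fx S T\<close>, where \<open>fx\<close>
  counts the neighbours of \<open>S\<close> that lie in \<open>T\<close>. Both terms are at most
  \<open>t\<close>, every round of at most three steps raises the sum, and one last step yields
  \<open>C\<close>: hence \<open>3 * (2 * t) + 1\<close>. The base \<open>t + c + 6\<close> leaves
  room for cut vertices, tuple positions, offsets up to \<open>c + 1\<close>, operation codes up to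
  5, and the digit 3, which no pair of vertices realises.\<close>

locale sgraph =
  fixes n :: nat and adj :: "nat \<Rightarrow> nat \<Rightarrow> bool"
  assumes adj_sym: "adj u v \<Longrightarrow> adj v u" and adj_irrefl: "\<not> adj v v"
begin

definition nb :: "nat set \<Rightarrow> nat set" where
  "nb A = {v. v < n \<and> v \<notin> A \<and> (\<exists>u\<in>A. adj u v)}"

lemma finite_nb [simp]: "finite (nb A)"
  by (rule finite_subset[of _ "{..<n}"]) (auto simp: nb_def)

lemma nb_subset: "nb A \<subseteq> {..<n}"
  by (auto simp: nb_def)

lemma card_nb_le: "card (nb A) \<le> n"
  using card_mono[of "{..<n}" "nb A"] by (auto simp: nb_def)

text \<open>Counted with multiplicity: a vertex on either boundary of the left side lies on
  \<open>nb A\<close> or \<open>nb B\<close>, and a vertex on both lies on both.\<close>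

lemma nb_submodular: "card (nb (A \<union> B)) + card (nb (A \<inter> B)) \<le> card (nb A) + card (nb B)"
proof -
  have "card (nb (A \<union> B)) + card (nb (A \<inter> B))
      = card (nb (A \<union> B) \<union> nb (A \<inter> B)) + card (nb (A \<union> B) \<inter> nb (A \<inter> B))"
    by (rule card_Un_Int) auto
  also have "\<dots> \<le> card (nb A \<union> nb B) + card (nb A \<inter> nb B)"
    by (intro add_mono card_mono) (auto simp: nb_def)
  also have "\<dots> = card (nb A) + card (nb B)"
    by (rule card_Un_Int[symmetric]) auto
  finally show ?thesis .
qed

text \<open>Vertices of \<open>T\<close> may be neighbours of \<open>R\<close>, that is, they may
  themselves be cut. So a separating set exists even if \<open>S\<close> and \<open>T\<close> are
  adjacent.\<close>

definition sep :: "nat set \<Rightarrow> nat set \<Rightarrow> nat set \<Rightarrow> bool" where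
  "sep S T R \<longleftrightarrow> S \<subseteq> R \<and> R \<subseteq> {..<n} \<and> R \<inter> T = {}"

definition lam :: "nat set \<Rightarrow> nat set \<Rightarrow> nat" where
  "lam S T = (LEAST k. \<exists>R. sep S T R \<and> card (nb R) = k)"

definition mincut :: "nat set \<Rightarrow> nat set \<Rightarrow> nat set \<Rightarrow> bool" where
  "mincut S T R \<longleftrightarrow> sep S T R \<and> card (nb R) = lam S T"

lemma lam_le: "sep S T R \<Longrightarrow> lam S T \<le> card (nb R)"
  unfolding lam_def by (rule Least_le) blast

lemma sep_self: "sep S T R \<Longrightarrow> sep S T S"
  by (auto simp: sep_def)

lemma mincut_exists:
  assumes "sep S T S" obtains R where "mincut S T R"
proof -
  have "\<exists>R. sep S T R \<and> card (nb R) = lam S T"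
    unfolding lam_def by (rule LeastI_ex) (use assms in blast)
  then show ?thesis using that by (auto simp: mincut_def)
qed

lemma mincutI: "sep S T R \<Longrightarrow> card (nb R) \<le> lam S T \<Longrightarrow> mincut S T R"
  using lam_le[of S T R] by (auto simp: mincut_def)

text \<open>Uncrossing: both sets separate, so neither can fall below the minimum, and by
  submodularity neither can exceed it.\<close>

lemma mincut_Un_Int:
  assumes "mincut S T A" "mincut S T B"
  shows "mincut S T (A \<union> B)" "mincut S T (A \<inter> B)"
proof -
  have s: "sep S T (A \<union> B)" "sep S T (A \<inter> B)"
    using assms by (auto simp: mincut_def sep_def)
  have "card (nb (A \<union> B)) + card (nb (A \<inter> B)) \<le> lam S T + lam S T"
    using nb_submodular[of A B] assms by (auto simp: mincut_def)
  with lam_le[OF s(1)] lam_le[OF s(2)] s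
  show "mincut S T (A \<union> B)" "mincut S T (A \<inter> B)" by (auto simp: mincut_def)
qed

definition Rmin :: "nat set \<Rightarrow> nat set \<Rightarrow> nat set" where
  "Rmin S T = \<Inter> {R. mincut S T R}"

definition Rmax :: "nat set \<Rightarrow> nat set \<Rightarrow> nat set" where
  "Rmax S T = \<Union> {R. mincut S T R}"

lemma mincut_finite: "mincut S T R \<Longrightarrow> finite R"
  by (auto simp: mincut_def sep_def intro: finite_subset)

text \<open>A minimum cut of least cardinality is contained in every other one, since intersecting
  the two gives a minimum cut that cannot be smaller.\<close>

lemma mincut_Rmin: assumes "sep S T S" shows "mincut S T (Rmin S T)"
proof -
  obtain R0 where "mincut S T R0" using mincut_exists[OF assms] .
  then obtain R where R: "mincut S T R" and m: "\<And>R'. mincut S T R' \<Longrightarrow> card R \<le> card R'"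
    using ex_has_least_nat[of "mincut S T" R0 card] by blast
  have "R \<subseteq> R'" if "mincut S T R'" for R'
  proof -
    have "mincut S T (R \<inter> R')" using R that by (rule mincut_Un_Int)
    then have "card R \<le> card (R \<inter> R')" by (rule m)
    then have "R \<inter> R' = R" using mincut_finite[OF R] by (intro card_seteq) auto
    then show ?thesis by blast
  qed
  then have "Rmin S T = R" using R by (auto simp: Rmin_def)
  with R show ?thesis by simp
qed

lemma mincut_Rmax: assumes "sep S T S" shows "mincut S T (Rmax S T)"
proof -
  have b: "card R \<le> n" if "mincut S T R" for R
    using card_mono[of "{..<n}" R] that by (auto simp: mincut_def sep_def)
  obtain R0 where "mincut S T R0" using mincut_exists[OF assms] .
  then obtain R where R: "mincut S T R" and m: "\<And>R'. mincut S T R' \<Longrightarrow> card R' \<le> card R"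
    using ex_has_greatest_nat[of "mincut S T" R0 card "Suc n"] b by (auto simp: le_imp_less_Suc)
  have "R' \<subseteq> R" if "mincut S T R'" for R'
  proof -
    have u: "mincut S T (R \<union> R')" using R that by (rule mincut_Un_Int)
    then have "card (R \<union> R') \<le> card R" by (rule m)
    then have "R = R \<union> R'" using mincut_finite[OF u] by (intro card_seteq) auto
    then show ?thesis by blast
  qed
  then have "Rmax S T = R" using R by (auto simp: Rmax_def)
  with R show ?thesis by simp
qed

lemma Rmin_least: "mincut S T R \<Longrightarrow> Rmin S T \<subseteq> R"
  by (auto simp: Rmin_def)

lemma Rmax_greatest: "mincut S T R \<Longrightarrow> R \<subseteq> Rmax S T"
  by (auto simp: Rmax_def)

lemma lam_mono:
  assumes "S \<subseteq> S'" "T \<subseteq> T'" "sep S' T' S'"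
  shows "lam S T \<le> lam S' T'"
proof -
  obtain R where "mincut S' T' R" using mincut_exists[OF assms(3)] .
  moreover from this have "sep S T R" using assms by (auto simp: mincut_def sep_def)
  ultimately show ?thesis using lam_le[of S T R] by (auto simp: mincut_def)
qed

text \<open>If the value stayed the same, a cut attaining it would be a minimum cut for
  \<open>T\<close> that avoids \<open>u\<close>, yet \<open>Rmin\<close> is contained in all of
  those.\<close>

lemma lam_less_insert_right:
  assumes "u \<in> Rmin S T" "sep S (insert u T) S"
  shows "lam S T < lam S (insert u T)"
proof (rule ccontr)
  assume "\<not> ?thesis"
  moreover obtain R where R: "mincut S (insert u T) R" using mincut_exists[OF assms(2)] .
  ultimately have "mincut S T R" by (intro mincutI) (auto simp: mincut_def sep_def)
  from Rmin_least[OF this] R assms(1) show False by (auto simp: mincut_def sep_def)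
qed

lemma lam_less_insert_left:
  assumes "x \<notin> Rmax S T" "sep (insert x S) T (insert x S)"
  shows "lam S T < lam (insert x S) T"
proof (rule ccontr)
  assume "\<not> ?thesis"
  moreover obtain R where R: "mincut (insert x S) T R" using mincut_exists[OF assms(2)] .
  ultimately have "mincut S T R" by (intro mincutI) (auto simp: mincut_def sep_def)
  from Rmax_greatest[OF this] R assms(1) show False by (auto simp: mincut_def sep_def)
qed

text \<open>This reduces \<open>Rmax\<close> to \<open>n\<close> cut computations: forcing a vertex
  onto the source side is free exactly for its members.\<close>

lemma in_Rmax_iff:
  assumes "sep S T S"
  shows "v \<in> Rmax S T \<longleftrightarrow> v < n \<and> v \<notin> T \<and> lam (insert v S) T = lam S T"
proof
  assume "v \<in> Rmax S T"
  moreover have m: "mincut S T (Rmax S T)" using mincut_Rmax[OF assms] .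
  ultimately have s: "sep (insert v S) T (Rmax S T)" by (auto simp: mincut_def sep_def)
  then have "lam (insert v S) T \<le> lam S T" using lam_le m by (metis mincut_def)
  moreover have "lam S T \<le> lam (insert v S) T"
    by (rule lam_mono) (use sep_self[OF s] in auto)
  ultimately show "v < n \<and> v \<notin> T \<and> lam (insert v S) T = lam S T"
    using s by (auto simp: sep_def)
next
  assume "v < n \<and> v \<notin> T \<and> lam (insert v S) T = lam S T"
  with assms lam_less_insert_left[of v S T] show "v \<in> Rmax S T" by (auto simp: sep_def)
qed

text \<open>Enlarging the source side within a minimum cut keeps that cut separating, so the value
  cannot rise.\<close>

lemma mincut_of_superset:
  assumes "mincut S T R" "S \<subseteq> S'" "S' \<subseteq> R"
  shows "lam S' T = lam S T" "mincut S' T R"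
proof -
  have s: "sep S' T R" using assms by (auto simp: mincut_def sep_def)
  have "lam S' T \<le> lam S T" using lam_le[OF s] assms(1) by (simp add: mincut_def)
  moreover have "lam S T \<le> lam S' T" using lam_mono[of S S' T T] sep_self[OF s] assms by auto
  ultimately show "lam S' T = lam S T" by simp
  with s assms(1) show "mincut S' T R" by (simp add: mincut_def)
qed

section \<open>Connectedness and closest cuts\<close>

definition arcs_in :: "nat set \<Rightarrow> (nat \<times> nat) set" where
  "arcs_in A = {(a, b). a \<in> A \<and> b \<in> A \<and> adj a b}"

definition conn :: "nat set \<Rightarrow> bool" where
  "conn A \<longleftrightarrow> A \<noteq> {} \<and> (\<forall>x\<in>A. \<forall>y\<in>A. (x, y) \<in> rtrancl (arcs_in A))"

lemma arcs_in_mono: "A \<subseteq> B \<Longrightarrow> rtrancl (arcs_in A) \<subseteq> rtrancl (arcs_in B)"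
  by (rule rtrancl_mono) (auto simp: arcs_in_def)

lemma connI:
  assumes "a \<in> A" "\<And>x. x \<in> A \<Longrightarrow> (a, x) \<in> rtrancl (arcs_in A)"
  shows "conn A"
proof -
  have "sym (rtrancl (arcs_in A))" by (rule sym_rtrancl) (auto simp: arcs_in_def sym_def adj_sym)
  with assms show ?thesis unfolding conn_def by (metis empty_iff rtrancl_trans symD)
qed

text \<open>A path inside \<open>C\<close> from \<open>H\<close> to a vertex outside
  \<open>H\<close> leaves \<open>H\<close> through a neighbour.\<close>

lemma conn_crossing:
  assumes "conn C" "H \<subseteq> C" "H \<noteq> {}" "C \<subseteq> {..<n}" "C \<noteq> H"
  obtains x where "x \<in> C" "x \<in> nb H"
proof -
  obtain a b where ab: "a \<in> H" "b \<in> C" "b \<notin> H" using assms by blast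
  then have "(a, b) \<in> rtrancl (arcs_in C)" using assms by (auto simp: conn_def)
  then have "b \<in> H \<or> (\<exists>x\<in>C. x \<in> nb H)"
    by (induction rule: rtrancl_induct) (use ab assms(4) in \<open>auto simp: arcs_in_def nb_def\<close>)
  with ab that show ?thesis by blast
qed

text \<open>The part of \<open>Rmin\<close> reachable from \<open>S\<close> acquires no further
  neighbours, so it is a minimum cut itself and hence all of \<open>Rmin\<close>.\<close>

lemma Rmin_reachable:
  assumes "sep S T S" "v \<in> Rmin S T"
  obtains s where "s \<in> S" "(s, v) \<in> rtrancl (arcs_in (Rmin S T))"
proof -
  let ?R = "Rmin S T"
  define R0 where "R0 = {v \<in> ?R. \<exists>s\<in>S. (s, v) \<in> rtrancl (arcs_in ?R)}"
  have m: "mincut S T ?R" using mincut_Rmin[OF assms(1)] .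
  have s0: "sep S T R0" using m by (auto simp: R0_def mincut_def sep_def)
  have "nb R0 \<subseteq> nb ?R"
  proof
    fix x assume x: "x \<in> nb R0"
    then obtain u where u: "u \<in> R0" "adj u x" "x < n" "x \<notin> R0" by (auto simp: nb_def)
    from u(1) obtain s where s: "s \<in> S" "(s, u) \<in> rtrancl (arcs_in ?R)" "u \<in> ?R" by (auto simp: R0_def)
    have "x \<notin> ?R"
    proof
      assume "x \<in> ?R"
      then have "(s, x) \<in> rtrancl (arcs_in ?R)"
        using s u by (intro rtrancl_into_rtrancl[OF s(2)]) (auto simp: arcs_in_def)
      then show False using s u(4) \<open>x \<in> ?R\<close> by (auto simp: R0_def)
    qed
    then show "x \<in> nb ?R" using u s by (auto simp: nb_def)
  qed
  then have "card (nb R0) \<le> lam S T" using m card_mono[OF finite_nb] by (metis mincut_def)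
  with s0 have "mincut S T R0" by (rule mincutI)
  from Rmin_least[OF this] assms(2) have "v \<in> R0" by blast
  then show ?thesis using that by (auto simp: R0_def)
qed

lemma conn_Un_Rmin:
  assumes C: "conn C" and sp: "sep S T S" and S: "\<And>s. s \<in> S \<Longrightarrow> s \<in> C \<or> (\<exists>a\<in>C. adj a s)"
  shows "conn (C \<union> Rmin S T)"
proof -
  let ?R = "Rmin S T"
  obtain c0 where c0: "c0 \<in> C" using C by (auto simp: conn_def)
  have inC: "(c0, x) \<in> rtrancl (arcs_in (C \<union> ?R))" if "x \<in> C" for x
    using C c0 that arcs_in_mono[of C "C \<union> ?R"] by (auto simp: conn_def)
  have "(c0, x) \<in> rtrancl (arcs_in (C \<union> ?R))" if "x \<in> ?R" for x
  proof -
    obtain s where s: "s \<in> S" "(s, x) \<in> rtrancl (arcs_in ?R)" using Rmin_reachable[OF sp \<open>x \<in> ?R\<close>] .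
    have sR: "s \<in> ?R" using mincut_Rmin[OF sp] s(1) by (auto simp: mincut_def sep_def)
    have "(c0, s) \<in> rtrancl (arcs_in (C \<union> ?R))"
    proof (cases "s \<in> C")
      case False
      then obtain a where "a \<in> C" "adj a s" using S[OF s(1)] by blast
      then show ?thesis
        using inC[of a] sR by (auto simp: arcs_in_def intro: rtrancl_into_rtrancl[of c0 a])
    qed (rule inC)
    moreover have "(s, x) \<in> rtrancl (arcs_in (C \<union> ?R))"
      using s(2) arcs_in_mono[of ?R "C \<union> ?R"] by auto
    ultimately show ?thesis by (rule rtrancl_trans)
  qed
  with inC c0 show ?thesis by (intro connI[of c0]) auto
qed

section \<open>The chain of levels between the closest and the furthest minimum cut\<close>

definition lnext :: "nat set \<Rightarrow> nat set \<Rightarrow> nat set" where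
  "lnext M H = (H \<union> nb H) - nb M"

primrec level :: "nat set \<Rightarrow> nat set \<Rightarrow> nat \<Rightarrow> nat set" where
  "level S T 0 = Rmin S T"
| "level S T (Suc l) = Rmin (lnext (Rmax S T) (level S T l)) T"

text \<open>A neighbour of \<open>H\<close> outside \<open>Rmax S T\<close> is a neighbour of
  \<open>Rmax S T\<close>; withholding those keeps the enlarged set inside
  \<open>Rmax S T\<close>.\<close>

lemma lnext_bounds:
  assumes "mincut S T H" "sep S T S"
  shows "H \<subseteq> lnext (Rmax S T) H" "lnext (Rmax S T) H \<subseteq> Rmax S T"
proof -
  have "H \<subseteq> Rmax S T" using Rmax_greatest assms(1) by auto
  then show "H \<subseteq> lnext (Rmax S T) H" "lnext (Rmax S T) H \<subseteq> Rmax S T"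
    by (auto simp: lnext_def nb_def)
qed

text \<open>The enlarged source side still lies in the minimum cut \<open>Rmax S T\<close>, so the
  value is unchanged and cuts found from it are minimum cuts of the original pair.\<close>

lemma lnext_mincut:
  assumes "mincut S T H" "sep S T S"
  defines "L \<equiv> lnext (Rmax S T) H"
  shows "sep L T L" "lam L T = lam S T" "mincut S T (Rmin L T)" "L \<subseteq> Rmin L T"
proof -
  have M: "mincut S T (Rmax S T)" using mincut_Rmax[OF assms(2)] .
  have SH: "S \<subseteq> H" using assms(1) by (auto simp: mincut_def sep_def)
  have b: "H \<subseteq> L" "L \<subseteq> Rmax S T" unfolding L_def using lnext_bounds[OF assms(1,2)] by auto
  then show l: "lam L T = lam S T" and *: "sep L T L"
    using mincut_of_superset[OF M, of L] SH sep_self[of L T "Rmax S T"]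
    by (auto simp: mincut_def)
  have r: "mincut L T (Rmin L T)" using mincut_Rmin[OF *] .
  then show "L \<subseteq> Rmin L T" by (auto simp: mincut_def sep_def)
  show "mincut S T (Rmin L T)" using r l b SH by (auto simp: mincut_def sep_def)
qed

lemma mincut_level: "sep S T S \<Longrightarrow> mincut S T (level S T l)"
  by (induction l) (auto simp: mincut_Rmin lnext_mincut)

lemma lnext_level_subset: "sep S T S \<Longrightarrow> lnext (Rmax S T) (level S T l) \<subseteq> level S T (Suc l)"
  using lnext_mincut(4)[OF mincut_level] by simp

lemma level_mono: assumes "sep S T S" "l \<le> l'" shows "level S T l \<subseteq> level S T l'"
  using assms(2)
proof (induction l' rule: dec_induct)
  case (step m)
  have "level S T m \<subseteq> level S T (Suc m)"
    using lnext_level_subset[OF assms(1)] lnext_bounds(1)[OF mincut_level[OF assms(1)] assms(1)]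
    by blast
  with step show ?case by blast
qed auto

lemma level_le_Rmax: "sep S T S \<Longrightarrow> level S T l \<subseteq> Rmax S T"
  using Rmax_greatest mincut_level by blast

text \<open>Such a vertex is swallowed by the next level and stays inside from then on. The
  pigeonhole argument over levels rests on this.\<close>

lemma nb_level_disjoint:
  assumes "sep S T S" "l < l'" "x \<in> nb (level S T l)" "x \<notin> nb (Rmax S T)"
  shows "x \<notin> nb (level S T l')"
proof -
  have "x \<in> level S T (Suc l)"
    using lnext_level_subset[OF assms(1), of l] assms by (auto simp: lnext_def)
  then have "x \<in> level S T l'" using level_mono[OF assms(1), of "Suc l" l'] assms by auto
  then show ?thesis by (simp add: nb_def)
qed

text \<open>While some boundary vertex is not on the boundary of \<open>Rmax\<close>, the next level
  is strictly larger, and no level has more than \<open>n\<close> vertices. Afterwards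
  \<open>lnext\<close> adds nothing.\<close>

lemma level_stable:
  assumes "sep S T S"
  shows "nb (level S T n) \<subseteq> nb (Rmax S T)" "n \<le> l \<Longrightarrow> level S T l = level S T n"
proof -
  have fin: "finite (level S T l)" for l using mincut_finite[OF mincut_level[OF assms]] .
  have stab: "level S T (Suc l) = level S T l" if "nb (level S T l) \<subseteq> nb (Rmax S T)" for l
  proof -
    have "lnext (Rmax S T) (level S T l) = level S T l"
      using that lnext_bounds(1)[OF mincut_level[OF assms, of l] assms] by (auto simp: lnext_def)
    moreover have "mincut (level S T l) T (level S T l)"
      using mincut_of_superset(2)[OF mincut_level[OF assms, of l]] mincut_level[OF assms, of l]
      by (auto simp: mincut_def sep_def)
    ultimately show ?thesis
      using Rmin_least[of "level S T l" T "level S T l"] lnext_level_subset[OF assms, of l] by auto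
  qed
  have grow: "nb (level S T l) \<subseteq> nb (Rmax S T) \<or> l < card (level S T l) \<or> (l = 0)" for l
  proof (induction l)
    case (Suc l)
    show ?case
    proof (cases "nb (level S T l) \<subseteq> nb (Rmax S T)")
      case True then show ?thesis using stab by simp
    next
      case False
      then have "level S T l \<subset> level S T (Suc l)"
        using lnext_level_subset[OF assms, of l] level_mono[OF assms, of l "Suc l"]
        by (auto simp: lnext_def nb_def)
      moreover have "level S T l \<noteq> {}" using False by (auto simp: nb_def)
      ultimately have "card (level S T l) < card (level S T (Suc l))" "card (level S T l) > 0"
        using fin[of l] psubset_card_mono[OF fin[of "Suc l"]] by (auto simp: card_gt_0_iff)
      with Suc False show ?thesis by auto
    qed
  qed simp
  have "card (level S T n) \<le> n"
    using card_mono[of "{..<n}" "level S T n"] mincut_level[OF assms, of n]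
    by (auto simp: mincut_def sep_def)
  with grow[of n] show st: "nb (level S T n) \<subseteq> nb (Rmax S T)" by (auto simp: nb_def)
  have *: "level S T (n + k) = level S T n" for k
  proof (induction k)
    case (Suc k)
    have "level S T (Suc (n + k)) = level S T (n + k)" by (rule stab) (simp only: Suc st)
    with Suc show ?case by (simp only: add_Suc_right)
  qed simp
  show "level S T l = level S T n" if "n \<le> l" using *[of "l - n"] that by simp
qed

end

section \<open>Branching\<close>

text \<open>The value \<open>m\<close> signals failure. In the level search it is
  \<open>2 * n\<close> and addresses the stable last level; in the sink search it is an index
  outside the split graph.\<close>

definition lst :: "nat \<Rightarrow> (nat \<Rightarrow> bool) \<Rightarrow> nat" where
  "lst m P = (if \<exists>v<m. P v then LEAST v. P v else m)"

lemma lst_found: assumes "v < m" "P v" shows "P (lst m P)" "lst m P \<le> v"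
proof -
  have "lst m P = (LEAST v. P v)" using assms by (auto simp: lst_def)
  then show "P (lst m P)" "lst m P \<le> v" using LeastI[of P v] Least_le[of P v] assms by auto
qed

lemma lst_unique: "v < m \<Longrightarrow> P v \<Longrightarrow> (\<And>x. P x \<Longrightarrow> x = v) \<Longrightarrow> lst m P = v"
  using lst_found(1)[of v m P] by blast

locale branching = sgraph +
  fixes c :: nat and Phi :: "(nat \<Rightarrow> nat \<Rightarrow> nat) list"
  assumes c_pos: "0 < c"
begin

text \<open>A matrix of such digits is the pattern of a tuple. Recording equality lets tuples with
  repetitions represent graphs with fewer than \<open>c\<close> vertices.\<close>

definition digit :: "nat \<Rightarrow> nat \<Rightarrow> nat" where
  "digit x y = (if x = y then 2 else if adj x y then 1 else 0)"

definition has_type :: "(nat \<Rightarrow> nat) \<Rightarrow> (nat \<Rightarrow> nat \<Rightarrow> nat) \<Rightarrow> bool" where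
  "has_type q \<phi> \<longleftrightarrow> (\<forall>i<c. \<forall>j<c. digit (q i) (q j) = \<phi> i j)"

definition free :: "nat set \<Rightarrow> bool" where
  "free A \<longleftrightarrow> \<not> (\<exists>q. (\<forall>i<c. q i \<in> A) \<and> (\<exists>\<phi>\<in>set Phi. has_type q \<phi>))"

text \<open>The element of rank \<open>j\<close>, so that a digit below \<open>card A\<close> can
  name any vertex of \<open>A\<close>.\<close>

definition pick :: "nat set \<Rightarrow> nat \<Rightarrow> nat" where
  "pick A j = lst n (\<lambda>v. v \<in> A \<and> card {u \<in> A. u < v} = j)"

lemma pick_surj:
  assumes "A \<subseteq> {..<n}" "v \<in> A"
  obtains j where "j < card A" "pick A j = v"
proof
  have fin: "finite A" using assms finite_subset by blast
  show "card {u \<in> A. u < v} < card A"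
    using assms fin by (intro psubset_card_mono) auto
  have "x = v" if "x \<in> A" "card {u \<in> A. u < x} = card {u \<in> A. u < v}" for x
  proof (rule ccontr)
    assume "x \<noteq> v"
    moreover have "card {u \<in> A. u < y} < card {u \<in> A. u < z}" if "y \<in> A" "y < z" for y z
      using fin that by (intro psubset_card_mono) auto
    ultimately show False using that assms(2) nat_neq_iff[of x v] by fastforce
  qed
  then show "pick A (card {u \<in> A. u < v}) = v"
    unfolding pick_def using assms by (intro lst_unique) auto
qed

text \<open>
  A guess \<open>g\<close> holds an operation code, an index and an offset in its first three digits, then one
  root digit per tuple position (0 for a vertex of the cut, otherwise the index of a neighbour of
  the closest minimum cut), and finally the digit matrix that the tuple has to realise.
\<close>

definition matches :: "(nat \<Rightarrow> nat) \<Rightarrow> nat set \<Rightarrow> nat set \<Rightarrow> (nat \<Rightarrow> nat) \<Rightarrow> bool" where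
  "matches g D B q \<longleftrightarrow>
     (\<forall>i<c. q i < n \<and> (if g (3 + i) = 0 then q i \<in> B else q i = pick D (g (3 + i) - 1))) \<and>
     has_type q (\<lambda>i j. g (3 + c + i * c + j))"

text \<open>Greedy construction: each entry is the smallest value with which the prefix still
  extends to a tuple, so only existence queries are asked.\<close>

primrec lexfirst :: "((nat \<Rightarrow> nat) \<Rightarrow> bool) \<Rightarrow> nat \<Rightarrow> nat \<Rightarrow> nat" where
  "lexfirst P 0 = (\<lambda>_. 0)"
| "lexfirst P (Suc i) = (lexfirst P i)
     (i := lst n (\<lambda>v. \<exists>q. P q \<and> (\<forall>j<i. q j = lexfirst P i j) \<and> q i = v))"

lemma lexfirst_prefix:
  assumes "P q0" "\<And>q. P q \<Longrightarrow> \<forall>i<c. q i < n" "i \<le> c"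
  shows "\<exists>q. P q \<and> (\<forall>j<i. q j = lexfirst P i j)"
  using assms(3)
proof (induction i)
  case (Suc i)
  let ?Q = "\<lambda>v. \<exists>q. P q \<and> (\<forall>j<i. q j = lexfirst P i j) \<and> q i = v"
  obtain q where q: "P q" "\<forall>j<i. q j = lexfirst P i j" using Suc by auto
  then have "?Q (lst n ?Q)" using assms(2)[of q] Suc.prems by (intro lst_found(1)[of "q i" n ?Q]) auto
  then obtain q' where "P q'" "\<forall>j<i. q' j = lexfirst P i j" "q' i = lst n ?Q" by blast
  then have "P q' \<and> (\<forall>j<Suc i. q' j = lexfirst P (Suc i) j)" by (auto simp: less_Suc_eq)
  then show ?case by blast
qed (use assms in auto)

text \<open>Code 2 names a level by its distance \<open>g 2\<close> below the first level that
  contains a matching tuple. Codes above 4 do nothing and pad short sequences.\<close>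

definition step :: "(nat \<Rightarrow> nat) \<Rightarrow> nat set \<times> nat set \<Rightarrow> nat set \<times> nat set" where
  "step g = (\<lambda>(S, T).
     let B = Rmin S T; M = Rmax S T; P = matches g (nb B) in
     if g 0 = 0 \<and> g 1 < c then (S, insert (lexfirst (P B) c (g 1)) T)
     else if g 0 = 1 then (insert (pick (nb M) (g 1)) S, T)
     else if g 0 = 2 then (level S T (lst (2 * n) (\<lambda>l. \<exists>q. P (level S T l) q) - g 2), T)
     else if g 0 = 3 then (S, insert (pick (nb S) (g 1)) T)
     else if g 0 = 4 then (lnext M S, T)
     else (S, T))"

text \<open>Finitely many digits determine a step, so a guess can be encoded in a number.\<close>

lemma step_cong:
  assumes "\<And>i. i < 3 + c + c * c \<Longrightarrow> g i = g' i" shows "step g = step g'"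
proof -
  have e: "g (3 + i) = g' (3 + i)" if "i < c" for i using assms[of "3 + i"] that by simp
  have p: "g (3 + c + i * c + j) = g' (3 + c + i * c + j)" if "i < c" "j < c" for i j
  proof -
    have "i * c + j < Suc i * c" using that by simp
    also have "\<dots> \<le> c * c" using that by (intro mult_le_mono1) simp
    finally show ?thesis using assms[of "3 + c + i * c + j"] by simp
  qed
  have "matches g = matches g'"
    unfolding fun_eq_iff matches_def has_type_def using e p by (auto cong: conj_cong)
  moreover have "g 0 = g' 0" "g 1 = g' 1" "g 2 = g' 2" using assms by auto
  ultimately show ?thesis by (simp only: step_def)
qed

end

section \<open>Branching against a fixed maximal solution\<close>

locale target = branching +
  fixes C :: "nat set" and t :: nat
  assumes conn_C: "conn C" and C_subset: "C \<subseteq> {..<n}" and nb_C: "card (nb C) \<le> t"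
    and free_C: "free C"
    and maximal_C: "\<And>D. C \<subset> D \<Longrightarrow> D \<subseteq> {..<n} \<Longrightarrow> conn D \<Longrightarrow> card (nb D) \<le> t \<Longrightarrow> \<not> free D"
begin

text \<open>
  Vertices of \<open>H\<close> and vertices outside \<open>H \<union> nb H\<close> are never equal or adjacent, so the part of a
  forbidden tuple inside \<open>H\<close> can be replaced by any other part of the same type over \<open>nb H\<close>.
\<close>

lemma exchange:
  assumes u: "\<And>i. i < c \<Longrightarrow> u i < n" "\<And>i. i < c \<Longrightarrow> u i \<notin> H \<Longrightarrow> u i \<in> C"
    and ty: "has_type u \<phi>" "\<phi> \<in> set Phi"
    and q: "\<And>i. i < c \<Longrightarrow> u i \<in> H \<Longrightarrow> q i \<in> H" "\<And>i. i < c \<Longrightarrow> u i \<in> nb H \<Longrightarrow> q i = u i"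
      "\<And>i j. i < c \<Longrightarrow> j < c \<Longrightarrow> u i \<in> H \<union> nb H \<Longrightarrow> u j \<in> H \<union> nb H \<Longrightarrow>
         digit (q i) (q j) = digit (u i) (u j)"
  obtains i where "i < c" "u i \<in> H" "q i \<notin> C"
proof -
  \<comment> \<open>The mixed tuple has the forbidden type, so it cannot lie in \<open>C\<close>.
    Entries outside \<open>H\<close> are unchanged and in \<open>C\<close>, so a replaced entry is
    to blame.\<close>
  define u' where "u' i = (if u i \<in> H \<union> nb H then q i else u i)" for i
  have far: "digit x y = 0 \<and> digit y x = 0" if "x \<in> H" "y \<notin> H \<union> nb H" "y < n" for x y
    using that adj_sym by (auto simp: digit_def nb_def)
  have "digit (u' i) (u' j) = digit (u i) (u j)" if ij: "i < c" "j < c" for i j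
  proof (cases "u i \<in> H \<union> nb H"; cases "u j \<in> H \<union> nb H")
    assume a: "u i \<in> H \<union> nb H" "u j \<notin> H \<union> nb H"
    then show ?thesis using far[OF _ a(2)] q(1,2)[OF ij(1)] u(1)[OF ij(2)] by (auto simp: u'_def)
  next
    assume a: "u i \<notin> H \<union> nb H" "u j \<in> H \<union> nb H"
    then show ?thesis using far[OF _ a(1)] q(1,2)[OF ij(2)] u(1)[OF ij(1)] by (auto simp: u'_def)
  qed (use q(3) ij in \<open>auto simp: u'_def\<close>)
  then have "has_type u' \<phi>" using ty(1) by (simp add: has_type_def)
  then obtain i where i: "i < c" "u' i \<notin> C" using free_C ty(2) by (auto simp: free_def)
  have "u i \<in> H"
  proof (rule ccontr)
    assume "u i \<notin> H"
    moreover from this have "u' i = u i" using q(2)[OF i(1)] by (auto simp: u'_def)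
    ultimately show False using u(2)[OF i(1)] i by simp
  qed
  with i that show ?thesis by (auto simp: u'_def)
qed

text \<open>Positions far from \<open>H\<close> are filled with \<open>u i0\<close>, a vertex of
  \<open>H\<close>, so that the described tuple stays within \<open>H\<close> and its boundary.
  Nothing relates the filler to the far entries it stands for; \<open>exchange\<close> only compares
  near positions.\<close>

lemma guess_exists:
  assumes u: "\<And>i. i < c \<Longrightarrow> u i < n" "i0 < c" "u i0 \<in> H"
    and D: "D \<subseteq> {..<n}" "card D \<le> t" "\<And>i. i < c \<Longrightarrow> u i \<in> nb H \<Longrightarrow> u i \<in> D"
    and a: "a < t + c + 6"
  obtains g where "\<And>i. g i < t + c + 6" "g 0 = a"
    "matches g D H (\<lambda>i. if u i \<in> H \<union> nb H then u i else u i0)"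
    "\<And>i. i < c \<Longrightarrow> u i \<in> nb H \<Longrightarrow> g (3 + i) \<noteq> 0 \<and> pick D (g (3 + i) - 1) = u i"
    "\<And>i. i < c \<Longrightarrow> u i \<notin> nb H \<Longrightarrow> g (3 + i) = 0"
proof -
  define q where "q i = (if u i \<in> H \<union> nb H then u i else u i0)" for i
  have "\<exists>j<card D. pick D j = u i" if "i < c" "u i \<in> nb H" for i
    using pick_surj[OF D(1), of "u i"] D(3)[OF that] by blast
  then obtain r where r: "\<And>i. i < c \<Longrightarrow> u i \<in> nb H \<Longrightarrow> r i < card D \<and> pick D (r i) = u i"
    by metis
  define g where "g k = (if k = 0 then a else if k < 3 then 0
     else if k < 3 + c then (if u (k - 3) \<in> nb H then Suc (r (k - 3)) else 0)
     else digit (q ((k - 3 - c) div c)) (q ((k - 3 - c) mod c)))" for k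
  have gp: "g (3 + c + i * c + j) = digit (q i) (q j)" if "j < c" for i j
    using that by (simp add: g_def)
  have gr: "g (3 + i) = (if u i \<in> nb H then Suc (r i) else 0)" if "i < c" for i
    using that by (simp add: g_def)
  show ?thesis
  proof (rule that[of g])
    show "g i < t + c + 6" for i
    proof (cases "3 \<le> i \<and> i < 3 + c \<and> u (i - 3) \<in> nb H")
      case True
      then have "i - 3 < c" by arith
      then have "r (i - 3) < t" using True r[of "i - 3"] D(2) by auto
      with True show ?thesis by (simp add: g_def)
    qed (use a in \<open>auto simp: g_def digit_def\<close>)
    show "matches g D H (\<lambda>i. if u i \<in> H \<union> nb H then u i else u i0)"
      unfolding q_def[symmetric] matches_def has_type_def using gp gr u r
      by (auto simp: q_def)
  qed (use gr r in \<open>auto simp: g_def\<close>)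
qed

text \<open>Index and offset can therefore be set last, once the tuple or level determined by the
  other digits is known.\<close>

lemma matches_upd: "k = 1 \<or> k = 2 \<Longrightarrow> matches (g(k := x)) = matches g"
  by (auto simp: fun_eq_iff matches_def has_type_def)

definition inv :: "nat set \<Rightarrow> nat set \<Rightarrow> bool" where
  "inv S T \<longleftrightarrow> S \<noteq> {} \<and> S \<subseteq> C \<and> C \<inter> T = {}"

lemma inv_sep: "inv S T \<Longrightarrow> sep S T C" "inv S T \<Longrightarrow> sep S T S"
  using C_subset by (auto simp: inv_def sep_def)

lemma lam_le_t: "inv S T \<Longrightarrow> lam S T \<le> t"
  using lam_le[OF inv_sep(1)] nb_C by fastforce

text \<open>\<open>C \<inter> Rmin L T\<close> still separates and so has at least
  \<open>lam S T\<close> neighbours; by submodularity the union has at most as many neighbours as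
  \<open>C\<close>. It is connected and larger than \<open>C\<close>, so by maximality it is not
  free.\<close>

lemma forbidden_in_Un:
  assumes i: "inv S T" and m: "mincut S T (Rmin L T)" and L: "sep L T L"
    and near: "\<And>s. s \<in> L \<Longrightarrow> s \<in> C \<or> (\<exists>a\<in>C. adj a s)" and new: "\<not> Rmin L T \<subseteq> C"
  obtains u \<phi> where "\<And>i. i < c \<Longrightarrow> u i \<in> C \<union> Rmin L T" "has_type u \<phi>" "\<phi> \<in> set Phi"
proof -
  let ?R = "Rmin L T"
  have "sep S T (C \<inter> ?R)" using inv_sep(1)[OF i] m by (auto simp: mincut_def sep_def)
  from lam_le[OF this] have "card (nb (C \<union> ?R)) \<le> t"
    using nb_submodular[of C ?R] nb_C m by (simp add: mincut_def)
  moreover have "conn (C \<union> ?R)" using conn_Un_Rmin[OF conn_C L near] .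
  moreover have "C \<union> ?R \<subseteq> {..<n}" using C_subset m by (auto simp: mincut_def sep_def)
  ultimately have "\<not> free (C \<union> ?R)" using maximal_C[of "C \<union> ?R"] new by blast
  then show ?thesis using that by (auto simp: free_def)
qed

lemma op0:
  assumes i: "inv S T" and new: "\<not> Rmin S T \<subseteq> C"
  obtains g u where "\<And>i. g i < t + c + 6" "u \<in> Rmin S T" "u \<notin> C" "step g (S, T) = (S, insert u T)"
proof -
  let ?B = "Rmin S T"
  have m: "mincut S T ?B" using mincut_Rmin[OF inv_sep(2)[OF i]] .
  have near: "s \<in> C \<or> (\<exists>a\<in>C. adj a s)" if "s \<in> S" for s using that i by (auto simp: inv_def)
  obtain u \<phi> where u: "\<And>i. i < c \<Longrightarrow> u i \<in> C \<union> ?B" and ty: "has_type u \<phi>" "\<phi> \<in> set Phi"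
    by (rule forbidden_in_Un[OF i m inv_sep(2)[OF i] near new]) blast+
  obtain i0 where i0: "i0 < c" "u i0 \<in> ?B" using free_C ty u unfolding free_def by blast
  have un: "u i < n" if "i < c" for i using u[OF that] C_subset m by (auto simp: mincut_def sep_def)
  have nt: "card (nb ?B) \<le> t" using lam_le_t[OF i] m by (simp add: mincut_def)
  obtain g where g: "\<And>i. g i < t + c + 6" "g 0 = 0"
    "matches g (nb ?B) ?B (\<lambda>i. if u i \<in> ?B \<union> nb ?B then u i else u i0)"
    "\<And>i. i < c \<Longrightarrow> u i \<in> nb ?B \<Longrightarrow> g (3 + i) \<noteq> 0 \<and> pick (nb ?B) (g (3 + i) - 1) = u i"
    "\<And>i. i < c \<Longrightarrow> u i \<notin> nb ?B \<Longrightarrow> g (3 + i) = 0"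
    by (rule guess_exists[of u i0 ?B "nb ?B" 0, OF un i0 nb_subset nt]) auto
  let ?P = "matches g (nb ?B) ?B"
  define F where "F = lexfirst ?P c"
  obtain q where q: "?P q" "\<And>j. j < c \<Longrightarrow> q j = F j"
  proof -
    have "\<forall>i<c. q i < n" if "?P q" for q using that by (simp add: matches_def)
    then show thesis using lexfirst_prefix[of ?P, OF g(3) _ order.refl] that by (auto simp: F_def)
  qed
  \<comment> \<open>Root digit 0 forces membership in \<open>?B\<close>. This places the new
    terminal in \<open>Rmin S T\<close>, and so adding it to \<open>T\<close> raises the cut
    value.\<close>
  have qB: "q i \<in> ?B" if "i < c" "u i \<in> ?B" for i
    using q(1) g(5)[OF that(1)] that by (auto simp: matches_def nb_def)
  have qN: "q i = u i" if "i < c" "u i \<in> nb ?B" for i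
    using q(1) g(4)[OF that] that(1) by (auto simp: matches_def)
  have "digit (q i) (q j) = digit (u i) (u j)"
    if "i < c" "j < c" "u i \<in> ?B \<union> nb ?B" "u j \<in> ?B \<union> nb ?B" for i j
    using q(1) g(3) that unfolding matches_def has_type_def by fastforce
  then obtain i1 where i1: "i1 < c" "u i1 \<in> ?B" "q i1 \<notin> C"
    by (rule_tac exchange[of u ?B \<phi> q]) (use un u ty qB qN in \<open>blast+\<close>)
  show ?thesis
  proof (rule that[of "g(1 := i1)" "F i1"])
    show "step (g(1 := i1)) (S, T) = (S, insert (F i1) T)"
      by (simp add: step_def Let_def matches_upd F_def g(2) i1(1))
    show "(g(1 := i1)) i < t + c + 6" for i using g(1) i1(1) by (simp add: trans_less_add1)
    show "F i1 \<in> ?B" "F i1 \<notin> C" using q(2)[OF i1(1)] i1 qB[OF i1(1,2)] by auto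
  qed
qed

lemma op2:
  assumes i: "inv S T" and CM: "C \<subseteq> Rmax S T"
    and li: "level S T k \<subseteq> C" and new: "\<not> level S T (Suc k) \<subseteq> C"
  obtains g where "\<And>i. g i < t + c + 6" "step g (S, T) = (level S T k, T)"
proof -
  note sp = inv_sep(2)[OF i]
  let ?M = "Rmax S T" and ?H = "level S T" and ?D = "nb (Rmin S T)"
  let ?L = "lnext ?M (?H k)"
  note L = lnext_mincut[OF mincut_level[OF sp, of k] sp]
  have near: "s \<in> C \<or> (\<exists>a\<in>C. adj a s)" if "s \<in> ?L" for s
    using that li by (auto simp: lnext_def nb_def)
  obtain u \<phi> where u: "\<And>i. i < c \<Longrightarrow> u i \<in> C \<union> ?H (Suc k)" and ty: "has_type u \<phi>" "\<phi> \<in> set Phi"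
    by (rule forbidden_in_Un[OF i L(3,1) near]) (use new in \<open>simp; blast\<close>)+
  have uM: "u i \<in> ?M" if "i < c" for i using u[OF that] CM level_le_Rmax[OF sp, of "Suc k"] by blast
  have "\<exists>l\<in>{Suc k..Suc k + c}. \<forall>i<c. u i \<notin> nb (?H l)"
  proof (rule ccontr)
    \<comment> \<open>Otherwise \<open>f\<close> maps \<open>c + 1\<close> levels injectively to
      \<open>c\<close> positions: an entry lies inside \<open>Rmax\<close>, hence on the boundary of
      at most one level.\<close>
    assume "\<not> ?thesis"
    then obtain f where f: "\<And>l. l \<in> {Suc k..Suc k + c} \<Longrightarrow> f l < c \<and> u (f l) \<in> nb (?H l)"
      by metis
    have "f l \<noteq> f l'" if "l \<in> {Suc k..Suc k + c}" "l' \<in> {Suc k..Suc k + c}" "l < l'" for l l'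
    proof -
      have "u (f l) \<notin> nb ?M" using uM f[OF that(1)] by (auto simp: nb_def)
      then show ?thesis using nb_level_disjoint[OF sp that(3)] f[OF that(1)] f[OF that(2)] by metis
    qed
    then have "inj_on f {Suc k..Suc k + c}" by (intro linorder_inj_onI') auto
    then have "card {Suc k..Suc k + c} \<le> card {..<c}"
      by (rule card_inj_on_le) (use f in auto)
    then show False by simp
  qed
  then obtain l where l: "Suc k \<le> l" "l \<le> Suc k + c" and ul: "\<And>i. i < c \<Longrightarrow> u i \<notin> nb (?H l)" by auto
  have Hl: "?H (Suc k) \<subseteq> ?H l" using level_mono[OF sp l(1)] .
  obtain i0 where i0: "i0 < c" "u i0 \<in> ?H l" using free_C ty u Hl unfolding free_def by blast
  have un: "u i < n" if "i < c" for i
    using uM[OF that] mincut_Rmax[OF sp] by (auto simp: mincut_def sep_def)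
  have nt: "card ?D \<le> t" using lam_le_t[OF i] mincut_Rmin[OF sp] by (simp add: mincut_def)
  obtain g where g: "\<And>i. g i < t + c + 6" "g 0 = 2"
    "matches g ?D (?H l) (\<lambda>i. if u i \<in> ?H l \<union> nb (?H l) then u i else u i0)"
    "\<And>i. i < c \<Longrightarrow> g (3 + i) = 0"
    by (rule guess_exists[of u i0 "?H l" ?D 2, OF un i0 nb_subset nt]) (use ul in auto)
  define P where "P = (\<lambda>l. \<exists>q. matches g ?D (?H l) q)"
  define p where "p = lst (2 * n) P"
  \<comment> \<open>Levels are constant from \<open>n\<close> on, so \<open>l\<close> can be lowered
    into the search range below \<open>2 * n\<close>.\<close>
  have "P (min l n)"
    using g(3) level_stable(2)[OF sp, of l] by (auto simp: P_def min_def)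
  moreover have "n > 0" using un[OF i0(1)] by simp
  ultimately have p: "P p" "p \<le> min l n" using lst_found[of "min l n" "2 * n" P] by (auto simp: p_def)
  then obtain q where q: "matches g ?D (?H p) q" by (auto simp: P_def)
  have qp: "q i \<in> ?H p" if "i < c" for i using q g(4)[OF that] that by (auto simp: matches_def)
  have ql: "q i \<in> ?H l" if "i < c" for i using qp[OF that] level_mono[OF sp, of p l] p by auto
  have "digit (q i) (q j) = digit (u i) (u j)" if "i < c" "j < c"
      "u i \<in> ?H l \<union> nb (?H l)" "u j \<in> ?H l \<union> nb (?H l)" for i j
    using q g(3) that unfolding matches_def has_type_def by fastforce
  then obtain i1 where "i1 < c" "q i1 \<notin> C"
    by (rule_tac exchange[of u "?H l" \<phi> q]) (use un u ty ql ul Hl in \<open>blast+\<close>)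
  \<comment> \<open>A match inside level \<open>k\<close> would lie entirely in \<open>C\<close>,
    but exchange produced an entry outside \<open>C\<close>.\<close>
  then have "k < p" using qp[of i1] li level_mono[OF sp, of p k] by (meson not_le subsetD)
  show ?thesis
  proof (rule that[of "g(2 := p - k)"])
    show "step (g(2 := p - k)) (S, T) = (?H k, T)"
      using \<open>k < p\<close> by (simp add: step_def Let_def matches_upd g(2) p_def[symmetric] P_def[symmetric])
    show "(g(2 := p - k)) i < t + c + 6" for i using g(1) p l by auto
  qed
qed

text \<open>The guess asks for the digit 3, which is never realised. The search fails, its default
  \<open>2 * n\<close> selects the stable level, and that level is \<open>C\<close>.\<close>

lemma op2_final:
  assumes i: "inv S T" and CM: "C \<subseteq> Rmax S T" and all: "\<And>k. level S T k \<subseteq> C"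
  obtains g where "\<And>i. g i < t + c + 6" "fst (step g (S, T)) = C"
proof (rule that[of "\<lambda>k. if k = 0 then 2 else if k = 2 then 0 else 3"])
  note sp = inv_sep(2)[OF i]
  let ?g = "\<lambda>k. if k = 0 then 2 else if k = 2 then 0 else 3 :: nat"
  have no: "\<not> matches ?g D B q" for D B q
    using c_pos by (auto simp: matches_def has_type_def digit_def intro!: exI[of _ 0])
  have H: "level S T (2 * n) = level S T n" using level_stable(2)[OF sp, of "2 * n"] by simp
  have "level S T n \<noteq> {}"
    using i mincut_level[OF sp, of n] by (auto simp: inv_def mincut_def sep_def)
  note ne0 = this
  \<comment> \<open>By connectedness a larger \<open>C\<close> would contain a boundary vertex of
    the last level, thus of \<open>Rmax\<close>, although \<open>C\<close> lies inside
    \<open>Rmax\<close>.\<close>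
  have C: "C = level S T n"
  proof (rule ccontr)
    assume ne: "C \<noteq> level S T n"
    obtain x where "x \<in> C" "x \<in> nb (level S T n)"
      using conn_crossing[OF conn_C all ne0 C_subset ne] .
    with level_stable(1)[OF sp] CM show False by (auto simp: nb_def)
  qed
  have e: "Ex (matches ?g D B) = False" for D B using no by blast
  from C show "fst (step ?g (S, T)) = C" by (simp add: step_def Let_def lst_def H e)
qed auto

text \<open>The condition \<open>sep S T S\<close> is carried along because the compiled step is
  proved correct for such pairs.\<close>

primrec win :: "nat \<Rightarrow> nat set \<Rightarrow> nat set \<Rightarrow> bool" where
  "win 0 S T \<longleftrightarrow> S = C"
| "win (Suc k) S T \<longleftrightarrow> sep S T S \<and>
     (\<exists>g. (\<forall>i. g i < t + c + 6) \<and> win k (fst (step g (S, T))) (snd (step g (S, T))))"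

lemma win_mono: assumes "win k S T" "sep S T S" "k \<le> k'" shows "win k' S T"
  using assms(3)
proof (induction k' rule: dec_induct)
  case (step m)
  have "step (\<lambda>_. 5) (S, T) = (S, T)" by (simp add: step_def)
  with step assms(2) show ?case by (auto intro!: exI[of _ "\<lambda>_. 5"])
qed (rule assms(1))

lemma winI:
  assumes "sep S T S" "\<And>i. g i < t + c + 6" "step g (S, T) = (S', T')" "win k S' T'"
  shows "win (Suc k) S T"
  using assms by (auto intro!: exI[of _ g])

declare win.simps(2) [simp del]

text \<open>The second half of the potential: vertices of \<open>T\<close> adjacent to
  \<open>S\<close> are on the boundary of every separating set.\<close>

definition fx :: "nat set \<Rightarrow> nat set \<Rightarrow> nat" where
  "fx S T = card (nb S \<inter> T)"

lemma fx_mono: "S \<subseteq> S' \<Longrightarrow> T \<subseteq> T' \<Longrightarrow> S' \<inter> T' = {} \<Longrightarrow> fx S T \<le> fx S' T'"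
  unfolding fx_def by (rule card_mono) (auto simp: nb_def)

lemma fx_le_lam: assumes "sep S T S" shows "fx S T \<le> lam S T"
proof -
  have m: "mincut S T (Rmin S T)" using mincut_Rmin[OF assms] .
  then have "nb S \<inter> T \<subseteq> nb (Rmin S T)" by (auto simp: mincut_def sep_def nb_def)
  then show ?thesis using m card_mono[OF finite_nb] by (metis fx_def mincut_def)
qed

text \<open>Minimum cuts for the level as source are minimum cuts for \<open>S\<close> too, and
  \<open>Rmax S T\<close> is among them. So code 4 advances towards the same furthest cut.\<close>

lemma Rmax_level:
  assumes sp: "sep S T S" shows "Rmax (level S T k) T = Rmax S T"
proof -
  have m: "mincut S T (level S T k)" using mincut_level[OF sp] .
  have M: "mincut S T (Rmax S T)" using mincut_Rmax[OF sp] .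
  have S: "S \<subseteq> level S T k" using m by (auto simp: mincut_def sep_def)
  note ms = mincut_of_superset[OF M S level_le_Rmax[OF sp]]
  have "mincut S T R" if "mincut (level S T k) T R" for R
    using that S ms(1) by (auto simp: mincut_def sep_def)
  then show ?thesis using Rmax_greatest[OF ms(2)] by (auto simp: Rmax_def)
qed

text \<open>Induction on the missing potential. A round takes one step (a terminal that raises
  \<open>lam\<close>), two (jump to a level, then fix a boundary vertex), or three (jump, advance,
  then a terminal that raises \<open>lam\<close>).\<close>

theorem win_all:
  assumes "inv S T" "2 * t \<le> lam S T + fx S T + k"
  shows "win (3 * k + 1) S T"
  using assms
proof (induction k arbitrary: S T rule: less_induct)
  case (less k)
  note i = less.prems(1) and sp = inv_sep(2)[OF less.prems(1)]
  have IH: "win (3 * (k - 1) + 1) S' T'"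
    if "inv S' T'" "lam S T + fx S T < lam S' T' + fx S' T'" for S' T'
  proof -
    have "lam S' T' + fx S' T' \<le> 2 * t"
      using fx_le_lam[OF inv_sep(2)[OF that(1)]] lam_le_t[OF that(1)] by simp
    then have "k > 0" using that less.prems(2) by linarith
    then show ?thesis using less.IH[of "k - 1" S' T'] that less.prems(2) by auto
  qed
  have pad: "win (3 * k + 1) S T" if "win j S T" "k > 0" "j \<le> 3 * (k - 1) + 4" for j
    by (rule win_mono[OF that(1) sp]) (use that in simp)
  have IHpos: "k > 0"
    if "inv S' T'" "lam S T + fx S T < lam S' T' + fx S' T'" for S' T'
    using fx_le_lam[OF inv_sep(2)[OF that(1)]] lam_le_t[OF that(1)] that less.prems(2) by linarith
  have viaRmin: "win (Suc (3 * (k - 1) + 1)) S2 T \<and> k > 0"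
    if i2: "inv S2 T" "\<not> Rmin S2 T \<subseteq> C" "lam S T \<le> lam S2 T" "fx S T \<le> fx S2 T" for S2
  proof -
    obtain g u where g: "\<And>i. g i < t + c + 6" "u \<in> Rmin S2 T" "u \<notin> C"
      "step g (S2, T) = (S2, insert u T)" by (rule op0[OF i2(1,2)]) blast
    have i': "inv S2 (insert u T)" using i2 g by (auto simp: inv_def)
    have "lam S2 T < lam S2 (insert u T)" using lam_less_insert_right[OF g(2) inv_sep(2)[OF i']] .
    moreover have "fx S2 T \<le> fx S2 (insert u T)" using i' by (intro fx_mono) (auto simp: inv_def)
    ultimately have l: "lam S T + fx S T < lam S2 (insert u T) + fx S2 (insert u T)" using i2 by simp
    show ?thesis using winI[OF inv_sep(2)[OF i2(1)] g(1,4) IH[OF i' l]] IHpos[OF i' l] by simp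
  qed
  show ?case
  proof (cases "Rmin S T \<subseteq> C")
    case False
    have w: "win (Suc (3 * (k - 1) + 1)) S T \<and> k > 0" using viaRmin[OF i False] by simp
    then show ?thesis by (intro pad[of "Suc (3 * (k - 1) + 1)"]) auto
  next
    case B: True
    show ?thesis
    proof (cases "C \<subseteq> Rmax S T")
      case False
      let ?M = "Rmax S T"
      have M: "mincut S T ?M" using mincut_Rmax[OF sp] .
      have "C \<inter> ?M \<noteq> {}" "C \<noteq> C \<inter> ?M"
        using i M False by (auto simp: inv_def mincut_def sep_def)
      \<comment> \<open>\<open>x\<close> lies in \<open>C\<close> but not in
        \<open>C \<inter> ?M\<close>, hence outside \<open>?M\<close>, and a digit can name it as a
        boundary vertex of \<open>?M\<close>.\<close>
      then obtain x where x: "x \<in> C" "x \<in> nb (C \<inter> ?M)"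
        using conn_crossing[OF conn_C, of "C \<inter> ?M"] C_subset by blast
      then have xM: "x \<in> nb ?M" by (auto simp: nb_def)
      obtain j where j: "j < card (nb ?M)" "pick (nb ?M) j = x"
        using pick_surj[OF _ xM] by (auto simp: nb_def)
      have jt: "j < t" using j M lam_le_t[OF i] by (simp add: mincut_def)
      have i': "inv (insert x S) T" using i x by (auto simp: inv_def)
      have "lam S T < lam (insert x S) T"
        using lam_less_insert_left[of x S T] inv_sep(2)[OF i'] xM by (auto simp: nb_def)
      moreover have "fx S T \<le> fx (insert x S) T" using i' by (intro fx_mono) (auto simp: inv_def)
      ultimately have l: "lam S T + fx S T < lam (insert x S) T + fx (insert x S) T" by simp
      have "win (Suc (3 * (k - 1) + 1)) S T"
        by (rule winI[OF sp _ _ IH[OF i' l], of "\<lambda>k. if k = 1 then j else 1"])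
           (use jt j in \<open>auto simp: step_def\<close>)
      then show ?thesis by (rule pad) (use IHpos[OF i' l] in auto)
    next
      case CM: True
      show ?thesis
      proof (cases "\<forall>k. level S T k \<subseteq> C")
        case True
        obtain g where g: "\<And>i. g i < t + c + 6" "fst (step g (S, T)) = C"
          using op2_final[OF i CM] True by blast
        then have "win 1 S T" using winI[of S T g C "snd (step g (S, T))" 0] sp
          by (simp add: prod_eq_iff)
        then show ?thesis by (rule win_mono[OF _ sp]) simp
      next
        case False
        then obtain l where "\<not> level S T l \<subseteq> C" by blast
        with B obtain l where H: "level S T l \<subseteq> C" and new: "\<not> level S T (Suc l) \<subseteq> C"
          using dec_induct[of 0 l "\<lambda>l. level S T l \<subseteq> C"] by auto
        obtain g where g: "\<And>i. g i < t + c + 6" "step g (S, T) = (level S T l, T)"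
          by (rule op2[OF i CM H new]) blast
        let ?S1 = "level S T l" and ?M = "Rmax S T"
        have m1: "mincut S T ?S1" using mincut_level[OF sp] .
        have i1: "inv ?S1 T" using i H m1 by (auto simp: inv_def mincut_def sep_def)
        note sp1 = inv_sep(2)[OF i1]
        have S1: "S \<subseteq> ?S1" "?S1 \<inter> T = {}" using m1 by (auto simp: mincut_def sep_def)
        have lam1: "lam ?S1 T = lam S T" by (rule mincut_of_superset(1)[OF m1 S1(1) order.refl])
        have fx1: "fx S T \<le> fx ?S1 T" using S1 by (intro fx_mono) auto
        have M1: "?S1 \<subseteq> ?M" "?M \<inter> T = {}"
          using level_le_Rmax[OF sp] mincut_Rmax[OF sp] by (auto simp: mincut_def sep_def)
        show ?thesis
        proof (cases "nb ?S1 - nb ?M \<subseteq> C")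
          case False
          then obtain x where x: "x \<in> nb ?S1" "x \<notin> nb ?M" "x \<notin> C" by blast
          obtain j where j: "j < card (nb ?S1)" "pick (nb ?S1) j = x"
            using pick_surj[OF _ x(1)] by (auto simp: nb_def)
          have jt: "j < t" using j m1 lam_le_t[OF i] by (simp add: mincut_def)
          have i': "inv ?S1 (insert x T)" using i1 x by (auto simp: inv_def)
          \<comment> \<open>Being adjacent to \<open>?M\<close> but not on its boundary,
            \<open>x\<close> lies in \<open>?M\<close>, which avoids \<open>T\<close>: fixing
            \<open>x\<close> is real progress.\<close>
          have "x \<notin> T" using x M1 by (auto simp: nb_def)
          have "nb ?S1 \<inter> insert x T = insert x (nb ?S1 \<inter> T)" using x by auto
          then have "fx ?S1 T < fx ?S1 (insert x T)" using \<open>x \<notin> T\<close> by (simp add: fx_def)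
          moreover have "lam ?S1 T \<le> lam ?S1 (insert x T)"
            using lam_mono[of ?S1 ?S1 T "insert x T"] inv_sep(2)[OF i'] by auto
          ultimately have l: "lam S T + fx S T < lam ?S1 (insert x T) + fx ?S1 (insert x T)"
            using lam1 fx1 by simp
          have "win (Suc (3 * (k - 1) + 1)) ?S1 T"
            by (rule winI[OF sp1 _ _ IH[OF i' l], of "\<lambda>k. if k = 1 then j else 3"])
               (use jt j in \<open>auto simp: step_def\<close>)
          then have "win (Suc (Suc (3 * (k - 1) + 1))) S T" using winI[OF sp g] by blast
          then show ?thesis by (rule pad) (use IHpos[OF i' l] in auto)
        next
          case True
          let ?S2 = "lnext ?M ?S1"
          have i2: "inv ?S2 T"
            using i1 True H lnext_bounds[OF m1 sp] by (auto simp: inv_def lnext_def)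
          have S12: "?S1 \<subseteq> ?S2" using lnext_bounds[OF m1 sp] by simp
          have "fx ?S1 T \<le> fx ?S2 T" using i2 S12 by (intro fx_mono) (auto simp: inv_def)
          \<comment> \<open>\<open>Rmin ?S2 T\<close> is the next level, which is not inside
            \<open>C\<close>, so the first case applies with \<open>?S2\<close> as source.\<close>
          then have w: "win (Suc (3 * (k - 1) + 1)) ?S2 T \<and> k > 0"
            using viaRmin[OF i2] new lnext_mincut(2)[OF m1 sp] fx1 by simp
          have "win (Suc (Suc (3 * (k - 1) + 1))) ?S1 T"
            by (rule winI[OF sp1, of "\<lambda>_. 4" ?S2 T])
               (use w Rmax_level[OF sp] in \<open>auto simp: step_def\<close>)
          then have "win (Suc (Suc (Suc (3 * (k - 1) + 1)))) S T" using winI[OF sp g] by blast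
          then show ?thesis by (rule pad) (use w in auto)
        qed
      qed
    qed
  qed
qed

end

section \<open>Path reversal in the split graph\<close>

definition dout :: "(nat \<times> nat) set \<Rightarrow> nat set \<Rightarrow> nat" where
  "dout A Y = card {(x, y) \<in> A. x \<in> Y \<and> y \<notin> Y}"

text \<open>
  Reversing one arc changes every out-degree by a quantity that depends on its two ends only, so
  reversing a path from a source to a sink lowers the out-degree of every source-sink cut by one.
\<close>

lemma dout_reverse:
  assumes "finite A" "(x, z) \<in> A" "(z, x) \<notin> A"
  shows "dout (insert (z, x) (A - {(x, z)})) Y + of_bool (x \<in> Y) = dout A Y + of_bool (z \<in> Y)"
proof -
  let ?D = "\<lambda>B. {(x, y) \<in> B. x \<in> Y \<and> y \<notin> Y}"
  have fin: "finite (?D A)" using assms(1) by (rule finite_subset[rotated]) auto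
  have sub: "?D (insert (z, x) (A - {(x, z)}))
    = (if z \<in> Y \<and> x \<notin> Y then insert (z, x) (?D A) else ?D A) - (if x \<in> Y \<and> z \<notin> Y then {(x, z)} else {})"
    using assms(2,3) by auto
  have "card (?D A) > 0" if "x \<in> Y \<and> z \<notin> Y"
    using that fin assms(2) by (auto simp: card_gt_0_iff)
  then show ?thesis
    unfolding dout_def sub using fin assms(2,3) by (auto simp: card_Diff_singleton_if)
qed

lemma dout_mono_zero: "finite A \<Longrightarrow> dout A Y = 0 \<Longrightarrow> (x, y) \<in> A \<Longrightarrow> x \<in> Y \<Longrightarrow> y \<in> Y"
proof -
  assume a: "finite A" "dout A Y = 0" "(x, y) \<in> A" "x \<in> Y"
  have "finite {(x, y) \<in> A. x \<in> Y \<and> y \<notin> Y}" using a(1) by (rule finite_subset[rotated]) auto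
  then have "{(x, y) \<in> A. x \<in> Y \<and> y \<notin> Y} = {}" using a(2) by (simp add: dout_def)
  with a show ?thesis by auto
qed

context sgraph
begin

text \<open>Vertex \<open>v\<close> is split into an entry \<open>v\<close> and an exit \<open>v + n\<close>.\<close>

definition arcs0 :: "(nat \<times> nat) set" where
  "arcs0 = {(x, y). x < 2 * n \<and> y < 2 * n \<and> (y = x + n \<or> (n \<le> x \<and> y < n \<and> adj (x - n) y))}"

text \<open>The sinks are exits of \<open>T\<close>, not entries, so that vertices of
  \<open>T\<close> may be cut.\<close>

definition valid :: "nat set \<Rightarrow> nat set \<Rightarrow> nat set \<Rightarrow> bool" where
  "valid S T Y \<longleftrightarrow> Y \<subseteq> {..<2 * n} \<and> (\<forall>v\<in>S. v < n \<longrightarrow> v + n \<in> Y) \<and> (\<forall>v\<in>T. v + n \<notin> Y)"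

text \<open>The source side of the cut that severs exactly the split arcs of
  \<open>nb R\<close>.\<close>

definition Ycut :: "nat set \<Rightarrow> nat set" where
  "Ycut R = R \<union> nb R \<union> (\<lambda>v. v + n) ` R"

lemma finite_arcs0: "finite arcs0"
  by (rule finite_subset[of _ "{..<2 * n} \<times> {..<2 * n}"]) (auto simp: arcs0_def)

lemma arcs0_antisym: "(x, y) \<in> arcs0 \<Longrightarrow> (y, x) \<notin> arcs0"
  using adj_irrefl by (auto simp: arcs0_def)

lemma Ycut_valid:
  assumes "sep S T R" shows "valid S T (Ycut R)" "dout arcs0 (Ycut R) = card (nb R)"
proof -
  have R: "R \<subseteq> {..<n}" "S \<subseteq> R" "R \<inter> T = {}" using assms by (auto simp: sep_def)
  then show "valid S T (Ycut R)" by (auto simp: valid_def Ycut_def nb_def)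
  have "{(x, y) \<in> arcs0. x \<in> Ycut R \<and> y \<notin> Ycut R} = (\<lambda>v. (v, v + n)) ` nb R"
    using R by (auto simp: arcs0_def Ycut_def nb_def)
  then show "dout arcs0 (Ycut R) = card (nb R)"
    by (simp add: dout_def card_image inj_on_def)
qed

text \<open>Unit capacity on all arcs suffices: a boundary vertex with its entry in \<open>Y\<close>
  is charged its split arc, any other one an arc that enters it. Distinct vertices are charged
  distinct arcs.\<close>

lemma cut_of_valid:
  assumes "valid S T Y" "S \<subseteq> {..<n}" defines "R \<equiv> {v. v < n \<and> v + n \<in> Y}"
  shows "sep S T R" "card (nb R) \<le> dout arcs0 Y"
proof -
  show "sep S T R" using assms by (auto simp: sep_def valid_def)
  let ?D = "{(x, y) \<in> arcs0. x \<in> Y \<and> y \<notin> Y}"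
  have "\<forall>w\<in>nb R. \<exists>e. e \<in> ?D \<and> (e = (w, w + n) \<or> (n \<le> fst e \<and> snd e = w))"
  proof
    fix w assume "w \<in> nb R"
    then obtain u where u: "w < n" "w + n \<notin> Y" "u < n" "u + n \<in> Y" "adj u w"
      by (auto simp: nb_def R_def)
    show "\<exists>e. e \<in> ?D \<and> (e = (w, w + n) \<or> (n \<le> fst e \<and> snd e = w))"
    proof (cases "w \<in> Y")
      case True
      then show ?thesis using u by (intro exI[of _ "(w, w + n)"]) (auto simp: arcs0_def)
    next
      case False
      then show ?thesis using u by (intro exI[of _ "(u + n, w)"]) (auto simp: arcs0_def)
    qed
  qed
  from bchoice[OF this] obtain f where
    "\<forall>w\<in>nb R. f w \<in> ?D \<and> (f w = (w, w + n) \<or> (n \<le> fst (f w) \<and> snd (f w) = w))" ..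
  note f = bspec[OF this]
  have inj: "inj_on f (nb R)"
  proof (rule inj_onI)
    fix a b assume ab: "a \<in> nb R" "b \<in> nb R" "f a = f b"
    then have "a < n" "b < n" by (auto simp: nb_def)
    with f[OF ab(1)] f[OF ab(2)] ab(3) show "a = b" by (cases "f b") auto
  qed
  have fin: "finite ?D" using finite_arcs0 by (rule finite_subset[rotated]) auto
  have "f ` nb R \<subseteq> ?D"
  proof
    fix e assume "e \<in> f ` nb R"
    then obtain w where w: "w \<in> nb R" "e = f w" by (rule imageE) simp
    show "e \<in> ?D" unfolding w(2) by (rule conjunct1[OF f[OF w(1)]])
  qed
  then show "card (nb R) \<le> dout arcs0 Y"
    unfolding dout_def by (rule card_inj_on_le[OF inj _ fin])
qed

text \<open>Max-flow min-cut phrased with reversals: \<open>A\<close> is the residual graph after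
  \<open>l\<close> augmentations, and its least closed valid set is the source side of the closest
  minimum cut.\<close>

theorem residual_mincut:
  assumes sp: "sep S T S"
    and inv: "\<And>Y. valid S T Y \<Longrightarrow> dout A Y + l = dout arcs0 Y"
    and Y: "valid S T Y0" "dout A Y0 = 0" "\<And>Y. valid S T Y \<Longrightarrow> dout A Y = 0 \<Longrightarrow> Y0 \<subseteq> Y"
  shows "lam S T = l" "Rmin S T = {v. v < n \<and> v + n \<in> Y0}"
proof -
  let ?R = "{v. v < n \<and> v + n \<in> Y0}"
  have S: "S \<subseteq> {..<n}" using sp by (auto simp: sep_def)
  note R = cut_of_valid[OF Y(1) S]
  have Rl: "card (nb ?R) \<le> l" using R(2) inv[OF Y(1)] Y(2) by simp
  have ge: "l \<le> card (nb R')" if "sep S T R'" for R'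
    using inv[OF Ycut_valid(1)[OF that]] Ycut_valid(2)[OF that] by simp
  obtain R0 where R0: "mincut S T R0" using mincut_exists[OF sp] .
  show l: "lam S T = l"
    using lam_le[OF R(1)] Rl R0 ge[of R0] by (auto simp: mincut_def)
  have m: "mincut S T ?R" using R(1) Rl l by (intro mincutI) auto
  have "?R \<subseteq> R'" if R': "mincut S T R'" for R'
  proof -
    have s: "sep S T R'" using R' by (simp add: mincut_def)
    have "dout A (Ycut R') = 0"
      using inv[OF Ycut_valid(1)[OF s]] Ycut_valid(2)[OF s] R' l by (simp add: mincut_def)
    from Y(3)[OF Ycut_valid(1)[OF s] this] show ?thesis
      using s by (auto simp: Ycut_def sep_def nb_def)
  qed
  with m show "Rmin S T = ?R" by (auto simp: Rmin_def)
qed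

end

section \<open>A loop language and its compilation\<close>

text \<open>Products, quantifiers and minimisation are all derived from the bounded sum
  \<open>Su\<close>.\<close>

datatype ex = V nat | K nat | Pl ex ex | Mi ex ex | Ar nat ex | Su nat ex ex

datatype cmd = As nat ex | Pt nat ex ex | Sq cmd cmd | Fo nat ex cmd

type_synonym st = "(nat \<Rightarrow> nat) \<times> (nat \<Rightarrow> nat \<Rightarrow> nat)"

definition setv :: "nat \<Rightarrow> nat \<Rightarrow> st \<Rightarrow> st" where
  "setv x i s = ((fst s)(x := i), snd s)"

definition seta :: "nat \<Rightarrow> nat \<Rightarrow> nat \<Rightarrow> st \<Rightarrow> st" where
  "seta k i x s = (fst s, (snd s)(k := (snd s k)(i := x)))"

lemma setv_simps [simp]:
  "fst (setv x i s) = (fst s)(x := i)" "snd (setv x i s) = snd s"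
  "fst (seta k j y s) = fst s" "snd (seta k j y s) = (snd s)(k := (snd s k)(j := y))"
  by (simp_all add: setv_def seta_def)

primrec ev :: "ex \<Rightarrow> st \<Rightarrow> nat" where
  "ev (V x) s = fst s x"
| "ev (K m) s = m"
| "ev (Pl a b) s = ev a s + ev b s"
| "ev (Mi a b) s = ev a s - ev b s"
| "ev (Ar k a) s = snd s k (ev a s)"
| "ev (Su x b a) s = (\<Sum>i<ev b s. ev a (setv x i s))"

primrec iter :: "(nat \<Rightarrow> 'a \<Rightarrow> 'a) \<Rightarrow> nat \<Rightarrow> 'a \<Rightarrow> 'a" where
  "iter f 0 s = s"
| "iter f (Suc m) s = f m (iter f m s)"

primrec exec :: "cmd \<Rightarrow> st \<Rightarrow> st" where
  "exec (As x a) = (\<lambda>s. setv x (ev a s) s)"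
| "exec (Pt k a b) = (\<lambda>s. seta k (ev a s) (ev b s) s)"
| "exec (Sq c1 c2) = (\<lambda>s. exec c2 (exec c1 s))"
| "exec (Fo x b c) = (\<lambda>s. iter (\<lambda>i s. exec c (setv x i s)) (ev b s) s)"

text \<open>Exact step counts of the compiled code. \<open>A\<close> is the number of arrays: an
  address takes \<open>A\<close> additions, since the machine cannot multiply.\<close>

primrec tmE :: "ex \<Rightarrow> nat \<Rightarrow> st \<Rightarrow> nat" where
  "tmE (V x) A s = 2"
| "tmE (K m) A s = 1"
| "tmE (Pl a b) A s = tmE a A s + tmE b A s + 1"
| "tmE (Mi a b) A s = tmE a A s + tmE b A s + 1"
| "tmE (Ar k a) A s = tmE a A s + A + 2"
| "tmE (Su x b a) A s = tmE b A s + 4 + (\<Sum>i<ev b s. tmE a A (setv x i s) + 6) + 6"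

primrec tm :: "cmd \<Rightarrow> nat \<Rightarrow> st \<Rightarrow> nat" where
  "tm (As x a) A = (\<lambda>s. tmE a A s + 2)"
| "tm (Pt k a b) A = (\<lambda>s. tmE a A s + A + 1 + tmE b A s + 1)"
| "tm (Sq c1 c2) A = (\<lambda>s. tm c1 A s + tm c2 A (exec c1 s))"
| "tm (Fo x b c) A = (\<lambda>s. tmE b A s + 1 +
     (\<Sum>i<ev b s. tm c A (setv x i (iter (\<lambda>i s. exec c (setv x i s)) i s)) + 7) + 2)"

text \<open>Syntactic bounds: largest variable, largest array and number of temporaries.\<close>

primrec mvE :: "ex \<Rightarrow> nat" where
  "mvE (V x) = x" | "mvE (K m) = 0" | "mvE (Pl a b) = max (mvE a) (mvE b)"
| "mvE (Mi a b) = max (mvE a) (mvE b)" | "mvE (Ar k a) = mvE a"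
| "mvE (Su x b a) = max x (max (mvE b) (mvE a))"

primrec maE :: "ex \<Rightarrow> nat" where
  "maE (V x) = 0" | "maE (K m) = 0" | "maE (Pl a b) = max (maE a) (maE b)"
| "maE (Mi a b) = max (maE a) (maE b)" | "maE (Ar k a) = max k (maE a)"
| "maE (Su x b a) = max (maE b) (maE a)"

primrec dpE :: "ex \<Rightarrow> nat" where
  "dpE (V x) = 1" | "dpE (K m) = 1" | "dpE (Pl a b) = max (dpE a) (dpE b + 1)"
| "dpE (Mi a b) = max (dpE a) (dpE b + 1)" | "dpE (Ar k a) = max 2 (dpE a)"
| "dpE (Su x b a) = max (dpE b) (dpE a + 3) + 4"

primrec mv :: "cmd \<Rightarrow> nat" where
  "mv (As x a) = max x (mvE a)" | "mv (Pt k a b) = max (mvE a) (mvE b)"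
| "mv (Sq c1 c2) = max (mv c1) (mv c2)" | "mv (Fo x b c) = max x (max (mvE b) (mv c))"

primrec ma :: "cmd \<Rightarrow> nat" where
  "ma (As x a) = maE a" | "ma (Pt k a b) = max k (max (maE a) (maE b))"
| "ma (Sq c1 c2) = max (ma c1) (ma c2)" | "ma (Fo x b c) = max (maE b) (ma c)"

primrec dp :: "cmd \<Rightarrow> nat" where
  "dp (As x a) = dpE a" | "dp (Pt k a b) = max (dpE a) (dpE b + 2)"
| "dp (Sq c1 c2) = max (dp c1) (dp c2)" | "dp (Fo x b c) = max (dpE b) (dp c + 2) + 3"

lemma dpE_pos [simp]: "0 < dpE e"
  by (induction e) auto

text \<open>
  Registers below \<open>nV\<close> hold the variables, registers from \<open>nV\<close> up to \<open>nR\<close> are temporaries, and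
  entry \<open>i\<close> of array \<open>k\<close> lives at address \<open>nR + k + nA * i\<close>.
\<close>

locale layout =
  fixes nV nA nR :: nat
  assumes nA_pos: "0 < nA" and VR: "nV \<le> nR"
begin

text \<open>A register is copied by clearing the target and adding. A sum counts in its bound
  variable, whose old value is kept in a temporary and restored at exit.\<close>

primrec compE :: "ex \<Rightarrow> nat \<Rightarrow> nat \<Rightarrow> ram_instr list" where
  "compE (V x) d p = [Const (nV + d) 0, Add (nV + d) (nV + d) x]"
| "compE (K m) d p = [Const (nV + d) m]"
| "compE (Pl a b) d p = (let u = compE a d p in
     u @ compE b (d + 1) (p + length u) @ [Add (nV + d) (nV + d) (nV + d + 1)])"
| "compE (Mi a b) d p = (let u = compE a d p in
     u @ compE b (d + 1) (p + length u) @ [Sub (nV + d) (nV + d) (nV + d + 1)])"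
| "compE (Ar k a) d p = compE a d p @ Const (nV + d + 1) (nR + k)
     # replicate nA (Add (nV + d + 1) (nV + d + 1) (nV + d)) @ [Load (nV + d) (nV + d + 1)]"
| "compE (Su x b a) d p = (let u = compE b d p; l = p + length u + 4;
     w = compE a (d + 3) (l + 2) in
     u @ [Const (nV + d + 1) 0, Const (nV + d + 2) 0, Add (nV + d + 2) (nV + d + 2) x, Const x 0,
          Sub (nV + d + 3) (nV + d) x, JumpZero (nV + d + 3) (l + 2 + length w + 4)]
     @ w @ [Add (nV + d + 1) (nV + d + 1) (nV + d + 3), Const (nV + d + 3) 1,
          Add x x (nV + d + 3), Jump l,
          Const x 0, Add x x (nV + d + 2), Const (nV + d) 0, Add (nV + d) (nV + d) (nV + d + 1)])"

text \<open>A loop keeps its counter in a temporary and copies it to \<open>x\<close> in every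
  round, because the body may overwrite \<open>x\<close>.\<close>

primrec comp :: "cmd \<Rightarrow> nat \<Rightarrow> nat \<Rightarrow> ram_instr list" where
  "comp (As x a) d p = compE a d p @ [Const x 0, Add x x (nV + d)]"
| "comp (Pt k a b) d p = (let u = compE a d p @ Const (nV + d + 1) (nR + k)
     # replicate nA (Add (nV + d + 1) (nV + d + 1) (nV + d)) in
     u @ compE b (d + 2) (p + length u) @ [Store (nV + d + 1) (nV + d + 2)])"
| "comp (Sq c1 c2) d p = (let u = comp c1 d p in u @ comp c2 d (p + length u))"
| "comp (Fo x b c) d p = (let u = compE b d p; l = p + length u + 1;
     w = comp c (d + 2) (l + 4) in
     u @ [Const (nV + d + 1) 0, Sub (nV + d + 2) (nV + d) (nV + d + 1),
          JumpZero (nV + d + 2) (l + 4 + length w + 3), Const x 0, Add x x (nV + d + 1)]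
     @ w @ [Const (nV + d + 2) 1, Add (nV + d + 1) (nV + d + 1) (nV + d + 2), Jump l])"

text \<open>Jump targets are absolute, so code is compiled for, and tied to, an address
  \<open>p\<close>.\<close>

definition placed :: "ram_program \<Rightarrow> nat \<Rightarrow> ram_instr list \<Rightarrow> bool" where
  "placed P p cs \<longleftrightarrow> (\<exists>xs ys. P = xs @ cs @ ys \<and> length xs = p)"

lemma placed_append: "placed P p (xs @ ys) \<longleftrightarrow> placed P p xs \<and> placed P (p + length xs) ys"
proof
  assume "placed P p xs \<and> placed P (p + length xs) ys"
  then obtain a b a' b' where *: "P = a @ xs @ b" "length a = p" "P = a' @ ys @ b'"
    "length a' = p + length xs" unfolding placed_def by blast
  then have "a' = a @ xs \<and> ys @ b' = b" using append_eq_append_conv[of a' "a @ xs"] by simp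
  with * show "placed P p (xs @ ys)" unfolding placed_def by (intro exI[of _ a] exI[of _ b']) simp
next
  assume "placed P p (xs @ ys)"
  then obtain a b where "P = a @ (xs @ ys) @ b" "length a = p" by (auto simp: placed_def)
  then show "placed P p xs \<and> placed P (p + length xs) ys" unfolding placed_def
    by (intro conjI exI[of _ a] exI[of _ "ys @ b"] exI[of _ "a @ xs"] exI[of _ b]) auto
qed

lemma placed_Cons: "placed P p (x # y # ys) \<longleftrightarrow> placed P p [x] \<and> placed P (Suc p) (y # ys)"
  using placed_append[of P p "[x]" "y # ys"] by simp

lemma placed_Cons_append: "placed P p (x # xs @ ys) \<longleftrightarrow>
    placed P p [x] \<and> placed P (Suc p) xs \<and> placed P (Suc p + length xs) ys"
  using placed_append[of P p "[x]" "xs @ ys"] placed_append[of P "Suc p" xs ys] by simp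

definition steps :: "ram_program \<Rightarrow> nat \<Rightarrow> ram_config \<Rightarrow> ram_config \<Rightarrow> bool" where
  "steps P k c c' \<longleftrightarrow> (ram_step P ^^ k) c = c'"

lemma steps_refl: "steps P 0 c c" by (simp add: steps_def)

lemma steps_trans: "steps P k c c' \<Longrightarrow> steps P l c' c'' \<Longrightarrow> steps P (k + l) c c''"
  by (auto simp: steps_def add.commute[of k l] funpow_add)

lemma steps_one: "placed P p [i] \<Longrightarrow> steps P 1 (p, M) (ram_exec i (p, M))"
  by (auto simp: placed_def steps_def ram_step_def nth_append)

lemma steps_Cons:
  assumes "placed P p [i]" "steps P k (ram_exec i (p, M)) c" shows "steps P (Suc k) (p, M) c"
  using steps_trans[OF steps_one[OF assms(1)] assms(2)] by simp

text \<open>Temporaries from \<open>d\<close> on are unconstrained and may be clobbered; those below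
  \<open>d\<close> hold pending operands.\<close>

definition rel :: "nat \<Rightarrow> (nat \<Rightarrow> nat) \<Rightarrow> st \<Rightarrow> ram_memory \<Rightarrow> bool" where
  "rel d m s M \<longleftrightarrow> (\<forall>x<nV. M x = fst s x) \<and> (\<forall>j<d. M (nV + j) = m j) \<and>
     (\<forall>k<nA. \<forall>i. M (nR + k + nA * i) = snd s k i)"

lemma rel_tempD: "rel d m s M \<Longrightarrow> j < d \<Longrightarrow> M (nV + j) = m j"
  by (auto simp: rel_def)

lemma rel_varD: "rel d m s M \<Longrightarrow> x < nV \<Longrightarrow> M x = fst s x"
  by (auto simp: rel_def)

lemma rel_weaken: "rel d m s M \<Longrightarrow> d' \<le> d \<Longrightarrow> rel d' m s M"
  by (auto simp: rel_def)

lemma rel_temp: "rel d m s M \<Longrightarrow> nV + d < nR \<Longrightarrow> rel (Suc d) (m(d := y)) s (M(nV + d := y))"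
  by (auto simp: rel_def less_Suc_eq)

lemma rel_scratch: "rel d m s M \<Longrightarrow> d \<le> e \<Longrightarrow> nV + e < nR \<Longrightarrow> rel d m s (M(nV + e := y))"
  by (auto simp: rel_def)

lemma addr_inj: "k < nA \<Longrightarrow> k' < nA \<Longrightarrow> nR + k + nA * i = nR + k' + nA * i' \<Longrightarrow> k = k' \<and> i = i'"
proof -
  assume a: "k < nA" "k' < nA" "nR + k + nA * i = nR + k' + nA * i'"
  then have e: "k + nA * i = k' + nA * i'" by simp
  have "k = (k + nA * i) mod nA" using a(1) by simp
  also have "\<dots> = (k' + nA * i') mod nA" by (simp only: e)
  also have "\<dots> = k'" using a(2) by simp
  finally have "k = k'" .
  with e nA_pos show ?thesis by simp
qed

lemma rel_arr:
  assumes "rel d m s M" "k < nA" "nV + d \<le> nR"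
  shows "rel d m (seta k i y s) (M(nR + k + nA * i := y))"
  using assms addr_inj[of _ k _ i] VR unfolding rel_def by auto

lemma steps_addr:
  assumes "placed P p (replicate j (Add (r + 1) (r + 1) r))"
  shows "steps P j (p, M) (p + j, M(r + 1 := M (r + 1) + j * M r))"
  using assms
proof (induction j arbitrary: p M)
  case (Suc j)
  then have a: "placed P p [Add (r + 1) (r + 1) r]" "placed P (Suc p) (replicate j (Add (r + 1) (r + 1) r))"
    using placed_append[of P p "[Add (r + 1) (r + 1) r]" "replicate j (Add (r + 1) (r + 1) r)"] by auto
  show ?case
    by (rule steps_Cons[OF a(1)])
       (use Suc.IH[OF a(2), of "M(r + 1 := M (r + 1) + M r)"] in
         \<open>simp del: fun_upd_apply add: fun_upd_same fun_upd_other ac_simps\<close>)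
qed (simp add: steps_refl)

lemma steps_Suc: "steps P (Suc k) c c' \<longleftrightarrow> steps P k (ram_step P c) c'"
  by (simp add: steps_def funpow_swap1)

lemma steps_0: "steps P 0 c c' \<longleftrightarrow> c = c'"
  by (simp add: steps_def)

lemma step_placed: "placed P p [i] \<Longrightarrow> ram_step P (p, M) = ram_exec i (p, M)"
  by (auto simp: placed_def ram_step_def nth_append)

lemma setv_triv [simp]: "setv x (fst s x) s = s" "setv x j (setv x i s) = setv x j s"
  by (simp_all add: setv_def)

theorem compE_correct:
  assumes "placed P p (compE e d p)" "mvE e < nV" "maE e < nA" "nV + d + dpE e \<le> nR" "rel d m s M"
  shows "\<exists>M'. steps P (tmE e nA s) (p, M) (p + length (compE e d p), M') \<and>
           rel (Suc d) (m(d := ev e s)) s M'"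
  using assms
proof (induction e arbitrary: p d m s M)
  case (V x)
  then have st: "ram_step P (p, M) = ram_exec (Const (nV + d) 0) (p, M)"
    "ram_step P (Suc p, M) = ram_exec (Add (nV + d) (nV + d) x) (Suc p, M)" for M
    by (auto simp: placed_Cons step_placed)
  have "steps P 2 (p, M) (p + 2, M(nV + d := fst s x))"
    using V by (simp add: st steps_Suc steps_0 numeral_2_eq_2 rel_def)
  moreover have "rel (Suc d) (m(d := ev (V x) s)) s (M(nV + d := fst s x))"
    "p + length (compE (V x) d p) = p + 2" "tmE (V x) nA s = 2"
    using V.prems rel_temp[OF V.prems(5), of "fst s x"] by simp_all
  ultimately show ?case by metis
next
  case (K x)
  then have "steps P 1 (p, M) (Suc p, M(nV + d := x))"
    by (simp add: steps_Suc steps_0 step_placed[of P p])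
  moreover have "rel (Suc d) (m(d := ev (K x) s)) s (M(nV + d := x))"
    "p + length (compE (K x) d p) = Suc p" "tmE (K x) nA s = 1"
    using K.prems rel_temp[OF K.prems(5), of x] by simp_all
  ultimately show ?case by metis
next
  case (Pl a b)
  let ?u = "compE a d p" let ?q = "p + length ?u" let ?w = "compE b (d + 1) ?q"
  have pl: "placed P p ?u" "placed P ?q ?w"
    "placed P (?q + length ?w) [Add (nV + d) (nV + d) (nV + d + 1)]"
    using Pl.prems(1) by (auto simp: Let_def placed_append add.assoc)
  have bd: "mvE a < nV" "maE a < nA" "nV + d + dpE a \<le> nR"
    "mvE b < nV" "maE b < nA" "nV + (d + 1) + dpE b \<le> nR" using Pl.prems(2-4) by auto
  obtain M1 where M1: "steps P (tmE a nA s) (p, M) (?q, M1)" "rel (Suc d) (m(d := ev a s)) s M1"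
    using Pl.IH(1)[OF pl(1) bd(1-3) Pl.prems(5)] by blast
  obtain M2 where M2: "steps P (tmE b nA s) (?q, M1) (?q + length ?w, M2)"
    "rel (Suc (Suc d)) (m(d := ev a s, Suc d := ev b s)) s M2"
    using Pl.IH(2)[OF pl(2) bd(4-6)] M1(2) by (metis Suc_eq_plus1)
  let ?M3 = "M2(nV + d := ev a s + ev b s)"
  have "steps P 1 (?q + length ?w, M2) (Suc (?q + length ?w), ?M3)"
    using steps_one[OF pl(3), of M2] rel_tempD[OF M2(2), of d] rel_tempD[OF M2(2), of "Suc d"] by simp
  from steps_trans[OF steps_trans[OF M1(1) M2(1)] this]
  have "steps P (tmE (Pl a b) nA s) (p, M) (Suc (?q + length ?w), ?M3)" by simp
  moreover have "rel (Suc d) (m(d := ev (Pl a b) s)) s ?M3"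
    using M2(2) Pl.prems(4) by (auto simp: rel_def)
  moreover have "p + length (compE (Pl a b) d p) = Suc (?q + length ?w)" by (simp add: Let_def)
  ultimately show ?case by metis
next
  case (Mi a b)
  let ?u = "compE a d p" let ?q = "p + length ?u" let ?w = "compE b (d + 1) ?q"
  have pl: "placed P p ?u" "placed P ?q ?w"
    "placed P (?q + length ?w) [Sub (nV + d) (nV + d) (nV + d + 1)]"
    using Mi.prems(1) by (auto simp: Let_def placed_append add.assoc)
  have bd: "mvE a < nV" "maE a < nA" "nV + d + dpE a \<le> nR"
    "mvE b < nV" "maE b < nA" "nV + (d + 1) + dpE b \<le> nR" using Mi.prems(2-4) by auto
  obtain M1 where M1: "steps P (tmE a nA s) (p, M) (?q, M1)" "rel (Suc d) (m(d := ev a s)) s M1"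
    using Mi.IH(1)[OF pl(1) bd(1-3) Mi.prems(5)] by blast
  obtain M2 where M2: "steps P (tmE b nA s) (?q, M1) (?q + length ?w, M2)"
    "rel (Suc (Suc d)) (m(d := ev a s, Suc d := ev b s)) s M2"
    using Mi.IH(2)[OF pl(2) bd(4-6)] M1(2) by (metis Suc_eq_plus1)
  let ?M3 = "M2(nV + d := ev a s - ev b s)"
  have "steps P 1 (?q + length ?w, M2) (Suc (?q + length ?w), ?M3)"
    using steps_one[OF pl(3), of M2] rel_tempD[OF M2(2), of d] rel_tempD[OF M2(2), of "Suc d"] by simp
  from steps_trans[OF steps_trans[OF M1(1) M2(1)] this]
  have "steps P (tmE (Mi a b) nA s) (p, M) (Suc (?q + length ?w), ?M3)" by simp
  moreover have "rel (Suc d) (m(d := ev (Mi a b) s)) s ?M3"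
    using M2(2) Mi.prems(4) by (auto simp: rel_def)
  moreover have "p + length (compE (Mi a b) d p) = Suc (?q + length ?w)" by (simp add: Let_def)
  ultimately show ?case by metis
next
  case (Ar k a)
  let ?u = "compE a d p" let ?q = "p + length ?u" let ?r = "nV + d"
  have pl: "placed P p ?u" "placed P ?q [Const (?r + 1) (nR + k)]"
    "placed P (Suc ?q) (replicate nA (Add (?r + 1) (?r + 1) ?r))"
    "placed P (Suc ?q + nA) [Load ?r (?r + 1)]"
    using Ar.prems(1) by (auto simp: placed_append placed_Cons_append add.assoc)
  have bd: "mvE a < nV" "maE a < nA" "nV + d + dpE a \<le> nR" "k < nA" "nV + d + 1 < nR"
    using Ar.prems(2-4) by auto
  obtain M1 where M1: "steps P (tmE a nA s) (p, M) (?q, M1)" "rel (Suc d) (m(d := ev a s)) s M1"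
    using Ar.IH[OF pl(1) bd(1-3) Ar.prems(5)] by blast
  let ?ad = "nR + k + nA * ev a s"
  let ?M2 = "M1(?r + 1 := ?ad)" let ?M3 = "?M2(?r := snd s k (ev a s))"
  have v: "M1 ?r = ev a s" "M1 ?ad = snd s k (ev a s)" using M1(2) bd by (auto simp: rel_def)
  have "steps P 1 (?q, M1) (Suc ?q, M1(?r + 1 := nR + k))"
    using steps_one[OF pl(2), of M1] by simp
  moreover have "steps P nA (Suc ?q, M1(?r + 1 := nR + k)) (Suc ?q + nA, ?M2)"
    using steps_addr[OF pl(3), of "M1(?r + 1 := nR + k)"] v by simp
  moreover have "steps P 1 (Suc ?q + nA, ?M2) (Suc (Suc ?q + nA), ?M3)"
    using steps_one[OF pl(4), of ?M2] v bd by simp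
  ultimately have "steps P (tmE a nA s + (1 + (nA + 1))) (p, M) (Suc (Suc ?q + nA), ?M3)"
    using M1(1) by (blast intro: steps_trans)
  moreover have "rel (Suc d) (m(d := ev (Ar k a) s)) s ?M3"
    using M1(2) bd by (auto simp: rel_def)
  moreover have "p + length (compE (Ar k a) d p) = Suc (Suc ?q + nA)"
    "tmE (Ar k a) nA s = tmE a nA s + (1 + (nA + 1))" by simp_all
  ultimately show ?case by metis
next
  case (Su x b a)
  let ?u = "compE b d p" let ?r = "nV + d" let ?q = "p + length ?u" let ?l = "?q + 4"
  let ?w = "compE a (d + 3) (?l + 2)" let ?z = "?l + 2 + length ?w"
  have pl: "placed P p ?u"
    "placed P ?q [Const (?r + 1) 0]" "placed P (Suc ?q) [Const (?r + 2) 0]"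
    "placed P (Suc (Suc ?q)) [Add (?r + 2) (?r + 2) x]"
    "placed P (Suc (Suc (Suc ?q))) [Const x 0]"
    "placed P ?l [Sub (?r + 3) ?r x]" "placed P (Suc ?l) [JumpZero (?r + 3) (?z + 4)]"
    "placed P (?l + 2) ?w"
    "placed P ?z [Add (?r + 1) (?r + 1) (?r + 3)]" "placed P (Suc ?z) [Const (?r + 3) 1]"
    "placed P (Suc (Suc ?z)) [Add x x (?r + 3)]" "placed P (Suc (Suc (Suc ?z))) [Jump ?l]"
    "placed P (?z + 4) [Const x 0]" "placed P (Suc (?z + 4)) [Add x x (?r + 2)]"
    "placed P (Suc (Suc (?z + 4))) [Const ?r 0]"
    "placed P (Suc (Suc (Suc (?z + 4)))) [Add ?r ?r (?r + 1)]"
    using Su.prems(1) by (simp_all add: Let_def placed_append placed_Cons placed_Cons_append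
      add.assoc eval_nat_numeral)
  note st = pl(2-7,9-16)[THEN step_placed]
  have b3: "nV + d + 3 < nR" "x < nV" using Su.prems(2-4) by auto
  have bd: "mvE b < nV" "maE b < nA" "nV + d + dpE b \<le> nR"
    "mvE a < nV" "maE a < nA" "nV + (d + 3) + dpE a \<le> nR" using Su.prems(2-4) by auto
  obtain M1 where M1: "steps P (tmE b nA s) (p, M) (?q, M1)" "rel (Suc d) (m(d := ev b s)) s M1"
    using Su.IH(1)[OF pl(1) bd(1-3) Su.prems(5)] by blast
  define m' where "m' y = m(d := ev b s, d + 1 := y, d + 2 := fst s x)" for y
  define M2 where "M2 = M1(?r + 1 := 0, ?r + 2 := fst s x, x := 0)"
  have "M1 x = fst s x" using M1(2) b3 by (auto simp: rel_def)
  then have s2: "steps P 4 (?q, M1) (?l, M2)"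
    using b3 st by (simp add: steps_Suc steps_0 eval_nat_numeral M2_def)
  have r2: "rel (d + 3) (m' 0) (setv x 0 s) M2"
    using M1(2) b3 by (auto simp: rel_def M2_def m'_def less_Suc_eq eval_nat_numeral)
  \<comment> \<open>After \<open>i\<close> rounds the partial sum is in temporary
    \<open>d + 1\<close>, the saved value of \<open>x\<close> in \<open>d + 2\<close>, and
    \<open>x\<close> itself is \<open>i\<close>.\<close>
  have loop: "\<exists>M'. steps P (\<Sum>j<i. tmE a nA (setv x j s) + 6) (?l, M2) (?l, M') \<and>
      rel (d + 3) (m' (\<Sum>j<i. ev a (setv x j s))) (setv x i s) M'" if "i \<le> ev b s" for i
    using that
  proof (induction i)
    case 0
    show ?case using r2 steps_refl by auto
  next
    case (Suc i)
    let ?y = "\<Sum>j<i. ev a (setv x j s)" let ?s = "setv x i s"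
    obtain N where N: "steps P (\<Sum>j<i. tmE a nA (setv x j s) + 6) (?l, M2) (?l, N)"
      "rel (d + 3) (m' ?y) ?s N" using Suc by auto
    let ?N1 = "N(?r + 3 := ev b s - i)"
    have Nv: "N ?r = ev b s" "N x = i" "N (?r + 1) = ?y"
      using rel_tempD[OF N(2), of d] rel_tempD[OF N(2), of "d + 1"] rel_tempD[OF N(2), of "d + 2"] rel_varD[OF N(2) b3(2)]
      by (simp_all add: m'_def)
    have a1: "steps P 2 (?l, N) (?l + 2, ?N1)"
      using Nv Suc.prems st by (simp add: steps_Suc steps_0 eval_nat_numeral)
    have rN: "rel (d + 3) (m' ?y) ?s ?N1" using rel_scratch[OF N(2), of "d + 3"] b3 by (simp add: add.assoc)
    obtain N2 where N2: "steps P (tmE a nA ?s) (?l + 2, ?N1) (?z, N2)"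
      "rel (Suc (d + 3)) ((m' ?y)(d + 3 := ev a ?s)) ?s N2"
      using Su.IH(2)[OF pl(8) bd(4-6) rN] by blast
    let ?N3 = "N2(?r + 1 := ?y + ev a ?s, ?r + 3 := 1, x := Suc i)"
    have v2: "N2 (?r + 1) = ?y" "N2 (?r + 3) = ev a ?s" "N2 x = i"
      using rel_tempD[OF N2(2), of "d + 1"] rel_tempD[OF N2(2), of "d + 3"] rel_varD[OF N2(2) b3(2)]
      by (simp_all add: m'_def add.assoc)
    have "steps P 4 (?z, N2) (?l, ?N3)"
      using v2 b3 st by (simp add: steps_Suc steps_0 eval_nat_numeral)
    with a1 N2(1) have "steps P (2 + (tmE a nA ?s + 4)) (?l, N) (?l, ?N3)"
      by (blast intro: steps_trans)
    from steps_trans[OF N(1) this]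
    have "steps P (\<Sum>j<Suc i. tmE a nA (setv x j s) + 6) (?l, M2) (?l, ?N3)"
      by (simp add: ac_simps)
    moreover have "rel (d + 3) (m' (\<Sum>j<Suc i. ev a (setv x j s))) (setv x (Suc i) s) ?N3"
      using N2(2) b3 rel_tempD[OF N2(2), of "d + 2"] by (auto simp: rel_def m'_def)
    ultimately show ?case by blast
  qed
  let ?y = "\<Sum>j<ev b s. ev a (setv x j s)"
  obtain N where N: "steps P (\<Sum>j<ev b s. tmE a nA (setv x j s) + 6) (?l, M2) (?l, N)"
      "rel (d + 3) (m' ?y) (setv x (ev b s) s) N" using loop[of "ev b s"] by auto
  have Nv: "N ?r = ev b s" "N x = ev b s" "N (?r + 1) = ?y" "N (?r + 2) = fst s x"
    using rel_tempD[OF N(2), of d] rel_tempD[OF N(2), of "d + 1"] rel_tempD[OF N(2), of "d + 2"] rel_varD[OF N(2) b3(2)]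
    by (simp_all add: m'_def)
  let ?N1 = "N(?r + 3 := 0, x := fst s x, ?r := ?y)"
  \<comment> \<open>Two steps for the failing test, two to restore \<open>x\<close>, two to move the
    sum to its place.\<close>
  have "steps P 6 (?l, N) (?z + 8, ?N1)"
    using Nv b3 st by (simp add: steps_Suc steps_0 eval_nat_numeral)
  from steps_trans[OF steps_trans[OF steps_trans[OF M1(1) s2] N(1)] this]
  have "steps P (tmE (Su x b a) nA s) (p, M) (?z + 8, ?N1)" by simp
  moreover have "rel (Suc d) (m(d := ev (Su x b a) s)) s ?N1"
    using N(2) b3 by (auto simp: rel_def m'_def)
  moreover have "p + length (compE (Su x b a) d p) = ?z + 8" by (simp add: Let_def)
  ultimately show ?case by metis
qed

theorem comp_correct:
  assumes "placed P p (comp c d p)" "mv c < nV" "ma c < nA" "nV + d + dp c \<le> nR" "rel d m s M"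
  shows "\<exists>M'. steps P (tm c nA s) (p, M) (p + length (comp c d p), M') \<and> rel d m (exec c s) M'"
  using assms
proof (induction c arbitrary: p d m s M)
  case (As x a)
  let ?u = "compE a d p" let ?q = "p + length ?u"
  have pl: "placed P p ?u" "placed P ?q [Const x 0]" "placed P (Suc ?q) [Add x x (nV + d)]"
    using As.prems(1) by (simp_all add: placed_append placed_Cons)
  obtain M1 where M1: "steps P (tmE a nA s) (p, M) (?q, M1)" "rel (Suc d) (m(d := ev a s)) s M1"
    using compE_correct[OF pl(1) _ _ _ As.prems(5)] As.prems(2-4) by (simp del: fun_upd_apply) blast
  let ?M2 = "M1(x := ev a s)"
  have "M1 (nV + d) = ev a s" using M1(2) by (auto simp: rel_def)
  then have "steps P 2 (?q, M1) (?q + 2, ?M2)"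
    using As.prems(2) by (simp add: steps_Suc steps_0 pl(2,3)[THEN step_placed] eval_nat_numeral)
  from steps_trans[OF M1(1) this] have "steps P (tm (As x a) nA s) (p, M) (?q + 2, ?M2)" by simp
  moreover have "rel d m (exec (As x a) s) ?M2" using M1(2) As.prems(2) VR by (auto simp: rel_def)
  moreover have "p + length (comp (As x a) d p) = ?q + 2" by simp
  ultimately show ?case by metis
next
  case (Pt k a b)
  let ?u = "compE a d p" let ?q = "p + length ?u" let ?r = "nV + d" let ?o = "Suc ?q + nA"
  let ?w = "compE b (d + 2) ?o"
  have pl: "placed P p ?u" "placed P ?q [Const (?r + 1) (nR + k)]"
    "placed P (Suc ?q) (replicate nA (Add (?r + 1) (?r + 1) ?r))" "placed P ?o ?w"
    "placed P (?o + length ?w) [Store (?r + 1) (?r + 2)]"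
    using Pt.prems(1) by (auto simp: Let_def placed_append placed_Cons_append add.assoc)
  have bd: "mvE a < nV" "maE a < nA" "nV + d + dpE a \<le> nR"
    "mvE b < nV" "maE b < nA" "nV + (d + 2) + dpE b \<le> nR" using Pt.prems(2-4) by auto
  obtain M1 where M1: "steps P (tmE a nA s) (p, M) (?q, M1)" "rel (Suc d) (m(d := ev a s)) s M1"
    using compE_correct[OF pl(1) bd(1-3) Pt.prems(5)] by blast
  let ?ad = "nR + k + nA * ev a s" let ?M2 = "M1(?r + 1 := ?ad)"
  have v: "M1 ?r = ev a s" using M1(2) by (auto simp: rel_def)
  have s1: "steps P 1 (?q, M1) (Suc ?q, M1(?r + 1 := nR + k))"
    using steps_one[OF pl(2), of M1] by simp
  have s2: "steps P nA (Suc ?q, M1(?r + 1 := nR + k)) (?o, ?M2)"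
    using steps_addr[OF pl(3), of "M1(?r + 1 := nR + k)"] v by simp
  have b3: "nV + d + 2 < nR" using bd(6) dpE_pos[of b] by linarith
  have rN: "rel (d + 2) (m(d := ev a s, Suc d := ?ad)) s ?M2"
    using M1(2) b3 by (auto simp: rel_def less_Suc_eq)
  obtain M3 where M3: "steps P (tmE b nA s) (?o, ?M2) (?o + length ?w, M3)"
    "rel (Suc (d + 2)) (m(d := ev a s, Suc d := ?ad, d + 2 := ev b s)) s M3"
    using compE_correct[OF pl(4) bd(4-6) rN] by blast
  let ?M4 = "M3(?ad := ev b s)"
  have "M3 (?r + 1) = ?ad" "M3 (?r + 2) = ev b s"
    using rel_tempD[OF M3(2), of "d + 1"] rel_tempD[OF M3(2), of "d + 2"] by simp_all
  then have "steps P 1 (?o + length ?w, M3) (Suc (?o + length ?w), ?M4)"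
    using steps_one[OF pl(5), of M3] by simp
  with M1(1) s1 s2 M3(1)
  have "steps P (tmE a nA s + (1 + (nA + (tmE b nA s + 1)))) (p, M) (Suc (?o + length ?w), ?M4)"
    by (blast intro: steps_trans)
  moreover have "rel d m (exec (Pt k a b) s) ?M4"
    using rel_arr[OF rel_weaken[OF M3(2), of d], of k "ev a s" "ev b s"] Pt.prems(3) b3
    by (auto simp: rel_def)
  moreover have "p + length (comp (Pt k a b) d p) = Suc (?o + length ?w)"
    "tm (Pt k a b) nA s = tmE a nA s + (1 + (nA + (tmE b nA s + 1)))"
    by (simp_all add: Let_def add.assoc)
  ultimately show ?case by metis
next
  case (Sq c1 c2)
  let ?u = "comp c1 d p" let ?q = "p + length ?u" let ?w = "comp c2 d ?q"
  have pl: "placed P p ?u" "placed P ?q ?w" using Sq.prems(1) by (auto simp: Let_def placed_append)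
  have bd: "mv c1 < nV" "ma c1 < nA" "nV + d + dp c1 \<le> nR"
    "mv c2 < nV" "ma c2 < nA" "nV + d + dp c2 \<le> nR" using Sq.prems(2-4) by auto
  obtain M1 where M1: "steps P (tm c1 nA s) (p, M) (?q, M1)" "rel d m (exec c1 s) M1"
    using Sq.IH(1)[OF pl(1) bd(1-3) Sq.prems(5)] by blast
  obtain M2 where M2: "steps P (tm c2 nA (exec c1 s)) (?q, M1) (?q + length ?w, M2)"
    "rel d m (exec c2 (exec c1 s)) M2"
    using Sq.IH(2)[OF pl(2) bd(4-6) M1(2)] by blast
  show ?case using steps_trans[OF M1(1) M2(1)] M2(2)
    by (intro exI[of _ M2]) (simp add: Let_def add.assoc)
next
  case (Fo x b c)
  let ?u = "compE b d p" let ?r = "nV + d" let ?q = "p + length ?u" let ?l = "?q + 1"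
  let ?w = "comp c (d + 2) (?l + 4)" let ?z = "?l + 4 + length ?w"
  let ?f = "\<lambda>i s. exec c (setv x i s)"
  have pl: "placed P p ?u" "placed P ?q [Const (?r + 1) 0]"
    "placed P ?l [Sub (?r + 2) ?r (?r + 1)]" "placed P (Suc ?l) [JumpZero (?r + 2) (?z + 3)]"
    "placed P (Suc (Suc ?l)) [Const x 0]" "placed P (Suc (Suc (Suc ?l))) [Add x x (?r + 1)]"
    "placed P (?l + 4) ?w"
    "placed P ?z [Const (?r + 2) 1]" "placed P (Suc ?z) [Add (?r + 1) (?r + 1) (?r + 2)]"
    "placed P (Suc (Suc ?z)) [Jump ?l]"
    using Fo.prems(1) by (simp_all add: Let_def placed_append placed_Cons placed_Cons_append
      add.assoc eval_nat_numeral)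
  note st = pl(2-6,8-10)[THEN step_placed]
  have b3: "nV + d + 3 \<le> nR" "x < nV" using Fo.prems(2-4) by auto
  have bd: "mvE b < nV" "maE b < nA" "nV + d + dpE b \<le> nR"
    "mv c < nV" "ma c < nA" "nV + (d + 2) + dp c \<le> nR" using Fo.prems(2-4) by auto
  obtain M1 where M1: "steps P (tmE b nA s) (p, M) (?q, M1)" "rel (Suc d) (m(d := ev b s)) s M1"
    using compE_correct[OF pl(1) bd(1-3) Fo.prems(5)] by blast
  define m' where "m' y = m(d := ev b s, d + 1 := y)" for y
  define M2 where "M2 = M1(?r + 1 := 0)"
  have s2: "steps P 1 (?q, M1) (?l, M2)" using st by (simp add: steps_Suc steps_0 M2_def)
  have r2: "rel (d + 2) (m' 0) s M2"
    using M1(2) b3 by (auto simp: rel_def M2_def m'_def less_Suc_eq)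
  have loop: "\<exists>M'. steps P (\<Sum>j<i. tm c nA (setv x j (iter ?f j s)) + 7) (?l, M2) (?l, M') \<and>
      rel (d + 2) (m' i) (iter ?f i s) M'" if "i \<le> ev b s" for i
    using that
  proof (induction i)
    case 0
    show ?case using r2 steps_refl by auto
  next
    case (Suc i)
    let ?s = "setv x i (iter ?f i s)"
    obtain N where N: "steps P (\<Sum>j<i. tm c nA (setv x j (iter ?f j s)) + 7) (?l, M2) (?l, N)"
      "rel (d + 2) (m' i) (iter ?f i s) N" using Suc by auto
    let ?N1 = "N(?r + 2 := ev b s - i, x := i)"
    have Nv: "N ?r = ev b s" "N (?r + 1) = i" 
      using rel_tempD[OF N(2), of d] rel_tempD[OF N(2), of "d + 1"] by (simp_all add: m'_def)
    have a1: "steps P 4 (?l, N) (?l + 4, ?N1)"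
      using Nv Suc.prems b3 st by (simp add: steps_Suc steps_0 eval_nat_numeral)
    have rN: "rel (d + 2) (m' i) ?s ?N1"
      using N(2) b3 by (auto simp: rel_def m'_def less_Suc_eq)
    obtain N2 where N2: "steps P (tm c nA ?s) (?l + 4, ?N1) (?z, N2)"
      "rel (d + 2) (m' i) (exec c ?s) N2"
      using Fo.IH[OF pl(7) bd(4-6) rN] by blast
    let ?N3 = "N2(?r + 2 := 1, ?r + 1 := Suc i)"
    have v2: "N2 (?r + 1) = i" using rel_tempD[OF N2(2), of "d + 1"] by (simp add: m'_def)
    have "steps P 3 (?z, N2) (?l, ?N3)"
      using v2 st by (simp add: steps_Suc steps_0 eval_nat_numeral)
    with a1 N2(1) have "steps P (4 + (tm c nA ?s + 3)) (?l, N) (?l, ?N3)"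
      by (blast intro: steps_trans)
    from steps_trans[OF N(1) this]
    have "steps P (\<Sum>j<Suc i. tm c nA (setv x j (iter ?f j s)) + 7) (?l, M2) (?l, ?N3)"
      by (simp add: ac_simps)
    moreover have "rel (d + 2) (m' (Suc i)) (iter ?f (Suc i) s) ?N3"
      using N2(2) b3 by (auto simp: rel_def m'_def less_Suc_eq)
    ultimately show ?case by blast
  qed
  let ?T = "\<Sum>j<ev b s. tm c nA (setv x j (iter ?f j s)) + 7"
  obtain N where N: "steps P ?T (?l, M2) (?l, N)"
      "rel (d + 2) (m' (ev b s)) (iter ?f (ev b s) s) N" using loop[of "ev b s"] by auto
  have Nv: "N ?r = ev b s" "N (?r + 1) = ev b s"
    using rel_tempD[OF N(2), of d] rel_tempD[OF N(2), of "d + 1"] by (simp_all add: m'_def)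
  let ?N1 = "N(?r + 2 := 0)"
  have "steps P 2 (?l, N) (?z + 3, ?N1)"
    using Nv st by (simp add: steps_Suc steps_0 eval_nat_numeral)
  with M1(1) s2 N(1) have "steps P (tmE b nA s + (1 + (?T + 2))) (p, M) (?z + 3, ?N1)"
    by (blast intro: steps_trans)
  moreover have "rel d m (exec (Fo x b c) s) ?N1"
    using N(2) b3 by (auto simp: rel_def m'_def less_Suc_eq)
  moreover have "p + length (comp (Fo x b c) d p) = ?z + 3"
    "tm (Fo x b c) nA s = tmE b nA s + (1 + (?T + 2))" by (simp_all add: Let_def)
  ultimately show ?case by metis
qed

end

section \<open>Running time of loop programs\<close>

lemma iter_inv:
  assumes "I 0 s" "\<And>i s. i < m \<Longrightarrow> I i s \<Longrightarrow> I (Suc i) (f i s)"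
  shows "I m (iter f m s)"
proof -
  have "j \<le> m \<Longrightarrow> I j (iter f j s)" for j by (induction j) (auto simp: assms)
  then show ?thesis by simp
qed

primrec wv :: "cmd \<Rightarrow> nat set" where
  "wv (As x a) = {x}" | "wv (Pt k a b) = {}" | "wv (Sq c1 c2) = wv c1 \<union> wv c2"
| "wv (Fo x b c) = insert x (wv c)"

primrec wa :: "cmd \<Rightarrow> nat set" where
  "wa (As x a) = {}" | "wa (Pt k a b) = {k}" | "wa (Sq c1 c2) = wa c1 \<union> wa c2"
| "wa (Fo x b c) = wa c"

lemma iter_frame: "(\<And>i s. h (f i s) = h s) \<Longrightarrow> h (iter f m s) = h s"
  by (induction m) auto

lemma exec_frame:
  "x \<notin> wv c \<Longrightarrow> fst (exec c s) x = fst s x"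
  "k \<notin> wa c \<Longrightarrow> snd (exec c s) k = snd s k"
proof (induction c arbitrary: s)
  case (Fo y b c)
  { case 1
    then show ?case using Fo iter_frame[of "\<lambda>s. fst s x" "\<lambda>i s. exec c (setv y i s)"] by simp
  next
    case 2
    then show ?case using Fo iter_frame[of "\<lambda>s. snd s k" "\<lambda>i s. exec c (setv y i s)"] by simp }
qed auto

text \<open>
  Loop bounds are restricted to expressions over a set \<open>Q\<close> of variables that the program never
  writes; the running time is then polynomial in the values of these variables.
\<close>

primrec bok :: "nat set \<Rightarrow> ex \<Rightarrow> bool" where
  "bok Q (V x) = (x \<in> Q)" | "bok Q (K m) = True" | "bok Q (Pl a b) = (bok Q a \<and> bok Q b)"
| "bok Q (Mi a b) = bok Q a" | "bok Q (Ar k a) = False" | "bok Q (Su x b a) = False"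

text \<open>Coefficient in the bound \<open>ev e s \<le> bc e * (B + 1)\<close>; a difference is
  bounded by its first operand.\<close>

primrec bc :: "ex \<Rightarrow> nat" where
  "bc (V x) = 1" | "bc (K m) = m" | "bc (Pl a b) = bc a + bc b"
| "bc (Mi a b) = bc a" | "bc (Ar k a) = 0" | "bc (Su x b a) = 0"

primrec okE :: "nat set \<Rightarrow> ex \<Rightarrow> bool" where
  "okE Q (V x) = True" | "okE Q (K m) = True" | "okE Q (Pl a b) = (okE Q a \<and> okE Q b)"
| "okE Q (Mi a b) = (okE Q a \<and> okE Q b)" | "okE Q (Ar k a) = okE Q a"
| "okE Q (Su x b a) = (x \<notin> Q \<and> bok Q b \<and> okE Q b \<and> okE Q a)"

primrec okC :: "nat set \<Rightarrow> cmd \<Rightarrow> bool" where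
  "okC Q (As x a) = (x \<notin> Q \<and> okE Q a)" | "okC Q (Pt k a b) = (okE Q a \<and> okE Q b)"
| "okC Q (Sq c1 c2) = (okC Q c1 \<and> okC Q c2)"
| "okC Q (Fo x b c) = (x \<notin> Q \<and> bok Q b \<and> okE Q b \<and> okC Q c)"

lemma okC_wv: "okC Q c \<Longrightarrow> wv c \<inter> Q = {}"
  by (induction c) auto

definition bd :: "nat set \<Rightarrow> nat \<Rightarrow> st \<Rightarrow> bool" where
  "bd Q B s \<longleftrightarrow> (\<forall>p\<in>Q. fst s p \<le> B)"

lemma bd_setv: "bd Q B s \<Longrightarrow> x \<notin> Q \<Longrightarrow> bd Q B (setv x i s)"
  by (auto simp: bd_def)

lemma bd_exec: "bd Q B s \<Longrightarrow> okC Q c \<Longrightarrow> bd Q B (exec c s)"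
  using okC_wv[of Q c] exec_frame(1)[of _ c s] by (fastforce simp: bd_def disjoint_iff)

lemma ev_bound: "bok Q e \<Longrightarrow> bd Q B s \<Longrightarrow> ev e s \<le> bc e * (B + 1)"
proof (induction e)
  case (Pl a b)
  then show ?case by (auto simp: add_mult_distrib intro: add_mono)
qed (auto simp: bd_def intro: le_trans)

text \<open>Factor and degree are uniform in the state, so they depend on the program only.\<close>

definition poly_time :: "nat set \<Rightarrow> (st \<Rightarrow> nat) \<Rightarrow> bool" where
  "poly_time Q f \<longleftrightarrow> (\<exists>C D. \<forall>B s. bd Q B s \<longrightarrow> f s \<le> C * (B + 1) ^ D)"

lemma poly_time_const: "poly_time Q (\<lambda>_. m)"
  unfolding poly_time_def by (rule exI[of _ m], rule exI[of _ 0]) simp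

lemma poly_time_add:
  assumes "poly_time Q f" "poly_time Q g" shows "poly_time Q (\<lambda>s. f s + g s)"
proof -
  obtain C D C' D' where
    f: "\<And>B s. bd Q B s \<Longrightarrow> f s \<le> C * (B + 1) ^ D" and g: "\<And>B s. bd Q B s \<Longrightarrow> g s \<le> C' * (B + 1) ^ D'"
    using assms unfolding poly_time_def by metis
  have "f s + g s \<le> (C + C') * (B + 1) ^ max D D'" if "bd Q B s" for B s
  proof -
    have "f s \<le> C * (B + 1) ^ max D D'"
      by (rule order.trans[OF f[OF that]]) (intro mult_left_mono power_increasing, auto)
    moreover have "g s \<le> C' * (B + 1) ^ max D D'"
      by (rule order.trans[OF g[OF that]]) (intro mult_left_mono power_increasing, auto)
    ultimately show ?thesis by (simp add: add_mult_distrib)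
  qed
  then show ?thesis unfolding poly_time_def by blast
qed

lemma poly_time_comp:
  assumes "poly_time Q f" "\<And>B s. bd Q B s \<Longrightarrow> bd Q B (h s)"
  shows "poly_time Q (\<lambda>s. f (h s))"
  using assms unfolding poly_time_def by blast

lemma poly_time_sum:
  assumes f: "poly_time Q f" and h: "\<And>B s i. bd Q B s \<Longrightarrow> bd Q B (h i s)" and e: "bok Q e"
  shows "poly_time Q (\<lambda>s. \<Sum>i<ev e s. f (h i s))"
proof -
  obtain C D where f: "\<And>B s. bd Q B s \<Longrightarrow> f s \<le> C * (B + 1) ^ D"
    using f unfolding poly_time_def by metis
  have "(\<Sum>i<ev e s. f (h i s)) \<le> bc e * C * (B + 1) ^ Suc D" if "bd Q B s" for B s
  proof -
    have "(\<Sum>i<ev e s. f (h i s)) \<le> (\<Sum>i<ev e s. C * (B + 1) ^ D)"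
      by (intro sum_mono f h that)
    also have "\<dots> = ev e s * (C * (B + 1) ^ D)" by simp
    also have "\<dots> \<le> bc e * (B + 1) * (C * (B + 1) ^ D)"
      by (intro mult_right_mono ev_bound[OF e that]) simp
    finally show ?thesis by (simp only: power_Suc mult_ac)
  qed
  then show ?thesis unfolding poly_time_def by blast
qed

lemma tmE_poly: "okE Q e \<Longrightarrow> poly_time Q (tmE e A)"
proof (induction e)
  case (Su x b a)
  have "poly_time Q (\<lambda>s. \<Sum>i<ev b s. (\<lambda>s. tmE a A s + 6) (setv x i s))"
    using Su by (intro poly_time_sum poly_time_add poly_time_const) (auto intro: bd_setv)
  moreover have "poly_time Q (tmE b A)" using Su by simp
  ultimately have "poly_time Q (\<lambda>s. tmE b A s + 4 + (\<Sum>i<ev b s. tmE a A (setv x i s) + 6) + 6)"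
    by (intro poly_time_add poly_time_const) auto
  then show ?case by (simp add: poly_time_def)
next
  case (Pl a b)
  then have "poly_time Q (\<lambda>s. tmE a A s + tmE b A s + 1)"
    by (intro poly_time_add poly_time_const) auto
  then show ?case by (simp add: poly_time_def)
next
  case (Mi a b)
  then have "poly_time Q (\<lambda>s. tmE a A s + tmE b A s + 1)"
    by (intro poly_time_add poly_time_const) auto
  then show ?case by (simp add: poly_time_def)
next
  case (Ar k a)
  then have "poly_time Q (\<lambda>s. tmE a A s + A + 2)"
    by (intro poly_time_add poly_time_const) auto
  then show ?case by (simp add: poly_time_def)
qed (use poly_time_const[of Q 2] poly_time_const[of Q 1] in \<open>auto simp: poly_time_def\<close>)

lemma tm_poly: "okC Q c \<Longrightarrow> poly_time Q (tm c A)"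
proof (induction c)
  case (As x a)
  then have "poly_time Q (\<lambda>s. tmE a A s + 2)"
    using tmE_poly[of Q a] by (intro poly_time_add poly_time_const) auto
  then show ?case by simp
next
  case (Pt k a b)
  then have "poly_time Q (\<lambda>s. tmE a A s + A + 1 + tmE b A s + 1)"
    using tmE_poly[of Q a] tmE_poly[of Q b] by (intro poly_time_add poly_time_const) auto
  then show ?case by simp
next
  case (Sq c1 c2)
  then have "poly_time Q (tm c1 A)" "poly_time Q (\<lambda>s. tm c2 A (exec c1 s))"
    using poly_time_comp[of Q "tm c2 A" "exec c1"] bd_exec by auto
  from poly_time_add[OF this] show ?case by simp
next
  case (Fo x b c)
  let ?f = "\<lambda>i s. exec c (setv x i s)"
  have it: "bd Q B (iter ?f i s)" if "bd Q B s" for B s i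
    by (rule iter_inv[of "\<lambda>_ s. bd Q B s"]) (use that Fo.prems in \<open>auto intro: bd_exec bd_setv\<close>)
  have "poly_time Q (\<lambda>s. \<Sum>i<ev b s. (\<lambda>s. tm c A s + 7) (setv x i (iter ?f i s)))"
    using Fo it by (intro poly_time_sum poly_time_add poly_time_const) (auto intro: bd_setv)
  moreover have "poly_time Q (tmE b A)" using Fo tmE_poly by simp
  ultimately have "poly_time Q (\<lambda>s. tmE b A s + 1 +
     (\<Sum>i<ev b s. tm c A (setv x i (iter ?f i s)) + 7) + 2)"
    by (intro poly_time_add poly_time_const) auto
  then show ?case by simp
qed

section \<open>Derived expressions and breadth-first search\<close>

definition nz :: "ex \<Rightarrow> ex" where "nz e = Mi (K 1) (Mi (K 1) e)"
definition notE :: "ex \<Rightarrow> ex" where "notE e = Mi (K 1) e"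
definition andE :: "ex \<Rightarrow> ex \<Rightarrow> ex" where "andE a b = Mi (Pl (nz a) (nz b)) (K 1)"
definition orE :: "ex \<Rightarrow> ex \<Rightarrow> ex" where "orE a b = nz (Pl a b)"
definition leE :: "ex \<Rightarrow> ex \<Rightarrow> ex" where "leE a b = notE (Mi a b)"
definition ltE :: "ex \<Rightarrow> ex \<Rightarrow> ex" where "ltE a b = nz (Mi b a)"
definition eqE :: "ex \<Rightarrow> ex \<Rightarrow> ex" where "eqE a b = notE (Pl (Mi a b) (Mi b a))"
definition exE :: "nat \<Rightarrow> ex \<Rightarrow> ex \<Rightarrow> ex" where "exE x b a = nz (Su x b a)"
text \<open>Counts the values of \<open>y\<close> up to which, inclusively, there is no witness.
  This is the least witness, or the bound if there is none.\<close>

definition leastE :: "nat \<Rightarrow> nat \<Rightarrow> ex \<Rightarrow> ex \<Rightarrow> ex" where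
  "leastE x y b a = Su y b (notE (Su x b (andE (leE (V x) (V y)) a)))"
primrec andL :: "ex list \<Rightarrow> ex" where
  "andL [] = K 1" | "andL (a # as) = andE a (andL as)"
primrec orL :: "ex list \<Rightarrow> ex" where
  "orL [] = K 0" | "orL (a # as) = orE a (orL as)"

text \<open>Variable 8 is a dummy: it is only ever written, as the counter of 0/1-fold loops and products.\<close>

definition mulE :: "nat \<Rightarrow> ex \<Rightarrow> ex" where "mulE p e = Su 8 (V p) e"
definition IfC :: "ex \<Rightarrow> cmd \<Rightarrow> cmd" where "IfC e c = Fo 8 (nz e) c"

lemma ev_nz [simp]: "ev (nz e) s = of_bool (ev e s \<noteq> 0)"
  by (cases "ev e s") (simp_all add: nz_def)

lemma sum_of_bool: "(\<Sum>i<m::nat. of_bool (P i)) = card {i. i < m \<and> P i}"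
proof (induction m)
  case (Suc m)
  have "{i. i < Suc m \<and> P i} = (if P m then insert m {i. i < m \<and> P i} else {i. i < m \<and> P i})"
    by (auto simp: less_Suc_eq)
  then show ?case using Suc by simp
qed simp

lemma ev_macros [simp]:
  "ev (notE e) s = of_bool (ev e s = 0)"
  "ev (andE a b) s = of_bool (ev a s \<noteq> 0 \<and> ev b s \<noteq> 0)"
  "ev (orE a b) s = of_bool (ev a s \<noteq> 0 \<or> ev b s \<noteq> 0)"
  "ev (leE a b) s = of_bool (ev a s \<le> ev b s)"
  "ev (ltE a b) s = of_bool (ev a s < ev b s)"
  "ev (eqE a b) s = of_bool (ev a s = ev b s)"
  "ev (exE x b a) s = of_bool (\<exists>i<ev b s. ev a (setv x i s) \<noteq> 0)"
  by (auto simp: notE_def andE_def orE_def leE_def ltE_def eqE_def exE_def)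

lemma ev_lists [simp]:
  "ev (andL as) s = of_bool (\<forall>a\<in>set as. ev a s \<noteq> 0)"
  "ev (orL as) s = of_bool (\<exists>a\<in>set as. ev a s \<noteq> 0)"
  by (induction as) auto

lemma ev_mulE: "(\<And>i. ev e (setv 8 i s) = ev e s) \<Longrightarrow> ev (mulE p e) s = fst s p * ev e s"
  by (simp add: mulE_def)

lemma ev_mulV [simp]: "x \<noteq> 8 \<Longrightarrow> ev (mulE p (V x)) s = fst s p * fst s x"
  by (rule ev_mulE[THEN trans]) auto

lemma exec_IfC [simp]: "exec (IfC e c) s = (if ev e s \<noteq> 0 then exec c (setv 8 0 s) else s)"
  by (simp add: IfC_def)

lemma ev_leastE:
  assumes "\<And>i j. i < fst s p \<Longrightarrow> ev a (setv x i (setv y j s)) \<noteq> 0 \<longleftrightarrow> P i" "x \<noteq> y" "p \<noteq> x" "p \<noteq> y"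
  shows "ev (leastE x y (V p) a) s = lst (fst s p) P"
proof -
  let ?m = "fst s p"
  have "ev (leastE x y (V p) a) s = card {j. j < ?m \<and> \<not> (\<exists>i<?m. i \<le> j \<and> P i)}"
    using assms by (auto simp: leastE_def sum_of_bool intro!: arg_cong[of _ _ card])
  also have "{j. j < ?m \<and> \<not> (\<exists>i<?m. i \<le> j \<and> P i)} = {..<lst ?m P}"
  proof (cases "\<exists>v<?m. P v")
    case True
    then obtain v where v: "v < ?m" "P v" by blast
    have l: "P (lst ?m P)" "lst ?m P < ?m" using lst_found[of v ?m P] v by auto
    have "\<not> P i" if "i < lst ?m P" for i
      using that l lst_found(2)[of i ?m P] by (meson less_trans not_le)
    with l show ?thesis by (auto simp: not_less) (meson le_less_trans not_le)+
  qed (auto simp: lst_def)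
  finally show ?thesis by simp
qed

lemma lst_less: assumes "lst m P < m" shows "P (lst m P)"
proof -
  obtain v where "v < m" "P v" using assms by (auto simp: lst_def split: if_splits)
  then show ?thesis by (rule lst_found(1))
qed

text \<open>The written value may depend on anything but array \<open>k\<close>, so earlier writes
  of the same loop cannot influence later ones.\<close>

lemma exec_tab:
  assumes "\<And>i s'. i < ev b s \<Longrightarrow> (\<And>z. z \<noteq> x \<Longrightarrow> fst s' z = fst s z) \<Longrightarrow> fst s' x = i \<Longrightarrow>
     (\<And>l. l \<noteq> k \<Longrightarrow> snd s' l = snd s l) \<Longrightarrow> ev ie s' = h + i \<and> ev e s' = g i"
  shows "snd (exec (Fo x b (Pt k ie e)) s) k j
    = (if h \<le> j \<and> j < h + ev b s then g (j - h) else snd s k j)"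
proof -
  let ?f = "\<lambda>i s. exec (Pt k ie e) (setv x i s)"
  let ?I = "\<lambda>m s'. (\<forall>z. z \<noteq> x \<longrightarrow> fst s' z = fst s z) \<and> (\<forall>l. l \<noteq> k \<longrightarrow> snd s' l = snd s l) \<and>
    snd s' k = (\<lambda>j. if h \<le> j \<and> j < h + m then g (j - h) else snd s k j)"
  have "?I (ev b s) (iter ?f (ev b s) s)"
  proof (rule iter_inv[of ?I])
    fix i s' assume i: "i < ev b s" and I: "?I i s'"
    have "ev ie (setv x i s') = h + i \<and> ev e (setv x i s') = g i"
      using assms[OF i, of "setv x i s'"] I by auto
    then show "?I (Suc i) (?f i s')" using I by (auto simp: fun_eq_iff less_Suc_eq)
  qed auto
  then show ?thesis by simp
qed

declare exec.simps(4) [simp del]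

lemma exec_tab0:
  assumes "j < ev b s"
    "\<And>i s'. i < ev b s \<Longrightarrow> (\<And>z. z \<noteq> x \<Longrightarrow> fst s' z = fst s z) \<Longrightarrow> fst s' x = i \<Longrightarrow>
     (\<And>l. l \<noteq> k \<Longrightarrow> snd s' l = snd s l) \<Longrightarrow> ev e s' = g i"
  shows "snd (exec (Fo x b (Pt k (V x) e)) s) k j = g j"
  using exec_tab[of b s x k "V x" 0 e g j] assms by simp

text \<open>
  Variables: 0 the answer, 1 \<open>n\<close>, 2 \<open>2 * n\<close>, 3 \<open>t\<close>, 4 \<open>w\<close>, 5 the base \<open>t + c + 6\<close> of the guess digits,
  6 the number of branching steps, 7 the number of guesses, 9 the remaining guess, 11 the size of the
  last cut, 12 \<open>lam S T\<close>, and \<open>60 + i\<close> entry \<open>i\<close> of a tuple. Arrays: 1 weights, 2 adjacency matrix (all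
  matrices have row length \<open>2 * n\<close>), 3 \<open>S\<close>, 4 \<open>T\<close>, 5 source side of the next cut, 6 residual graph, 7 distances,
  8 sources, 9 last cut, 10 \<open>Rmax\<close>, 11 levels, 12 digits of the guess, 13 lexicographically first tuple,
  14 \<open>Rmin\<close>, 15 roots, 16 to 18 neighbourhoods of \<open>Rmin\<close>, \<open>Rmax\<close> and \<open>S\<close>, 19 and 20 scratch.
\<close>

definition bfs :: cmd where
  "bfs = Sq (Fo 20 (V 2) (Pt 7 (V 20) (nz (Ar 8 (V 20)))))
    (Fo 21 (V 2) (Fo 22 (V 2) (IfC (andE (notE (Ar 7 (V 22))) (exE 20 (V 2)
        (andE (eqE (Ar 7 (V 20)) (Pl (V 21) (K 1))) (Ar 6 (Pl (mulE 2 (V 20)) (V 22))))))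
      (Pt 7 (V 22) (Pl (V 21) (K 2))))))"

lemma bfs_frame: "wv bfs = {8, 20, 21, 22}" "wa bfs = {7}"
  by (auto simp: bfs_def IfC_def)

text \<open>Values are shifted by one: 0 means unreached and 1 a source. Recorded are predecessor
  chains and closure under arcs.\<close>

definition dist_ok :: "nat \<Rightarrow> (nat \<Rightarrow> nat) \<Rightarrow> (nat \<Rightarrow> nat) \<Rightarrow> (nat \<Rightarrow> nat) \<Rightarrow> bool" where
  "dist_ok N E R D \<longleftrightarrow> (\<forall>x<N. D x \<le> N \<and> (D x = 1 \<longleftrightarrow> R x \<noteq> 0) \<and>
     (\<forall>k. D x = k + 2 \<longrightarrow> (\<exists>y<N. D y = k + 1 \<and> E (N * y + x) \<noteq> 0)) \<and>
     (\<forall>y<N. D x \<noteq> 0 \<and> E (N * x + y) \<noteq> 0 \<longrightarrow> D y \<noteq> 0))"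

text \<open>\<open>N\<close> rounds suffice, since all values from 1 to \<open>D x\<close> are
  taken, by different vertices.\<close>

lemma bfs_correct:
  assumes N: "fst s 2 = N" shows "dist_ok N (snd s 6) (snd s 8) (snd (exec bfs s) 7)"
proof -
  define E where "E = snd s 6"
  define R where "R = snd s 8"
  define nxt where "nxt i D y = (if y < N \<and> D y = 0 \<and> (\<exists>x<N. D x = i + 1 \<and> E (N * x + y) \<noteq> 0) then i + 2 else D y)"
    for i and D :: "nat \<Rightarrow> nat" and y
  let ?c = "IfC (andE (notE (Ar 7 (V 22))) (exE 20 (V 2)
        (andE (eqE (Ar 7 (V 20)) (Pl (V 21) (K 1))) (Ar 6 (Pl (mulE 2 (V 20)) (V 22))))))
      (Pt 7 (V 22) (Pl (V 21) (K 2)))"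
  let ?in = "Fo 22 (V 2) ?c"
  have inner: "snd (exec ?in u) 7 = nxt i (snd u 7)"
    if u: "fst u 2 = N" "fst u 21 = i" "snd u 6 = E" for u i
  proof -
    let ?D = "snd u 7"
    let ?I = "\<lambda>m (w :: st). fst w 2 = N \<and> fst w 21 = i \<and> snd w 6 = E \<and>
      snd w 7 = (\<lambda>y. if y < m then nxt i ?D y else ?D y)"
    have "?I N (iter (\<lambda>j w. exec ?c (setv 22 j w)) N u)"
    proof (rule iter_inv[of ?I])
      fix j w assume j: "j < N" and I: "?I j w"
      \<comment> \<open>Updating in place is safe: entries written in this round are
        \<open>i + 2\<close>, while the test looks for \<open>i + 1\<close>.\<close>
      have "snd w 7 x = Suc i \<longleftrightarrow> ?D x = Suc i" for x using I by (simp add: nxt_def)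
      then show "?I (Suc j) (exec ?c (setv 22 j w))"
        using I j by (simp add: fun_eq_iff nxt_def less_Suc_eq) blast
    qed (use u in auto)
    moreover have "exec ?in u = iter (\<lambda>j w. exec ?c (setv 22 j w)) N u"
      using u by (simp only: exec.simps ev.simps)
    ultimately have "snd (exec ?in u) 7 = (\<lambda>y. if y < N then nxt i ?D y else ?D y)" by simp
    then show ?thesis by (auto simp: fun_eq_iff nxt_def)
  qed
  define u where "u = exec (Fo 20 (V 2) (Pt 7 (V 20) (nz (Ar 8 (V 20))))) s"
  have u7: "snd u 7 x = of_bool (R x \<noteq> 0)" if "x < N" for x
    unfolding u_def by (rule exec_tab0) (use that N in \<open>auto simp: R_def\<close>)
  have u: "fst u 2 = N" "snd u 6 = E"
    unfolding u_def E_def by (subst exec_frame; simp add: N)+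
  \<comment> \<open>Closure is claimed for values up to \<open>i\<close> only, as the vertices
    reached last are not yet expanded.\<close>
  let ?I = "\<lambda>i (w :: st). fst w 2 = N \<and> snd w 6 = E \<and> (\<forall>x<N. snd w 7 x \<le> i + 1 \<and> (snd w 7 x = 1 \<longleftrightarrow> R x \<noteq> 0) \<and>
     (\<forall>k. snd w 7 x = k + 2 \<longrightarrow> (\<exists>y<N. snd w 7 y = k + 1 \<and> E (N * y + x) \<noteq> 0)) \<and>
     (\<forall>y<N. snd w 7 x \<noteq> 0 \<and> snd w 7 x \<le> i \<and> E (N * x + y) \<noteq> 0 \<longrightarrow> snd w 7 y \<noteq> 0))"
  have main: "?I N (iter (\<lambda>i w. exec ?in (setv 21 i w)) N u)"
  proof (rule iter_inv[of ?I])
    show "?I 0 u" using u u7 by auto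
  next
    fix i w assume I: "?I i w"
    define w' where "w' = exec ?in (setv 21 i w)"
    have fr: "fst w' 2 = N" "snd w' 6 = E"
      using I exec_frame(1)[of 2 ?in "setv 21 i w"] exec_frame(2)[of 6 ?in "setv 21 i w"]
      by (simp_all add: IfC_def w'_def)
    have D: "snd w' 7 = nxt i (snd w 7)"
      using inner[of "setv 21 i w" i] I by (simp add: w'_def)
    let ?D = "snd w 7"
    have "nxt i ?D x \<le> Suc i + 1 \<and> (nxt i ?D x = 1 \<longleftrightarrow> R x \<noteq> 0) \<and>
      (\<forall>k. nxt i ?D x = k + 2 \<longrightarrow> (\<exists>y<N. nxt i ?D y = k + 1 \<and> E (N * y + x) \<noteq> 0)) \<and>
      (\<forall>y<N. nxt i ?D x \<noteq> 0 \<and> nxt i ?D x \<le> Suc i \<and> E (N * x + y) \<noteq> 0 \<longrightarrow> nxt i ?D y \<noteq> 0)"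
      if x: "x < N" for x
    proof -
      have keep: "?D y \<noteq> 0 \<Longrightarrow> nxt i ?D y = ?D y" for y by (simp add: nxt_def)
      have 1: "nxt i ?D x \<le> Suc i + 1 \<and> (nxt i ?D x = 1 \<longleftrightarrow> R x \<noteq> 0)"
        using I x by (auto simp: nxt_def)
      have 2: "\<exists>y<N. nxt i ?D y = k + 1 \<and> E (N * y + x) \<noteq> 0" if k: "nxt i ?D x = k + 2" for k
      proof (cases "?D x = 0")
        case True
        then obtain y where "y < N" "?D y = k + 1" "E (N * y + x) \<noteq> 0"
          using k by (auto simp: nxt_def split: if_splits)
        then show ?thesis using keep[of y] by auto
      next
        case False
        then have "?D x = k + 2" using k keep[of x] by simp
        then obtain y where "y < N" "?D y = k + 1" "E (N * y + x) \<noteq> 0" using I x by blast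
        then show ?thesis using keep[of y] by auto
      qed
      have 3: "nxt i ?D y \<noteq> 0" if "y < N" "nxt i ?D x \<noteq> 0" "nxt i ?D x \<le> Suc i" "E (N * x + y) \<noteq> 0" for y
      proof -
        have Dx: "?D x \<noteq> 0" "?D x \<le> Suc i" using that by (auto simp: nxt_def split: if_splits)
        show ?thesis
        proof (cases "?D x \<le> i")
          case True
          then have "?D y \<noteq> 0" using I x Dx that by blast
          then show ?thesis using keep[of y] by simp
        next
          case False
          then have "?D x = i + 1" using Dx by simp
          then show ?thesis using x that by (auto simp: nxt_def)
        qed
      qed
      from 1 2 3 show ?thesis by blast
    qed
    then have "?I (Suc i) w'" using fr unfolding D by blast
    then show "?I (Suc i) (exec ?in (setv 21 i w))" unfolding w'_def by assumption
  qed
  have e: "exec bfs s = iter (\<lambda>i w. exec ?in (setv 21 i w)) N u"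
    using u by (simp only: bfs_def u_def exec.simps ev.simps)
  have I: "?I N (exec bfs s)" unfolding e by (rule main)
  let ?D = "snd (exec bfs s) 7"
  have lev: "\<exists>y<N. ?D y = j" if "x < N" "1 \<le> j" "j \<le> ?D x" for x j
    using that(3,2)
  proof (induction j rule: inc_induct)
    case base
    show ?case using that by auto
  next
    case (step m)
    then obtain y where y: "y < N" "?D y = Suc m" by auto
    define k where "k = m - 1"
    have k: "?D y = k + 2" "m = k + 1" using y step.prems by (simp_all add: k_def)
    show ?case unfolding k(2) using I y(1) k(1) by blast
  qed
  have "?D x \<le> N" if "x < N" for x
  proof (rule ccontr)
    assume "\<not> ?D x \<le> N"
    then have "{1..N + 1} \<subseteq> ?D ` {..<N}" using lev[OF that] by fastforce
    then have "card {1..N + 1} \<le> card (?D ` {..<N})" by (intro card_mono) auto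
    also have "\<dots> \<le> N" using card_image_le[of "{..<N}" ?D] by simp
    finally show False by simp
  qed
  then show ?thesis using I unfolding dist_ok_def E_def R_def by blast
qed

section \<open>Computing minimum cuts\<close>

definition mat :: "nat \<Rightarrow> (nat \<Rightarrow> nat) \<Rightarrow> (nat \<times> nat) set" where
  "mat N E = {(x, y). x < N \<and> y < N \<and> E (N * x + y) \<noteq> 0}"

lemma finite_mat [simp]: "finite (mat N E)"
  by (rule finite_subset[of _ "{..<N} \<times> {..<N}"]) (auto simp: mat_def)

lemma row_inj: "y < N \<Longrightarrow> y' < N \<Longrightarrow> N * x + y = N * x' + y' \<longleftrightarrow> x = x' \<and> y = (y' :: nat)"
proof
  assume a: "y < N" "y' < N" "N * x + y = N * x' + y'"
  have "x = (N * x + y) div N" using a(1) by simp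
  also have "\<dots> = (N * x' + y') div N" by (simp only: a(3))
  also have "\<dots> = x'" using a(2) by simp
  finally show "x = x' \<and> y = y'" using a by simp
qed auto

lemma mat_upd:
  "x < N \<Longrightarrow> y < N \<Longrightarrow> mat N (E(N * x + y := w)) = (if w = 0 then mat N E - {(x, y)} else insert (x, y) (mat N E))"
  by (auto simp: mat_def row_inj)

lemma exec_mat:
  assumes N: "fst s p = N" "p \<noteq> x" "p \<noteq> y" "x \<noteq> y" "p \<noteq> 8" "x \<noteq> 8" "y \<noteq> 8"
    and g: "\<And>i j s'. i < N \<Longrightarrow> j < N \<Longrightarrow> (\<And>z. z \<noteq> x \<Longrightarrow> z \<noteq> y \<Longrightarrow> z \<noteq> 8 \<Longrightarrow> fst s' z = fst s z) \<Longrightarrow>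
      fst s' x = i \<Longrightarrow> fst s' y = j \<Longrightarrow> (\<And>l. l \<noteq> k \<Longrightarrow> snd s' l = snd s l) \<Longrightarrow> ev e s' = g i j"
    and ij: "i < N" "j < N"
  shows "snd (exec (Fo x (V p) (Fo y (V p) (Pt k (Pl (mulE p (V x)) (V y)) e))) s) k (N * i + j) = g i j"
proof -
  let ?c = "Fo y (V p) (Pt k (Pl (mulE p (V x)) (V y)) e)"
  let ?I = "\<lambda>m (w :: st). (\<forall>z. z \<noteq> x \<longrightarrow> z \<noteq> y \<longrightarrow> fst w z = fst s z) \<and>
    (\<forall>l. l \<noteq> k \<longrightarrow> snd w l = snd s l) \<and> (\<forall>i<m. \<forall>j<N. snd w k (N * i + j) = g i j)"
  have "?I N (iter (\<lambda>i w. exec ?c (setv x i w)) N s)"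
  proof (rule iter_inv[of ?I])
    fix i w assume i: "i < N" and I: "?I i w"
    let ?w = "exec ?c (setv x i w)"
    have fr: "\<And>z. z \<noteq> x \<longrightarrow> z \<noteq> y \<longrightarrow> fst ?w z = fst s z" "\<And>l. l \<noteq> k \<longrightarrow> snd ?w l = snd s l"
      using I exec_frame[of _ ?c "setv x i w"] by simp_all
    have "snd ?w k j = (if N * i \<le> j \<and> j < N * i + ev (V p) (setv x i w) then g i (j - N * i)
        else snd (setv x i w) k j)" for j
      by (rule exec_tab) (use I N i in \<open>auto intro!: g\<close>)
    then have "snd ?w k j = (if N * i \<le> j \<and> j < N * i + N then g i (j - N * i) else snd w k j)" for j
      using I N by simp
    moreover have "\<not> N * i \<le> N * i' + j" if "i' < i" "j < N" for i' j
    proof -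
      have "N * i' + j < N * Suc i'" using that by simp
      also have "\<dots> \<le> N * i" using that by (intro mult_le_mono2) simp
      finally show ?thesis by simp
    qed
    ultimately show "?I (Suc i) ?w" using I fr by (auto simp: less_Suc_eq)
  qed auto
  then show ?thesis using N ij by (simp add: exec.simps(4)[of x])
qed

text \<open>Walks back along predecessors to a source, reversing each arc on the way. Once there,
  the remaining rounds do nothing.\<close>

definition trace :: cmd where
  "trace = Fo 26 (V 2) (IfC (ltE (K 1) (Ar 7 (V 13)))
     (Sq (As 14 (leastE 20 21 (V 2) (andE (eqE (Pl (Ar 7 (V 20)) (K 1)) (Ar 7 (V 13)))
        (Ar 6 (Pl (mulE 2 (V 20)) (V 13))))))
     (Sq (Pt 6 (Pl (mulE 2 (V 14)) (V 13)) (K 0))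
     (Sq (Pt 6 (Pl (mulE 2 (V 13)) (V 14)) (K 1))
         (As 13 (V 14))))))"

definition augment :: cmd where
  "augment = Sq bfs (Sq
     (As 13 (leastE 20 21 (V 2) (andE (leE (V 1) (V 20)) (andE (Ar 4 (Mi (V 20) (V 1))) (Ar 7 (V 20))))))
     (IfC (ltE (V 13) (V 2)) (Sq (As 11 (Pl (V 11) (K 1))) trace)))"

definition splitg :: cmd where
  "splitg = Fo 23 (V 2) (Fo 24 (V 2) (Pt 6 (Pl (mulE 2 (V 23)) (V 24))
     (orE (eqE (V 24) (Pl (V 23) (V 1)))
       (andE (andE (leE (V 1) (V 23)) (ltE (V 24) (V 1)))
         (Ar 2 (Pl (mulE 2 (Mi (V 23) (V 1))) (V 24)))))))"

text \<open>The closing search finds the least closed set of the residual graph; its exits form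
  \<open>Rmin\<close>.\<close>

definition mcut :: cmd where
  "mcut = Sq splitg
    (Sq (Fo 23 (V 2) (Pt 8 (V 23) (andE (leE (V 1) (V 23)) (Ar 5 (Mi (V 23) (V 1))))))
    (Sq (As 11 (K 0))
    (Sq (Fo 25 (V 2) augment)
    (Sq bfs (Fo 23 (V 1) (Pt 9 (V 23) (Ar 7 (Pl (V 23) (V 1)))))))))"

lemma trace_frame: "wv trace = {8, 13, 14, 26}" "wa trace = {6}"
  by (auto simp: trace_def IfC_def)

lemma augment_frame: "wv augment = {8, 11, 13, 14, 20, 21, 22, 26}" "wa augment = {6, 7}"
  by (auto simp: augment_def IfC_def bfs_frame trace_frame)

lemma mcut_frame: "wv mcut = {8, 11, 13, 14, 20, 21, 22, 23, 24, 25, 26}" "wa mcut = {6, 7, 8, 9}"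
  by (auto simp: mcut_def splitg_def augment_frame bfs_frame)

text \<open>In a 0/1 matrix a reversal is faithful only if the opposite arc is absent.\<close>

definition asym_arcs :: "(nat \<times> nat) set \<Rightarrow> bool" where
  "asym_arcs A \<longleftrightarrow> (\<forall>x y. (x, y) \<in> A \<longrightarrow> (y, x) \<notin> A)"

text \<open>The contributions of inner path vertices cancel, leaving only the two ends. The walk
  reads a changing matrix, but arcs between smaller distances are still the original ones.\<close>

lemma trace_correct:
  assumes N: "fst s 2 = N" and z: "fst s 13 < N" and as: "asym_arcs (mat N (snd s 6))"
    and d: "dist_ok N (snd s 6) R (snd s 7)" and Dz: "snd s 7 (fst s 13) \<noteq> 0"
  defines "s' \<equiv> exec trace s"
  shows "asym_arcs (mat N (snd s' 6)) \<and> (\<exists>x<N. R x \<noteq> 0 \<and>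
    (\<forall>Y. dout (mat N (snd s' 6)) Y + of_bool (x \<in> Y) = dout (mat N (snd s 6)) Y + of_bool (fst s 13 \<in> Y)))"
proof -
  define D where "D = snd s 7"
  define A0 where "A0 = mat N (snd s 6)"
  define z0 where "z0 = fst s 13"
  let ?lc = "leastE 20 21 (V 2) (andE (eqE (Pl (Ar 7 (V 20)) (K 1)) (Ar 7 (V 13)))
        (Ar 6 (Pl (mulE 2 (V 20)) (V 13))))"
  let ?c = "IfC (ltE (K 1) (Ar 7 (V 13))) (Sq (As 14 ?lc)
     (Sq (Pt 6 (Pl (mulE 2 (V 14)) (V 13)) (K 0))
     (Sq (Pt 6 (Pl (mulE 2 (V 13)) (V 14)) (K 1)) (As 13 (V 14)))))"
  let ?I = "\<lambda>j (w :: st). fst w 2 = N \<and> snd w 7 = D \<and> fst w 13 < N \<and> D (fst w 13) \<noteq> 0 \<and>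
    (D (fst w 13) = 1 \<or> D (fst w 13) + j = D z0) \<and> asym_arcs (mat N (snd w 6)) \<and>
    (\<forall>Y. dout (mat N (snd w 6)) Y + of_bool (fst w 13 \<in> Y) = dout A0 Y + of_bool (z0 \<in> Y)) \<and>
    (\<forall>a b. D b = D a + 1 \<and> D b \<le> D (fst w 13) \<longrightarrow> ((a, b) \<in> mat N (snd w 6) \<longleftrightarrow> (a, b) \<in> A0))"
  have "?I N (iter (\<lambda>j w. exec ?c (setv 26 j w)) N s)"
  proof (rule iter_inv[of ?I])
    show "?I 0 s" using assms by (simp add: D_def A0_def z0_def)
  next
    fix j w assume I: "?I j w"
    define z where "z = fst w 13"
    show "?I (Suc j) (exec ?c (setv 26 j w))"
    proof (cases "D z = 1")
      case True
      then show ?thesis using I by (simp add: z_def)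
    next
      case False
      define k where "k = D z - 2"
      have "D z \<noteq> 0" using I by (simp add: z_def)
      then have k: "D z = k + 2" using False by (simp add: k_def)
      have zN: "z < N" using I by (simp add: z_def)
      define P where "P x \<longleftrightarrow> D x + 1 = D z \<and> snd w 6 (N * x + z) \<noteq> 0" for x
      obtain y where y: "y < N" "D y = k + 1" "(y, z) \<in> A0"
      proof -
        obtain y where "y < N" "D y = k + 1" "snd s 6 (N * y + z) \<noteq> 0"
          using d k zN unfolding dist_ok_def D_def by blast
        then show thesis using that zN by (auto simp: A0_def mat_def)
      qed
      then have "(y, z) \<in> mat N (snd w 6)" using I k by (auto simp: z_def)
      then have "P y" using y k by (auto simp: P_def mat_def)
      define x where "x = lst N P"
      have x: "x < N" "P x" using lst_found[of y N P] y(1) \<open>P y\<close> by (auto simp: x_def)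
      have lc: "ev ?lc (setv 8 0 (setv 26 j w)) = x"
        using ev_leastE[of "setv 8 0 (setv 26 j w)" 2 "andE (eqE (Pl (Ar 7 (V 20)) (K 1)) (Ar 7 (V 13)))
          (Ar 6 (Pl (mulE 2 (V 20)) (V 13)))" 20 21 P] I
        by (simp add: P_def x_def z_def)
      let ?A = "mat N (snd w 6)" let ?A' = "insert (z, x) (?A - {(x, z)})"
      have xz: "(x, z) \<in> ?A" "(z, x) \<notin> ?A"
        using x zN I by (auto simp: mat_def P_def asym_arcs_def)
      have "x \<noteq> z" using x k by (auto simp: P_def)
      have ex: "exec ?c (setv 26 j w) = setv 13 x (seta 6 (N * z + x) 1 (seta 6 (N * x + z) 0
          (setv 14 x (setv 8 0 (setv 26 j w)))))"
        using I k lc by (simp add: z_def)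
      have mA: "mat N (snd (exec ?c (setv 26 j w)) 6) = ?A'"
        unfolding ex using x zN by (simp add: mat_upd)
      have as': "asym_arcs ?A'" using I xz \<open>x \<noteq> z\<close> by (auto simp: asym_arcs_def)
      have dd: "dout ?A' Y + of_bool (x \<in> Y) = dout A0 Y + of_bool (z0 \<in> Y)" for Y
        using dout_reverse[OF finite_mat xz, of Y] I by (simp add: z_def)
      have Dx: "D x = k + 1" using x(2) k by (simp add: P_def)
      have lv: "(a, b) \<in> ?A' \<longleftrightarrow> (a, b) \<in> A0" if "D b = D a + 1" "D b \<le> D x" for a b
      proof -
        have "(a, b) \<noteq> (z, x)" "(a, b) \<noteq> (x, z)" using that Dx k by auto
        then show ?thesis using I that Dx k by (auto simp: z_def)
      qed
      have "D x = 1 \<or> D x + Suc j = D z0" using I k Dx by (auto simp: z_def)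
      moreover have "fst (exec ?c (setv 26 j w)) 13 = x" "fst (exec ?c (setv 26 j w)) 2 = N"
        "snd (exec ?c (setv 26 j w)) 7 = D" unfolding ex using I by simp_all
      ultimately show ?thesis unfolding mA using x(1) Dx as' dd lv by simp
    qed
  qed
  then have I: "?I N s'" using N by (simp add: s'_def trace_def exec.simps(4))
  let ?z = "fst s' 13"
  have "D z0 \<le> N" using d z by (simp add: dist_ok_def D_def z0_def)
  then have "D ?z = 1" using I by auto
  then have "R ?z \<noteq> 0" using d I by (auto simp: dist_ok_def D_def)
  then have "?z < N \<and> R ?z \<noteq> 0 \<and> (\<forall>Y. dout (mat N (snd s' 6)) Y + of_bool (?z \<in> Y)
      = dout (mat N (snd s 6)) Y + of_bool (fst s 13 \<in> Y))"
    using I unfolding A0_def z0_def by blast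
  then show ?thesis using I by blast
qed

lemma dist_reach:
  assumes d: "dist_ok N E R D" and Y: "\<And>x. x < N \<Longrightarrow> R x \<noteq> 0 \<Longrightarrow> x \<in> Y" "dout (mat N E) Y = 0"
    and x: "x < N" "D x \<noteq> 0"
  shows "x \<in> Y"
  using x
proof (induction "D x" arbitrary: x rule: less_induct)
  case less
  show ?case
  proof (cases "D x = 1")
    case True
    then show ?thesis using d Y(1) less.prems by (auto simp: dist_ok_def)
  next
    case False
    define k where "k = D x - 2"
    have k: "D x = k + 2" using False less.prems by (simp add: k_def)
    then obtain y where y: "y < N" "D y = k + 1" "E (N * y + x) \<noteq> 0"
      using d less.prems unfolding dist_ok_def by blast
    then have "y \<in> Y" using less.hyps[of y] k by simp
    then show ?thesis
      using dout_mono_zero[OF finite_mat Y(2), of y x] y less.prems by (auto simp: mat_def)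
  qed
qed

lemma dist_closed:
  assumes "dist_ok N E R D" shows "dout (mat N E) {x. x < N \<and> D x \<noteq> 0} = 0"
proof -
  have "y < N \<and> D y \<noteq> 0" if "x < N" "D x \<noteq> 0" "(x, y) \<in> mat N E" for x y
    using assms that unfolding dist_ok_def mat_def by blast
  then have "{(x, y) \<in> mat N E. x \<in> {x. x < N \<and> D x \<noteq> 0} \<and> y \<notin> {x. x < N \<and> D x \<noteq> 0}} = {}"
    by blast
  then show ?thesis by (simp only: dout_def card.empty)
qed

section \<open>Correctness of the augmentation loop\<close>

context sgraph
begin

definition good :: "st \<Rightarrow> bool" where
  "good s \<longleftrightarrow> fst s 1 = n \<and> fst s 2 = 2 * n \<and>
     (\<forall>x<n. \<forall>y<n. snd s 2 (2 * n * x + y) \<noteq> 0 \<longleftrightarrow> adj x y)"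

definition rep :: "st \<Rightarrow> nat \<Rightarrow> nat set \<Rightarrow> bool" where
  "rep s k A \<longleftrightarrow> (\<forall>v<n. snd s k v \<noteq> 0 \<longleftrightarrow> v \<in> A)"

lemma good_frame: "good s \<Longrightarrow> 1 \<notin> wv c \<Longrightarrow> 2 \<notin> wv c \<Longrightarrow> 2 \<notin> wa c \<Longrightarrow> good (exec c s)"
  by (simp add: good_def exec_frame)

lemma rep_frame: "rep s k A \<Longrightarrow> k \<notin> wa c \<Longrightarrow> rep (exec c s) k A"
  by (simp add: rep_def exec_frame)

lemma good_setv [simp]: "x \<noteq> 1 \<Longrightarrow> x \<noteq> 2 \<Longrightarrow> good (setv x i s) = good s"
  by (simp add: good_def)

lemma rep_setv [simp]: "rep (setv x i s) k A = rep s k A"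
  by (simp add: rep_def)

text \<open>
  Invariant of the augmentation loop: after \<open>l\<close> path reversals, counted in variable 11, every cut has lost \<open>l\<close> arcs, and
  either all rounds so far were successful or some cut is already saturated.
\<close>

definition flow :: "nat set \<Rightarrow> nat set \<Rightarrow> nat \<Rightarrow> st \<Rightarrow> bool" where
  "flow S T i s \<longleftrightarrow> good s \<and> rep s 4 T \<and> (\<forall>x<2 * n. snd s 8 x \<noteq> 0 \<longleftrightarrow> n \<le> x \<and> x - n \<in> S) \<and>
     asym_arcs (mat (2 * n) (snd s 6)) \<and>
     (\<forall>Y. valid S T Y \<longrightarrow> dout (mat (2 * n) (snd s 6)) Y + fst s 11 = dout arcs0 Y) \<and>
     (fst s 11 = i \<or> (\<exists>Y. valid S T Y \<and> dout (mat (2 * n) (snd s 6)) Y = 0))"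

lemma valid_source: "valid S T Y \<Longrightarrow> x < 2 * n \<Longrightarrow> n \<le> x \<Longrightarrow> x - n \<in> S \<Longrightarrow> x \<in> Y"
  by (auto simp: valid_def)

text \<open>Either a sink is reached and every valid cut loses one arc, or the reached set is itself
  a valid cut without outgoing arcs.\<close>

lemma augment_correct:
  assumes F: "flow S T i s" and T: "S \<inter> T = {}"
  shows "flow S T (Suc i) (exec augment s)"
proof -
  let ?N = "2 * n"
  define s1 where "s1 = exec bfs s"
  define D where "D = snd s1 7"
  let ?E = "snd s 6" and ?R = "snd s 8"
  have N: "fst s 2 = ?N" "fst s 1 = n" using F by (simp_all add: flow_def good_def)
  have d: "dist_ok ?N ?E ?R D" using bfs_correct[OF N(1)] by (simp add: D_def s1_def)
  have f1: "fst s1 2 = ?N" "fst s1 1 = n" "fst s1 11 = fst s 11" "snd s1 6 = ?E" "snd s1 8 = ?R"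
    "snd s1 4 = snd s 4" "snd s1 2 = snd s 2"
    using N by (simp_all add: s1_def exec_frame bfs_frame)
  let ?le = "andE (leE (V 1) (V 20)) (andE (Ar 4 (Mi (V 20) (V 1))) (Ar 7 (V 20)))"
  define P where "P z \<longleftrightarrow> n \<le> z \<and> snd s 4 (z - n) \<noteq> 0 \<and> D z \<noteq> 0" for z
  define z where "z = lst ?N P"
  have le: "ev (leastE 20 21 (V 2) ?le) s1 = z"
    using ev_leastE[of s1 2 ?le 20 21 P] f1 by (simp add: P_def D_def z_def)
  define s2 where "s2 = setv 13 z s1"
  have ex: "exec augment s = (if z < ?N then exec trace (setv 11 (fst s1 11 + 1) (setv 8 0 s2)) else s2)"
    using le f1 by (simp add: augment_def s1_def[symmetric] s2_def)
  show ?thesis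
  proof (cases "z < ?N")
    case False
    have nP: "\<not> P x" if "x < ?N" for x using lst_found(2)[of x ?N P] that False by (auto simp: z_def)
    let ?Y = "{x. x < ?N \<and> D x \<noteq> 0}"
    have "D (v + n) = 1" if "v \<in> S" "v < n" for v
      using d F that unfolding dist_ok_def flow_def by auto
    moreover have "\<not> (v + n < ?N \<and> D (v + n) \<noteq> 0)" if "v \<in> T" for v
      using nP[of "v + n"] F that by (auto simp: P_def flow_def rep_def)
    ultimately have "valid S T ?Y" by (auto simp: valid_def)
    with dist_closed[OF d] show ?thesis
      using F False f1 unfolding ex by (auto simp: flow_def s2_def good_def rep_def)
  next
    case True
    then have P: "P z" unfolding z_def by (rule lst_less)
    define s3 where "s3 = setv 11 (fst s1 11 + 1) (setv 8 0 s2)"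
    have f3: "fst s3 2 = ?N" "fst s3 13 = z" "snd s3 6 = ?E" "snd s3 7 = D" "snd s3 8 = ?R"
      "snd s3 4 = snd s 4" "snd s3 2 = snd s 2" "fst s3 11 = fst s 11 + 1" "fst s3 1 = n"
      using f1 by (simp_all add: s3_def s2_def D_def)
    have e3: "exec augment s = exec trace s3" using True by (simp add: ex s3_def)
    let ?A = "mat ?N (snd (exec trace s3) 6)"
    have tr: "asym_arcs ?A \<and> (\<exists>x<?N. ?R x \<noteq> 0 \<and>
        (\<forall>Y. dout ?A Y + of_bool (x \<in> Y) = dout (mat ?N ?E) Y + of_bool (z \<in> Y)))"
      using trace_correct[of s3 ?N ?R] f3 True F d P by (simp add: flow_def P_def)
    then obtain x where x: "x < ?N" "?R x \<noteq> 0"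
      "\<And>Y. dout ?A Y + of_bool (x \<in> Y) = dout (mat ?N ?E) Y + of_bool (z \<in> Y)" by blast
    have xs: "n \<le> x" "x - n \<in> S" using F x(1,2) by (auto simp: flow_def)
    have down: "dout ?A Y + 1 = dout (mat ?N ?E) Y" if "valid S T Y" for Y
    proof -
      have "x \<in> Y" using valid_source[OF that x(1) xs] .
      moreover have "z - n \<in> T" using P True F by (auto simp: P_def flow_def rep_def)
      then have "z \<notin> Y" using that P True by (auto simp: valid_def P_def)
      ultimately show ?thesis using x(3)[of Y] by simp
    qed
    have fr: "fst (exec trace s3) 1 = n" "fst (exec trace s3) 2 = ?N" "fst (exec trace s3) 11 = fst s 11 + 1"
      "snd (exec trace s3) 2 = snd s 2" "snd (exec trace s3) 4 = snd s 4" "snd (exec trace s3) 8 = ?R"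
      using f3 by (simp_all add: exec_frame trace_frame)
    \<comment> \<open>Every valid cut could still be lowered, so none was saturated and all earlier
      rounds had succeeded.\<close>
    have "\<not> (\<exists>Y. valid S T Y \<and> dout (mat ?N ?E) Y = 0)" using down by fastforce
    then have "fst s 11 = i" using F by (auto simp: flow_def)
    moreover have "dout ?A Y + (fst s 11 + 1) = dout arcs0 Y" if "valid S T Y" for Y
      using down[OF that] F that by (auto simp: flow_def)
    ultimately show ?thesis unfolding e3 using F tr fr by (auto simp: flow_def good_def rep_def)
  qed
qed

lemma splitg_correct:
  assumes g: "good s" shows "mat (2 * n) (snd (exec splitg s) 6) = arcs0"
proof -
  have "snd (exec splitg s) 6 (2 * n * x + y)
      = of_bool (y = x + n \<or> (n \<le> x \<and> y < n \<and> snd s 2 (2 * n * (x - n) + y) \<noteq> 0))"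
    if "x < 2 * n" "y < 2 * n" for x y
    unfolding splitg_def
    by (rule exec_mat) (use g that in \<open>auto simp: good_def ev_mulE\<close>)
  moreover have "snd s 2 (2 * n * (x - n) + y) \<noteq> 0 \<longleftrightarrow> adj (x - n) y" if "x < 2 * n" "n \<le> x" "y < n" for x y
    using g that by (auto simp: good_def)
  ultimately show ?thesis by (auto simp: mat_def arcs0_def)
qed

text \<open>\<open>S\<close> itself has at most \<open>n\<close> neighbours, so \<open>2 * n\<close>
  successful rounds are impossible and some cut is saturated at the end.\<close>

theorem mcut_correct:
  assumes g: "good s" and S: "rep s 5 S" and T: "rep s 4 T" and sp: "sep S T S" and n: "n > 0"
  shows "fst (exec mcut s) 11 = lam S T" "rep (exec mcut s) 9 (Rmin S T)"
proof -
  let ?N = "2 * n"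
  define s1 where "s1 = exec splitg s"
  define s2 where "s2 = exec (Fo 23 (V 2) (Pt 8 (V 23) (andE (leE (V 1) (V 23)) (Ar 5 (Mi (V 23) (V 1)))))) s1"
  define s3 where "s3 = setv 11 0 s2"
  define s4 where "s4 = exec (Fo 25 (V 2) augment) s3"
  define s5 where "s5 = exec bfs s4"
  have ex: "exec mcut s = exec (Fo 23 (V 1) (Pt 9 (V 23) (Ar 7 (Pl (V 23) (V 1))))) s5"
    by (simp only: mcut_def exec.simps(1,3) ev.simps s1_def s2_def s3_def s4_def s5_def)
  have ST: "S \<inter> T = {}" "S \<subseteq> {..<n}" using sp by (auto simp: sep_def)
  have f1: "fst s1 1 = n" "fst s1 2 = ?N" "snd s1 5 = snd s 5" "snd s1 4 = snd s 4" "snd s1 2 = snd s 2"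
    using g by (simp_all add: s1_def exec_frame splitg_def good_def)
  have "snd s2 8 x = of_bool (n \<le> x \<and> snd s 5 (x - n) \<noteq> 0)" if "x < ?N" for x
    unfolding s2_def by (rule exec_tab0) (use that f1 in auto)
  then have src: "snd s2 8 x \<noteq> 0 \<longleftrightarrow> n \<le> x \<and> x - n \<in> S" if "x < ?N" for x
    using S that by (auto simp: rep_def)
  have f2: "fst s2 1 = n" "fst s2 2 = ?N" "snd s2 4 = snd s 4" "snd s2 2 = snd s 2" "snd s2 6 = snd s1 6"
    using f1 by (simp_all add: s2_def exec_frame)
  have F3: "flow S T 0 s3"
    using src f2 g T splitg_correct[OF g] arcs0_antisym
    by (auto simp: flow_def s3_def good_def rep_def s1_def asym_arcs_def)
  have "flow S T ?N (iter (\<lambda>i w. exec augment (setv 25 i w)) ?N s3)"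
  proof (rule iter_inv[of "flow S T"])
    fix i w assume "flow S T i w"
    then have "flow S T i (setv 25 i w)" by (simp add: flow_def)
    then show "flow S T (Suc i) (exec augment (setv 25 i w))" by (rule augment_correct[OF _ ST(1)])
  qed (rule F3)
  then have F4: "flow S T ?N s4" using f2 by (simp add: s4_def s3_def exec.simps(4))
  let ?A = "mat ?N (snd s4 6)"
  have inv: "\<And>Y. valid S T Y \<Longrightarrow> dout ?A Y + fst s4 11 = dout arcs0 Y" using F4 by (simp add: flow_def)
  have "fst s4 11 \<noteq> ?N"
    using inv[OF Ycut_valid(1)[OF sp]] Ycut_valid(2)[OF sp] card_nb_le[of S] n by auto
  then obtain Y1 where Y1: "valid S T Y1" "dout ?A Y1 = 0" using F4 by (auto simp: flow_def)
  define D where "D = snd s5 7"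
  have d: "dist_ok ?N (snd s4 6) (snd s4 8) D"
    using bfs_correct[of s4 ?N] F4 by (simp add: D_def s5_def flow_def good_def)
  let ?Y = "{x. x < ?N \<and> D x \<noteq> 0}"
  have least: "?Y \<subseteq> Y" if "valid S T Y" "dout ?A Y = 0" for Y
  proof
    fix x assume "x \<in> ?Y"
    then show "x \<in> Y"
      using dist_reach[OF d _ that(2), of x] valid_source[OF that(1)] F4 by (auto simp: flow_def)
  qed
  have "v + n \<in> ?Y" if "v \<in> S" "v < n" for v
  proof -
    have "snd s4 8 (v + n) \<noteq> 0" using F4 that by (auto simp: flow_def)
    then have "D (v + n) = 1" using d that unfolding dist_ok_def by auto
    then show ?thesis using that by simp
  qed
  moreover have "v + n \<notin> ?Y" if "v \<in> T" for v
    using least[OF Y1] Y1(1) that unfolding valid_def by blast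
  ultimately have vY: "valid S T ?Y" by (auto simp: valid_def)
  have res1: "lam S T = fst s4 11" by (rule residual_mincut(1)[OF sp inv vY dist_closed[OF d] least])
  have res2: "Rmin S T = {v. v < n \<and> v + n \<in> ?Y}"
    by (rule residual_mincut(2)[OF sp inv vY dist_closed[OF d] least])
  have f5: "fst s5 1 = n" "fst s5 11 = fst s4 11"
    using F4 by (simp_all add: s5_def exec_frame bfs_frame flow_def good_def)
  have "fst (exec mcut s) 11 = fst s5 11" unfolding ex by (rule exec_frame) simp
  then show "fst (exec mcut s) 11 = lam S T" by (simp only: f5 res1)
  have a: "snd (exec mcut s) 9 v = D (v + n)" if "v < n" for v
    unfolding ex by (rule exec_tab0) (use that f5 in \<open>auto simp: D_def\<close>)
  have b: "v \<in> Rmin S T \<longleftrightarrow> D (v + n) \<noteq> 0" if "v < n" for v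
    unfolding res2 using that by simp
  show "rep (exec mcut s) 9 (Rmin S T)" unfolding rep_def
  proof (intro allI impI)
    fix v assume "v < n"
    then show "snd (exec mcut s) 9 v \<noteq> 0 \<longleftrightarrow> v \<in> Rmin S T" by (simp only: a b)
  qed
qed

end

section \<open>Computing a branching step\<close>

definition adjE :: "nat \<Rightarrow> nat \<Rightarrow> ex" where
  "adjE x y = Ar 2 (Pl (mulE 2 (V x)) (V y))"
definition nbE :: "nat \<Rightarrow> nat \<Rightarrow> nat \<Rightarrow> ex" where
  "nbE k x u = andE (notE (Ar k (V x))) (exE u (V 1) (andE (Ar k (V u)) (adjE u x)))"
definition nbs :: "nat \<Rightarrow> nat \<Rightarrow> cmd" where
  "nbs k l = Fo 30 (V 1) (Pt l (V 30) (nbE k 30 31))"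
definition cpy :: "nat \<Rightarrow> nat \<Rightarrow> cmd" where
  "cpy k l = Fo 30 (V 1) (Pt k (V 30) (Ar l (V 30)))"
definition pickE :: "nat \<Rightarrow> ex \<Rightarrow> ex" where
  "pickE k j = leastE 32 33 (V 1) (andE (Ar k (V 32))
     (eqE (Su 34 (V 1) (andE (ltE (V 34) (V 32)) (Ar k (V 34)))) j))"
text \<open>Tuple entries occupy the variables from 60 on, clear of all others. The \<open>c\<close>
  nested sums amount to trying \<open>n ^ c\<close> tuples, which is polynomial for fixed
  \<open>c\<close>.\<close>

primrec exQ :: "nat \<Rightarrow> ex \<Rightarrow> ex" where
  "exQ 0 b = nz b" | "exQ (Suc m) b = exE (60 + m) (V 1) (exQ m b)"
text \<open>Equality counts twice, and the adjacency term vanishes on equal vertices, so the sum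
  reproduces \<open>digit\<close>.\<close>

definition digE :: "nat \<Rightarrow> nat \<Rightarrow> ex" where
  "digE i j = Pl (Pl (eqE (V (60 + i)) (V (60 + j))) (eqE (V (60 + i)) (V (60 + j))))
     (nz (adjE (60 + i) (60 + j)))"
definition typeE :: "nat \<Rightarrow> (nat \<Rightarrow> nat \<Rightarrow> ex) \<Rightarrow> ex" where
  "typeE c pat = andL [eqE (digE i j) (pat i j). i \<leftarrow> [0..<c], j \<leftarrow> [0..<c]]"
definition matchE :: "nat \<Rightarrow> (nat \<Rightarrow> ex) \<Rightarrow> ex" where
  "matchE c hx = andE
     (andL [orE (andE (notE (Ar 12 (K (3 + i)))) (hx (60 + i)))
              (andE (Ar 12 (K (3 + i))) (eqE (V (60 + i)) (Ar 15 (K i)))). i \<leftarrow> [0..<c]])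
     (typeE c (\<lambda>i j. Ar 12 (K (3 + c + i * c + j))))"

text \<open>Division counts the positive multiples of the base that fit; the number of guesses in
  variable 7 bounds this count.\<close>

definition rdg :: "nat \<Rightarrow> cmd" where
  "rdg c = Fo 30 (K (3 + c + c * c)) (Sq
     (As 16 (Su 20 (V 7) (leE (Su 21 (V 5) (Pl (V 20) (K 1))) (V 9))))
     (Sq (Pt 12 (V 30) (Mi (V 9) (Su 21 (V 5) (V 16)))) (As 9 (V 16))))"
definition roots :: "nat \<Rightarrow> cmd" where
  "roots c = Fo 30 (K c) (Pt 15 (V 30) (pickE 16 (Mi (Ar 12 (Pl (K 3) (V 30))) (K 1))))"
definition rmax :: cmd where
  "rmax = Fo 35 (V 1) (Sq (cpy 5 3) (Sq (Pt 5 (V 35) (K 1)) (Sq mcut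
     (Pt 10 (V 35) (andE (notE (Ar 4 (V 35))) (eqE (V 11) (V 12)))))))"
definition nextlevel :: cmd where
  "nextlevel = Sq (Fo 30 (V 1) (Pt 19 (V 30) (Ar 11 (Pl (mulE 2 (V 35)) (V 30)))))
     (Sq (nbs 19 20)
     (Sq (Fo 30 (V 1) (Pt 5 (V 30) (andE (orE (Ar 19 (V 30)) (Ar 20 (V 30))) (notE (Ar 17 (V 30))))))
     (Sq mcut
     (Fo 30 (V 1) (Pt 11 (Pl (mulE 2 (Pl (V 35) (K 1))) (V 30)) (Ar 9 (V 30)))))))"
definition levels :: cmd where
  "levels = Sq (cpy 11 14) (Fo 35 (V 2) nextlevel)"
definition lexE :: "nat \<Rightarrow> ex" where
  "lexE c = exQ c (andE (matchE c (\<lambda>q. Ar 14 (V q)))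
     (andL [orE (andE (ltE (K j) (V 36)) (eqE (V (60 + j)) (Ar 13 (K j))))
       (orE (andE (eqE (K j) (V 36)) (eqE (V (60 + j)) (V 37))) (ltE (V 36) (K j))). j \<leftarrow> [0..<c]]))"
definition lexf :: "nat \<Rightarrow> cmd" where
  "lexf c = Fo 36 (K c) (Pt 13 (V 36) (leastE 37 38 (V 1) (lexE c)))"
definition levE :: "nat \<Rightarrow> ex" where
  "levE c = exQ c (matchE c (\<lambda>q. Ar 11 (Pl (mulE 2 (V 39)) (V q))))"
text \<open>Each test reads array 12 again, which no branch writes, so at most one branch is
  taken.\<close>

definition ops :: "nat \<Rightarrow> cmd" where
  "ops c = Sq (IfC (andE (eqE (Ar 12 (K 0)) (K 0)) (ltE (Ar 12 (K 1)) (K c)))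
        (Pt 4 (Ar 13 (Ar 12 (K 1))) (K 1)))
    (Sq (IfC (eqE (Ar 12 (K 0)) (K 1)) (Pt 3 (pickE 17 (Ar 12 (K 1))) (K 1)))
    (Sq (IfC (eqE (Ar 12 (K 0)) (K 2)) (Sq (As 15 (Mi (leastE 39 40 (V 2) (levE c)) (Ar 12 (K 2))))
        (Fo 30 (V 1) (Pt 3 (V 30) (Ar 11 (Pl (mulE 2 (V 15)) (V 30)))))))
    (Sq (IfC (eqE (Ar 12 (K 0)) (K 3)) (Pt 4 (pickE 18 (Ar 12 (K 1))) (K 1)))
        (IfC (eqE (Ar 12 (K 0)) (K 4)) (Sq (Fo 30 (V 1)
          (Pt 19 (V 30) (andE (orE (Ar 3 (V 30)) (Ar 18 (V 30))) (notE (Ar 17 (V 30)))))) (cpy 3 19))))))"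
definition prep :: "nat \<Rightarrow> cmd" where
  "prep c = Sq (cpy 5 3) (Sq mcut (Sq (As 12 (V 11)) (Sq (cpy 14 9) (Sq (nbs 14 16)
     (Sq (roots c) (Sq rmax (Sq (nbs 10 17) (Sq (nbs 3 18) (Sq levels (lexf c))))))))))"
definition stepc :: "nat \<Rightarrow> cmd" where
  "stepc c = Sq (rdg c) (Sq (prep c) (ops c))"

lemma frames [simp]:
  "wv (nbs k l) = {30}" "wa (nbs k l) = {l}" "wv (cpy k l) = {30}" "wa (cpy k l) = {k}"
  "wv (roots c) = {30}" "wa (roots c) = {15}" "wv (lexf c) = {36}" "wa (lexf c) = {13}"
  "wv (rdg c) = {30, 16, 9}" "wa (rdg c) = {12}"
  by (auto simp: nbs_def cpy_def roots_def lexf_def rdg_def)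

lemma frames2 [simp]:
  "wv rmax = {35, 30} \<union> wv mcut" "wa rmax = {5, 10} \<union> wa mcut"
  "wv nextlevel = {30} \<union> wv mcut" "wa nextlevel = {19, 20, 5, 11} \<union> wa mcut"
  "wv levels = {30, 35} \<union> wv mcut" "wa levels = {19, 20, 5, 11} \<union> wa mcut"
  "wv (ops c) = {8, 15, 30}" "wa (ops c) = {3, 4, 19}"
  by (auto simp: rmax_def nextlevel_def levels_def ops_def IfC_def)

declare mcut_frame [simp]

section \<open>Semantics of the derived expressions\<close>

context sgraph
begin

lemma ev_adjE:
  assumes "good s" "fst s x < n" "fst s y < n" "x \<noteq> 8"
  shows "ev (adjE x y) s \<noteq> 0 \<longleftrightarrow> adj (fst s x) (fst s y)"
  using assms by (simp add: adjE_def good_def)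

lemma ev_nbE:
  assumes "good s" "rep s k A" "A \<subseteq> {..<n}" "fst s x < n" "u \<noteq> x" "u \<notin> {1, 2, 8}" "x \<notin> {1, 2, 8}"
  shows "ev (nbE k x u) s = of_bool (fst s x \<in> nb A)"
proof -
  have "fst s 1 = n" using assms by (simp add: good_def)
  moreover have "ev (adjE u x) (setv u i s) \<noteq> 0 \<longleftrightarrow> adj i (fst s x)" if "i < n" for i
    using ev_adjE[of "setv u i s" u x] assms that by simp
  ultimately have "ev (nbE k x u) s \<noteq> 0 \<longleftrightarrow> fst s x \<notin> A \<and> (\<exists>i<n. i \<in> A \<and> adj i (fst s x))"
    using assms by (simp add: nbE_def rep_def cong: conj_cong)
  also have "\<dots> \<longleftrightarrow> fst s x \<in> nb A" using assms(3,4) by (auto simp: nb_def)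
  finally show ?thesis by (simp add: nbE_def)
qed

lemma nbs_correct:
  assumes "good s" "rep s k A" "A \<subseteq> {..<n}" "k \<noteq> l" "l \<noteq> 2"
  shows "rep (exec (nbs k l) s) l (nb A)"
proof -
  have "snd (exec (nbs k l) s) l v = of_bool (v \<in> nb A)" if "v < n" for v
    unfolding nbs_def
  proof (rule exec_tab0)
    fix i s' assume i: "i < ev (V 1) s" "\<And>z. z \<noteq> 30 \<Longrightarrow> fst s' z = fst s z" "fst s' 30 = i"
      "\<And>m. m \<noteq> l \<Longrightarrow> snd s' m = snd s m"
    have "good s'" "rep s' k A" "fst s' 30 < n" using assms i by (simp_all add: good_def rep_def)
    then show "ev (nbE k 30 31) s' = of_bool (i \<in> nb A)" using ev_nbE[of s' k A 30 31] assms(3) i(3) by simp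
  qed (use assms that in \<open>simp add: good_def\<close>)
  then show ?thesis by (simp add: rep_def)
qed

lemma cpy_correct:
  assumes "good s" "rep s l A" "k \<noteq> l" shows "rep (exec (cpy k l) s) k A"
proof -
  have "snd (exec (cpy k l) s) k v = snd s l v" if "v < n" for v
    unfolding cpy_def by (rule exec_tab0) (use assms that in \<open>auto simp: good_def\<close>)
  then show ?thesis using assms by (simp add: rep_def)
qed

end

context branching
begin

lemma ev_pickE:
  assumes "fst s 1 = n" "rep s k A" "\<And>a b d. ev j (setv 32 a (setv 33 b s)) = jv"
  shows "ev (pickE k j) s = pick A jv"
proof -
  have "ev (pickE k j) s = lst (fst s 1) (\<lambda>v. v \<in> A \<and> card {u \<in> A. u < v} = jv)"
    unfolding pickE_def
  proof (rule ev_leastE)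
    fix i b assume i: "i < fst s 1"
    have "{u. u < n \<and> u < i \<and> u \<in> A} = {u \<in> A. u < i}" using i assms(1) by auto
    then show "ev (andE (Ar k (V 32)) (eqE (Su 34 (V 1) (andE (ltE (V 34) (V 32)) (Ar k (V 34)))) j))
       (setv 32 i (setv 33 b s)) \<noteq> 0 \<longleftrightarrow> i \<in> A \<and> card {u \<in> A. u < i} = jv"
      using assms i by (simp add: sum_of_bool rep_def cong: conj_cong)
  qed auto
  then show ?thesis using assms(1) by (simp add: pick_def)
qed

definition setq :: "nat \<Rightarrow> (nat \<Rightarrow> nat) \<Rightarrow> st \<Rightarrow> st" where
  "setq m q s = (\<lambda>x. if 60 \<le> x \<and> x < 60 + m then q (x - 60) else fst s x, snd s)"

lemma setq_simps [simp]:
  "snd (setq m q s) = snd s" "x < 60 \<Longrightarrow> fst (setq m q s) x = fst s x"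
  "i < m \<Longrightarrow> fst (setq m q s) (60 + i) = q i"
  by (simp_all add: setq_def)

lemma ev_exQ: "ev (exQ m b) s \<noteq> 0 \<longleftrightarrow> (\<exists>q. (\<forall>i<m. q i < fst s 1) \<and> ev b (setq m q s) \<noteq> 0)"
proof (induction m arbitrary: s)
  case 0
  have "setq 0 q s = s" for q by (simp add: setq_def prod_eq_iff fun_eq_iff)
  then show ?case by simp
next
  case (Suc m)
  have e: "setq m q (setv (60 + m) v s) = setq (Suc m) (q(m := v)) s" for q v
    by (auto simp: setq_def fun_eq_iff)
  have "ev (exQ (Suc m) b) s \<noteq> 0 \<longleftrightarrow>
      (\<exists>v<fst s 1. \<exists>q. (\<forall>i<m. q i < fst s 1) \<and> ev b (setq (Suc m) (q(m := v)) s) \<noteq> 0)"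
    using Suc.IH by (simp add: e)
  also have "\<dots> \<longleftrightarrow> (\<exists>q. (\<forall>i<Suc m. q i < fst s 1) \<and> ev b (setq (Suc m) q s) \<noteq> 0)" (is "?L \<longleftrightarrow> ?R")
  proof
    assume ?L
    then obtain v q where "v < fst s 1" "\<forall>i<m. q i < fst s 1" "ev b (setq (Suc m) (q(m := v)) s) \<noteq> 0"
      by blast
    then show ?R by (intro exI[of _ "q(m := v)"]) (simp add: less_Suc_eq)
  next
    assume ?R
    then obtain q where "\<forall>i<Suc m. q i < fst s 1" "ev b (setq (Suc m) q s) \<noteq> 0" by blast
    then show ?L by (intro exI[of _ "q m"] conjI exI[of _ q]) auto
  qed
  finally show ?case .
qed

lemma ev_digE:
  assumes "good s" "i < c" "j < c" "q i < n" "q j < n"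
  shows "ev (digE i j) (setq c q s) = digit (q i) (q j)"
proof -
  have "good (setq c q s)" using assms(1) by (simp add: good_def)
  then have "ev (adjE (60 + i) (60 + j)) (setq c q s) \<noteq> 0 \<longleftrightarrow> adj (q i) (q j)"
    using ev_adjE[of "setq c q s" "60 + i" "60 + j"] assms by simp
  then show ?thesis using assms adj_irrefl by (simp add: digE_def digit_def)
qed

lemma ev_typeE:
  assumes "good s" "\<And>i. i < c \<Longrightarrow> q i < n"
    "\<And>i j. i < c \<Longrightarrow> j < c \<Longrightarrow> ev (pat i j) (setq c q s) = \<phi> i j"
  shows "ev (typeE c pat) (setq c q s) \<noteq> 0 \<longleftrightarrow> has_type q \<phi>"
  using assms ev_digE[OF assms(1), of _ _ q]
  by (auto simp: typeE_def has_type_def)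

lemma ev_matchE:
  assumes g: "good s" and q: "\<And>i. i < c \<Longrightarrow> q i < n"
    and r: "\<And>i. i < c \<Longrightarrow> snd s 15 i = pick D (snd s 12 (3 + i) - 1)"
    and h: "\<And>i. i < c \<Longrightarrow> ev (hx (60 + i)) (setq c q s) \<noteq> 0 \<longleftrightarrow> q i \<in> B"
  shows "ev (matchE c hx) (setq c q s) \<noteq> 0 \<longleftrightarrow> matches (snd s 12) D B q"
proof -
  have "ev (typeE c (\<lambda>i j. Ar 12 (K (3 + c + i * c + j)))) (setq c q s) \<noteq> 0
      \<longleftrightarrow> has_type q (\<lambda>i j. snd s 12 (3 + c + i * c + j))"
    by (rule ev_typeE) (use g q in auto)
  moreover have "(\<forall>i<c. (snd s 12 (3 + i) = 0 \<and> q i \<in> B) \<or> (snd s 12 (3 + i) \<noteq> 0 \<and> q i = snd s 15 i)) \<longleftrightarrow>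
    (\<forall>i<c. q i < n \<and> (if snd s 12 (3 + i) = 0 then q i \<in> B else q i = pick D (snd s 12 (3 + i) - 1)))"
    using q r by auto
  ultimately show ?thesis unfolding matchE_def matches_def using h
    by (simp add: atLeast0LessThan Ball_def)
qed

end

section \<open>Correctness of the ingredients of a step\<close>

context branching
begin

definition base :: "st \<Rightarrow> nat set \<Rightarrow> nat set \<Rightarrow> bool" where
  "base s S T \<longleftrightarrow> good s \<and> rep s 3 S \<and> rep s 4 T"

lemma base_frame:
  "base s S T \<Longrightarrow> 1 \<notin> wv d \<Longrightarrow> 2 \<notin> wv d \<Longrightarrow> 2 \<notin> wa d \<Longrightarrow> 3 \<notin> wa d \<Longrightarrow> 4 \<notin> wa d \<Longrightarrow>
    base (exec d s) S T"
  by (simp add: base_def good_frame rep_frame)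

lemma base_setv [simp]: "x \<noteq> 1 \<Longrightarrow> x \<noteq> 2 \<Longrightarrow> base (setv x i s) S T = base s S T"
  by (simp add: base_def)

lemma rdg_correct:
  assumes v: "fst s 7 = Kk" "fst s 5 = Gm" "fst s 9 = X" "X \<le> Kk" "0 < Gm"
  defines "s' \<equiv> exec (rdg c) s"
  shows "fst s' 9 = X div Gm ^ (3 + c + c * c)"
    "\<And>i. i < 3 + c + c * c \<Longrightarrow> snd s' 12 i = X div Gm ^ i mod Gm"
proof -
  let ?d = "Sq (As 16 (Su 20 (V 7) (leE (Su 21 (V 5) (Pl (V 20) (K 1))) (V 9))))
     (Sq (Pt 12 (V 30) (Mi (V 9) (Su 21 (V 5) (V 16)))) (As 9 (V 16)))"
  let ?m = "3 + c + c * c"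
  let ?I = "\<lambda>i (w :: st). fst w 7 = Kk \<and> fst w 5 = Gm \<and> fst w 9 = X div Gm ^ i \<and>
    (\<forall>j<i. snd w 12 j = X div Gm ^ j mod Gm)"
  have main: "?I ?m (iter (\<lambda>i w. exec ?d (setv 30 i w)) ?m s)"
  proof (rule iter_inv[of ?I])
    fix i w assume I: "?I i w"
    define Y where "Y = X div Gm ^ i"
    have "Y \<le> Kk" unfolding Y_def by (rule order.trans[OF div_le_dividend v(4)])
    then have "Y div Gm \<le> Kk" by (rule order.trans[OF div_le_dividend])
    have "{a. a < Kk \<and> Gm * Suc a \<le> Y} = {..<Y div Gm}"
    proof -
      have h: "Gm * Suc a \<le> Y \<longleftrightarrow> Suc a \<le> Y div Gm" for a
        using less_eq_div_iff_mult_less_eq[OF v(5), of "Suc a" Y] by (simp add: mult.commute)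
      show ?thesis unfolding h using \<open>Y div Gm \<le> Kk\<close> by auto
    qed
    then have q: "ev (Su 20 (V 7) (leE (Su 21 (V 5) (Pl (V 20) (K 1))) (V 9))) (setv 30 i w) = Y div Gm"
      using I by (simp add: sum_of_bool Y_def)
    have "Y - Gm * (Y div Gm) = Y mod Gm" by (simp add: minus_mult_div_eq_mod)
    moreover have "Y div Gm = X div Gm ^ Suc i" by (simp only: Y_def power_Suc2 div_mult2_eq)
    moreover have "fst w 9 = Y" using I by (simp add: Y_def)
    moreover have ex: "exec ?d (setv 30 i w) = exec (Sq (Pt 12 (V 30) (Mi (V 9) (Su 21 (V 5) (V 16)))) (As 9 (V 16)))
        (setv 16 (Y div Gm) (setv 30 i w))" by (simp only: exec.simps(1,3) q)
    ultimately show "?I (Suc i) (exec ?d (setv 30 i w))"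
      unfolding ex using I by (simp del: power_Suc add: less_Suc_eq Y_def[symmetric])
  qed (use v in auto)
  have e: "s' = iter (\<lambda>i w. exec ?d (setv 30 i w)) ?m s"
    by (simp only: s'_def rdg_def exec.simps(4) ev.simps)
  show "fst s' 9 = X div Gm ^ ?m" "\<And>i. i < ?m \<Longrightarrow> snd s' 12 i = X div Gm ^ i mod Gm"
    unfolding e using main by blast+
qed

lemma roots_correct:
  assumes g: "good s" and D: "rep s 16 D" and i: "i < c"
  shows "snd (exec (roots c) s) 15 i = pick D (snd s 12 (3 + i) - 1)"
  unfolding roots_def
proof (rule exec_tab0)
  fix i s' assume s': "\<And>z. z \<noteq> 30 \<Longrightarrow> fst s' z = fst s z" "fst s' 30 = i" "\<And>l. l \<noteq> 15 \<Longrightarrow> snd s' l = snd s l"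
  then have "fst s' 1 = n" "rep s' 16 D" using g D by (simp_all add: good_def rep_def)
  then show "ev (pickE 16 (Mi (Ar 12 (Pl (K 3) (V 30))) (K 1))) s' = pick D (snd s 12 (3 + i) - 1)"
    by (rule ev_pickE) (use s' in simp)
qed (use i in simp)

lemma rmax_correct:
  assumes b: "base s S T" and sp: "sep S T S" and n: "n > 0" and l: "fst s 12 = lam S T"
  shows "rep (exec rmax s) 10 (Rmax S T)"
proof -
  let ?d = "Sq (cpy 5 3) (Sq (Pt 5 (V 35) (K 1)) (Sq mcut
     (Pt 10 (V 35) (andE (notE (Ar 4 (V 35))) (eqE (V 11) (V 12))))))"
  let ?I = "\<lambda>i (w :: st). base w S T \<and> fst w 12 = lam S T \<and> (\<forall>v<i. snd w 10 v \<noteq> 0 \<longleftrightarrow> v \<in> Rmax S T)"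
  have main: "?I n (iter (\<lambda>i w. exec ?d (setv 35 i w)) n s)"
  proof (rule iter_inv[of ?I])
    fix i w assume i: "i < n" and I: "?I i w"
    define w1 where "w1 = exec (cpy 5 3) (setv 35 i w)"
    define w2 where "w2 = seta 5 i 1 w1"
    define w3 where "w3 = exec mcut w2"
    have b1: "base w1 S T" "rep w1 5 S"
      using I base_frame[of "setv 35 i w" S T "cpy 5 3"] cpy_correct[of "setv 35 i w" 3 S 5]
      by (simp_all add: w1_def base_def)
    have f1: "fst w1 35 = i" "fst w1 12 = lam S T" "snd w1 10 = snd w 10"
      using I by (simp_all add: w1_def exec_frame)
    have b2: "base w2 S T" "rep w2 5 (insert i S)" using b1 by (auto simp: w2_def base_def good_def rep_def)
    have b3: "base w3 S T" using base_frame[OF b2(1), of mcut] by (simp add: w3_def)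
    have f3: "fst w3 35 = i" "fst w3 12 = lam S T" "snd w3 10 = snd w 10"
      using f1 by (simp_all add: w3_def w2_def exec_frame)
    have "fst w3 11 = lam (insert i S) T" if "i \<notin> T"
      unfolding w3_def
      by (rule mcut_correct(1)[OF _ b2(2)]) (use b2 sp i that n in \<open>auto simp: base_def sep_def\<close>)
    then have val: "(snd w3 4 i = 0 \<and> fst w3 11 = fst w3 12) \<longleftrightarrow> i \<in> Rmax S T"
      using in_Rmax_iff[OF sp, of i] i b3 f3 by (auto simp: base_def rep_def)
    have ex: "exec ?d (setv 35 i w) = seta 10 i (of_bool (snd w3 4 i = 0 \<and> fst w3 11 = fst w3 12)) w3"
    proof -
      have "exec ?d (setv 35 i w) = exec (Pt 10 (V 35) (andE (notE (Ar 4 (V 35))) (eqE (V 11) (V 12))))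
          (exec mcut (exec (Pt 5 (V 35) (K 1)) w1))"
        by (simp only: exec.simps(3) w1_def)
      also have "exec (Pt 5 (V 35) (K 1)) w1 = w2" by (simp add: w2_def f1)
      finally show ?thesis unfolding w3_def[symmetric] by (simp add: f3)
    qed
    show "?I (Suc i) (exec ?d (setv 35 i w))"
      unfolding ex using I b3 f3 val by (auto simp: base_def good_def rep_def less_Suc_eq)
  qed (use b l in auto)
  have "fst s 1 = n" using b by (simp add: base_def good_def)
  then have e: "exec rmax s = iter (\<lambda>i w. exec ?d (setv 35 i w)) n s"
    by (simp only: rmax_def exec.simps(4) ev.simps)
  show ?thesis unfolding e rep_def using main by blast
qed

text \<open>Rows up to \<open>2 * n\<close> are covered, beyond the point where levels stabilise,
  because a failed level search addresses row \<open>2 * n\<close>.\<close>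

lemma levels_correct:
  assumes b: "base s S T" and sp: "sep S T S" and n: "n > 0"
    and B: "rep s 14 (Rmin S T)" and M: "rep s 17 (nb (Rmax S T))"
  shows "\<forall>r\<le>2 * n. \<forall>v<n. snd (exec levels s) 11 (2 * n * r + v) \<noteq> 0 \<longleftrightarrow> v \<in> level S T r"
proof -
  let ?N = "2 * n"
  let ?I = "\<lambda>l (w :: st). base w S T \<and> rep w 17 (nb (Rmax S T)) \<and>
    (\<forall>r\<le>l. \<forall>v<n. snd w 11 (?N * r + v) \<noteq> 0 \<longleftrightarrow> v \<in> level S T r)"
  define s0 where "s0 = exec (cpy 11 14) s"
  have b0: "base s0 S T" "rep s0 11 (Rmin S T)" "rep s0 17 (nb (Rmax S T))"
    using b B M base_frame[OF b, of "cpy 11 14"] cpy_correct[of s 14 "Rmin S T" 11]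
    by (simp_all add: s0_def base_def rep_frame)
  have main: "?I ?N (iter (\<lambda>i w. exec nextlevel (setv 35 i w)) ?N s0)"
  proof (rule iter_inv[of ?I])
    show "?I 0 s0" using b0 by (auto simp: rep_def)
  next
    fix l w assume l: "l < ?N" and I: "?I l w"
    let ?H = "level S T l" and ?M = "Rmax S T"
    define w1 where "w1 = exec (Fo 30 (V 1) (Pt 19 (V 30) (Ar 11 (Pl (mulE 2 (V 35)) (V 30))))) (setv 35 l w)"
    define w2 where "w2 = exec (nbs 19 20) w1"
    define w3 where "w3 = exec (Fo 30 (V 1) (Pt 5 (V 30) (andE (orE (Ar 19 (V 30)) (Ar 20 (V 30))) (notE (Ar 17 (V 30)))))) w2"
    define w4 where "w4 = exec mcut w3"
    define w5 where "w5 = exec (Fo 30 (V 1) (Pt 11 (Pl (mulE 2 (Pl (V 35) (K 1))) (V 30)) (Ar 9 (V 30)))) w4"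
    have ex: "exec nextlevel (setv 35 l w) = w5"
      by (simp only: nextlevel_def exec.simps(3) w1_def w2_def w3_def w4_def w5_def)
    have gw: "fst w 1 = n" "fst w 2 = ?N" using I by (simp_all add: base_def good_def)
    have "snd w1 19 v = snd w 11 (?N * l + v)" if "v < n" for v
      unfolding w1_def by (rule exec_tab0) (use gw that in auto)
    then have H1: "rep w1 19 ?H" using I by (simp add: rep_def)
    have b1: "base w1 S T" unfolding w1_def by (rule base_frame) (use I in auto)
    have f1: "fst w1 35 = l" "snd w1 11 = snd w 11" "snd w1 17 = snd w 17"
      by (simp_all add: w1_def exec_frame)
    have mH: "mincut S T ?H" using mincut_level[OF sp] .
    then have Hn: "?H \<subseteq> {..<n}" by (auto simp: mincut_def sep_def)
    have H2: "rep w2 19 ?H" "rep w2 20 (nb ?H)"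
      using H1 b1 nbs_correct[OF _ H1 Hn] by (simp_all add: w2_def base_def rep_frame)
    have b2: "base w2 S T" unfolding w2_def by (rule base_frame[OF b1]) auto
    have f2: "fst w2 35 = l" "snd w2 11 = snd w 11" "snd w2 17 = snd w 17"
      using f1 by (simp_all add: w2_def exec_frame)
    have "snd w3 5 v = of_bool ((snd w2 19 v \<noteq> 0 \<or> snd w2 20 v \<noteq> 0) \<and> snd w2 17 v = 0)" if "v < n" for v
      unfolding w3_def by (rule exec_tab0) (use b2 that in \<open>auto simp: base_def good_def\<close>)
    then have L3: "rep w3 5 (lnext ?M ?H)" using H2 f2 I by (auto simp: rep_def lnext_def)
    have b3: "base w3 S T" unfolding w3_def by (rule base_frame[OF b2]) auto
    have f3: "fst w3 35 = l" "snd w3 11 = snd w 11" "snd w3 17 = snd w 17"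
      using f2 by (simp_all add: w3_def exec_frame)
    have R4: "rep w4 9 (level S T (Suc l))" unfolding w4_def level.simps
      by (rule mcut_correct(2)[OF _ L3]) (use b3 n lnext_mincut(1)[OF mH sp] in \<open>auto simp: base_def\<close>)
    have b4: "base w4 S T" unfolding w4_def by (rule base_frame[OF b3]) auto
    have f4: "fst w4 35 = l" "snd w4 11 = snd w 11" "snd w4 17 = snd w 17"
      using f3 by (simp_all add: w4_def exec_frame)
    have g4: "fst w4 1 = n" "fst w4 2 = ?N" using b4 by (simp_all add: base_def good_def)
    have t5: "snd w5 11 j = (if ?N * Suc l \<le> j \<and> j < ?N * Suc l + ev (V 1) w4
        then snd w4 9 (j - ?N * Suc l) else snd w4 11 j)" for j
      unfolding w5_def by (rule exec_tab) (use g4 f4 in \<open>auto simp: ev_mulE\<close>)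
    have b5: "base w5 S T" unfolding w5_def by (rule base_frame[OF b4]) auto
    have f5: "snd w5 17 = snd w 17" using f4 by (simp add: w5_def exec_frame)
    have low: "snd w5 11 (?N * r + v) = snd w 11 (?N * r + v)" if "r \<le> l" "v < n" for r v
    proof -
      have "?N * r + v < ?N * Suc r" using that by simp
      also have "\<dots> \<le> ?N * Suc l" using that by (intro mult_le_mono2) simp
      finally show ?thesis using t5[of "?N * r + v"] f4 by simp
    qed
    have high: "snd w5 11 (?N * Suc l + v) = snd w4 9 v" if "v < n" for v
      using t5[of "?N * Suc l + v"] that g4 by simp
    show "?I (Suc l) (exec nextlevel (setv 35 l w))"
      unfolding ex
    proof (intro conjI allI impI)
      fix r v assume r: "r \<le> Suc l" and v: "v < n"
      show "snd w5 11 (?N * r + v) \<noteq> 0 \<longleftrightarrow> v \<in> level S T r"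
      proof (cases "r = Suc l")
        case True
        show ?thesis unfolding True high[OF v] using R4 v by (simp only: rep_def)
      next
        case False
        then have "r \<le> l" using r by simp
        then show ?thesis using low[OF _ v] I v by simp
      qed
    qed (use b5 f5 I in \<open>simp_all add: rep_def\<close>)
  qed
  have e: "exec levels s = iter (\<lambda>i w. exec nextlevel (setv 35 i w)) ?N s0"
    using b0 by (simp only: levels_def exec.simps(3,4) ev.simps s0_def[symmetric] base_def good_def)
  show ?thesis unfolding e using main by blast
qed

lemma lexf_correct:
  assumes g: "good s" and B: "rep s 14 B"
    and r: "\<And>i. i < c \<Longrightarrow> snd s 15 i = pick D (snd s 12 (3 + i) - 1)" and j: "j < c"
  shows "snd (exec (lexf c) s) 13 j = lexfirst (matches (snd s 12) D B) c j"
proof -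
  let ?P = "matches (snd s 12) D B"
  let ?d = "Pt 13 (V 36) (leastE 37 38 (V 1) (lexE c))"
  let ?I = "\<lambda>i (w :: st). good w \<and> rep w 14 B \<and> snd w 15 = snd s 15 \<and> snd w 12 = snd s 12 \<and>
    (\<forall>j<i. snd w 13 j = lexfirst ?P i j)"
  have main: "?I c (iter (\<lambda>i w. exec ?d (setv 36 i w)) c s)"
  proof (rule iter_inv[of ?I])
    fix i w assume i: "i < c" and I: "?I i w"
    let ?Q = "\<lambda>v. \<exists>q. ?P q \<and> (\<forall>j<i. q j = lexfirst ?P i j) \<and> q i = v"
    have gw: "fst w 1 = n" using I by (simp add: good_def)
    have "ev (leastE 37 38 (V 1) (lexE c)) (setv 36 i w) = lst (fst (setv 36 i w) 1) ?Q"
    proof (rule ev_leastE)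
      fix v b
      let ?u = "setv 37 v (setv 38 b (setv 36 i w))"
      have gu: "good ?u" using I by simp
      have m: "ev (matchE c (\<lambda>q. Ar 14 (V q))) (setq c q ?u) \<noteq> 0 \<longleftrightarrow> ?P q" if "\<forall>i<c. q i < n" for q
        using ev_matchE[OF gu, of q D "\<lambda>q. Ar 14 (V q)" B] that I r by (simp add: rep_def)
      \<comment> \<open>Positions before \<open>i\<close> are pinned to the entries found so far,
        position \<open>i\<close> to the candidate \<open>v\<close>, later ones are open.\<close>
      have l: "(\<forall>j<c. (j < i \<and> q j = snd w 13 j) \<or> (j = i \<and> q j = v) \<or> i < j) \<longleftrightarrow>
          (\<forall>j<i. q j = lexfirst ?P i j) \<and> q i = v" for q
      proof
        assume a: "\<forall>j<c. (j < i \<and> q j = snd w 13 j) \<or> (j = i \<and> q j = v) \<or> i < j"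
        have "q j = lexfirst ?P i j" if "j < i" for j
        proof -
          have "j < c" using that i by simp
          with a that have "q j = snd w 13 j" by auto
          then show ?thesis using I that by simp
        qed
        moreover have "q i = v" using a i by auto
        ultimately show "(\<forall>j<i. q j = lexfirst ?P i j) \<and> q i = v" by blast
      next
        assume a: "(\<forall>j<i. q j = lexfirst ?P i j) \<and> q i = v"
        have "(j < i \<and> q j = snd w 13 j) \<or> (j = i \<and> q j = v) \<or> i < j" for j
          using a I by (cases j i rule: linorder_cases) auto
        then show "\<forall>j<c. (j < i \<and> q j = snd w 13 j) \<or> (j = i \<and> q j = v) \<or> i < j" by blast
      qed
      have "ev (lexE c) ?u \<noteq> 0 \<longleftrightarrow> (\<exists>q. (\<forall>i<c. q i < n) \<and> ?P q \<and>
          (\<forall>j<c. (j < i \<and> q j = snd w 13 j) \<or> (j = i \<and> q j = v) \<or> i < j))"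
      proof -
        have "fst ?u 1 = n" using gw by simp
        moreover have "ev (andE (matchE c (\<lambda>q. Ar 14 (V q)))
          (andL [orE (andE (ltE (K j) (V 36)) (eqE (V (60 + j)) (Ar 13 (K j))))
            (orE (andE (eqE (K j) (V 36)) (eqE (V (60 + j)) (V 37))) (ltE (V 36) (K j))). j \<leftarrow> [0..<c]]))
          (setq c q ?u) \<noteq> 0 \<longleftrightarrow>
          ?P q \<and> (\<forall>j<c. (j < i \<and> q j = snd w 13 j) \<or> (j = i \<and> q j = v) \<or> i < j)"
          if "\<forall>i<c. q i < n" for q
          using m[OF that] by (simp add: atLeast0LessThan Ball_def) blast
        ultimately show ?thesis unfolding lexE_def ev_exQ by blast
      qed
      also have "\<dots> \<longleftrightarrow> ?Q v" unfolding l by (auto simp: matches_def)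
      finally show "ev (lexE c) ?u \<noteq> 0 \<longleftrightarrow> ?Q v" .
    qed auto
    then have ex: "exec ?d (setv 36 i w) = seta 13 i (lst n ?Q) (setv 36 i w)" using gw by simp
    show "?I (Suc i) (exec ?d (setv 36 i w))"
      unfolding ex using I by (auto simp: good_def rep_def less_Suc_eq)
  qed (use g B in auto)
  have e: "exec (lexf c) s = iter (\<lambda>i w. exec ?d (setv 36 i w)) c s"
    by (simp only: lexf_def exec.simps(4) ev.simps)
  show ?thesis unfolding e using main j by blast
qed

end

section \<open>Assembling a step and encoding sequences of guesses\<close>

lemma lst_le: "lst m P \<le> m"
proof (cases "\<exists>v<m. P v")
  case True
  then obtain v where "v < m" "P v" by blast
  then show ?thesis using lst_found(2)[of v m P] by simp
qed (auto simp: lst_def)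

text \<open>\<open>y\<close> encodes \<open>m\<close> digits and any \<open>x\<close> can be stacked
  above them; stacking turns a sequence of guesses into one number.\<close>

lemma digits_exist:
  assumes "\<And>i. g i < b"
  shows "\<exists>y<b ^ m. \<forall>x. (\<forall>i<m. (y + b ^ m * x) div b ^ i mod b = g i) \<and> (y + b ^ m * x) div b ^ m = (x :: nat)"
  using assms
proof (induction m arbitrary: g)
  case (Suc m)
  have b: "0 < b" using Suc.prems[of 0] by simp
  obtain y where y: "y < b ^ m" "\<And>x. (\<forall>i<m. (y + b ^ m * x) div b ^ i mod b = g (Suc i))"
    "\<And>x. (y + b ^ m * x) div b ^ m = x"
    using Suc.IH[of "\<lambda>i. g (Suc i)"] Suc.prems by blast
  let ?y = "g 0 + b * y"
  have e: "?y + b ^ Suc m * x = g 0 + b * (y + b ^ m * x)" for x by (simp add: algebra_simps)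
  have d: "(g 0 + b * z) div b = z" "(g 0 + b * z) mod b = g 0" for z
    using Suc.prems[of 0] b by simp_all
  have "?y < b ^ Suc m"
  proof -
    have "?y < b * Suc y" using Suc.prems[of 0] by simp
    also have "\<dots> \<le> b * b ^ m" using y(1) by (intro mult_le_mono2) simp
    finally show ?thesis by simp
  qed
  moreover have "(?y + b ^ Suc m * x) div b ^ i mod b = g i" if "i < Suc m" for i x
  proof (cases i)
    case 0
    then show ?thesis unfolding e by (simp only: power_0 div_by_1 d)
  next
    case (Suc j)
    then have "j < m" using that by simp
    then show ?thesis unfolding e Suc using y(2)[of x] by (simp only: power_Suc div_mult2_eq d)
  qed
  moreover have "(?y + b ^ Suc m * x) div b ^ Suc m = x" for x
    unfolding e by (simp only: power_Suc div_mult2_eq d y(3))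
  ultimately show ?case by blast
qed simp

text \<open>The first guess sits in the lowest digits, so runs are unfolded from the front.\<close>

lemma iter_front: "iter f (Suc m) s = iter (\<lambda>i. f (Suc i)) m (f 0 s)"
  by (induction m) auto

context branching
begin

lemma prep_correct:
  assumes b: "base s S T" and sp: "sep S T S" and n: "n > 0"
  defines "s' \<equiv> exec (prep c) s" and "D \<equiv> nb (Rmin S T)"
  shows "base s' S T" "snd s' 12 = snd s 12" "rep s' 17 (nb (Rmax S T))" "rep s' 18 (nb S)"
    "\<forall>r\<le>2 * n. \<forall>v<n. snd s' 11 (2 * n * r + v) \<noteq> 0 \<longleftrightarrow> v \<in> level S T r"
    "\<And>i. i < c \<Longrightarrow> snd s' 15 i = pick D (snd s 12 (3 + i) - 1)"
    "\<And>i. i < c \<Longrightarrow> snd s' 13 i = lexfirst (matches (snd s 12) D (Rmin S T)) c i"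
proof -
  let ?B = "Rmin S T" and ?M = "Rmax S T"
  have Bn: "?B \<subseteq> {..<n}" "?M \<subseteq> {..<n}" "S \<subseteq> {..<n}"
    using mincut_Rmin[OF sp] mincut_Rmax[OF sp] sp by (auto simp: mincut_def sep_def)
  define s1 where "s1 = exec (cpy 5 3) s"
  define s2 where "s2 = exec mcut s1"
  define s3 where "s3 = setv 12 (fst s2 11) s2"
  define s4 where "s4 = exec (cpy 14 9) s3"
  define s5 where "s5 = exec (nbs 14 16) s4"
  define s6 where "s6 = exec (roots c) s5"
  define s7 where "s7 = exec rmax s6"
  define s8 where "s8 = exec (nbs 10 17) s7"
  define s9 where "s9 = exec (nbs 3 18) s8"
  define s10 where "s10 = exec levels s9"
  have ex: "s' = exec (lexf c) s10"
    by (simp only: s'_def prep_def exec.simps(1,3) ev.simps s1_def s2_def s3_def s4_def s5_def s6_def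
        s7_def s8_def s9_def s10_def)
  have b1: "base s1 S T" unfolding s1_def by (rule base_frame[OF b]) auto
  have "rep s1 5 S" unfolding s1_def by (rule cpy_correct) (use b in \<open>auto simp: base_def\<close>)
  then have r2: "fst s2 11 = lam S T" "rep s2 9 ?B"
    unfolding s2_def using mcut_correct[of s1 S T] b1 sp n by (auto simp: base_def)
  have b2: "base s2 S T" unfolding s2_def by (rule base_frame[OF b1]) auto
  have b3: "base s3 S T" "rep s3 9 ?B" "fst s3 12 = lam S T" using b2 r2 by (simp_all add: s3_def)
  have b4: "base s4 S T" unfolding s4_def by (rule base_frame[OF b3(1)]) auto
  have r4: "rep s4 14 ?B" unfolding s4_def by (rule cpy_correct) (use b3 in \<open>auto simp: base_def\<close>)
  have b5: "base s5 S T" unfolding s5_def by (rule base_frame[OF b4]) auto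
  have r5: "rep s5 16 D" unfolding s5_def D_def
    by (rule nbs_correct) (use b4 r4 Bn in \<open>auto simp: base_def\<close>)
  have r5': "rep s5 14 ?B" unfolding s5_def by (rule rep_frame[OF r4]) simp
  have g5: "snd s5 12 = snd s 12" by (simp add: s5_def s4_def s3_def s2_def s1_def exec_frame)
  have b6: "base s6 S T" unfolding s6_def by (rule base_frame[OF b5]) auto
  have r6: "snd s6 15 i = pick D (snd s 12 (3 + i) - 1)" if "i < c" for i
    unfolding s6_def using roots_correct[of s5 D i] b5 r5 that g5 by (simp add: base_def)
  have l6: "fst s6 12 = lam S T" using b3(3) by (simp add: s6_def s5_def s4_def exec_frame)
  have r6': "rep s6 14 ?B" unfolding s6_def by (rule rep_frame[OF r5']) simp
  have b7: "base s7 S T" unfolding s7_def by (rule base_frame[OF b6]) auto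
  have r7: "rep s7 10 ?M" unfolding s7_def by (rule rmax_correct[OF b6 sp n l6])
  have r7': "rep s7 14 ?B" unfolding s7_def by (rule rep_frame[OF r6']) simp
  have b8: "base s8 S T" unfolding s8_def by (rule base_frame[OF b7]) auto
  have r8: "rep s8 17 (nb ?M)" unfolding s8_def
    by (rule nbs_correct) (use b7 r7 Bn in \<open>auto simp: base_def\<close>)
  have r8': "rep s8 14 ?B" unfolding s8_def by (rule rep_frame[OF r7']) simp
  have b9: "base s9 S T" unfolding s9_def by (rule base_frame[OF b8]) auto
  have r9: "rep s9 18 (nb S)" unfolding s9_def
    by (rule nbs_correct) (use b8 Bn in \<open>auto simp: base_def\<close>)
  have r9': "rep s9 14 ?B" "rep s9 17 (nb ?M)" unfolding s9_def by (rule rep_frame; simp add: r8 r8')+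
  have b10: "base s10 S T" unfolding s10_def by (rule base_frame[OF b9]) auto
  have h10: "\<forall>r\<le>2 * n. \<forall>v<n. snd s10 11 (2 * n * r + v) \<noteq> 0 \<longleftrightarrow> v \<in> level S T r"
    unfolding s10_def by (rule levels_correct[OF b9 sp n r9'])
  have r10: "rep s10 14 ?B" "rep s10 17 (nb ?M)" "rep s10 18 (nb S)"
    unfolding s10_def by (rule rep_frame; simp add: r9 r9')+
  have g10: "snd s10 12 = snd s 12" using g5 by (simp add: s10_def s9_def s8_def s7_def s6_def exec_frame)
  have p10: "snd s10 15 i = pick D (snd s10 12 (3 + i) - 1)" if "i < c" for i
    unfolding g10 using r6[OF that] by (simp add: s10_def s9_def s8_def s7_def exec_frame)
  show "base s' S T" unfolding ex by (rule base_frame[OF b10]) auto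
  show "snd s' 12 = snd s 12" unfolding ex using g10 by (simp add: exec_frame)
  show "rep s' 17 (nb ?M)" "rep s' 18 (nb S)" unfolding ex by (rule rep_frame; simp add: r10)+
  show "\<forall>r\<le>2 * n. \<forall>v<n. snd s' 11 (2 * n * r + v) \<noteq> 0 \<longleftrightarrow> v \<in> level S T r"
    unfolding ex using h10 by (simp add: exec_frame)
  show "snd s' 15 i = pick D (snd s 12 (3 + i) - 1)" if "i < c" for i
    unfolding ex using p10[OF that] g10 by (simp add: exec_frame)
  show "snd s' 13 i = lexfirst (matches (snd s 12) D ?B) c i" if "i < c" for i
    unfolding ex g10[symmetric] by (rule lexf_correct) (use b10 r10 p10 that in \<open>auto simp: base_def\<close>)
qed

lemma ops_correct:
  assumes b: "base s S T" and M: "rep s 17 (nb (Rmax S T))" and NS: "rep s 18 (nb S)"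
    and H: "\<forall>r\<le>2 * n. \<forall>v<n. snd s 11 (2 * n * r + v) \<noteq> 0 \<longleftrightarrow> v \<in> level S T r"
    and r: "\<And>i. i < c \<Longrightarrow> snd s 15 i = pick (nb (Rmin S T)) (snd s 12 (3 + i) - 1)"
    and F: "\<And>i. i < c \<Longrightarrow> snd s 13 i = lexfirst (matches (snd s 12) (nb (Rmin S T)) (Rmin S T)) c i"
  shows "base (exec (ops c) s) (fst (step (snd s 12) (S, T))) (snd (step (snd s 12) (S, T)))"
proof -
  define g where "g = snd s 12"
  define o0 where "o0 = Pt 4 (Ar 13 (Ar 12 (K 1))) (K 1)"
  define o1 where "o1 = Pt 3 (pickE 17 (Ar 12 (K 1))) (K 1)"
  define o2 where "o2 = Sq (As 15 (Mi (leastE 39 40 (V 2) (levE c)) (Ar 12 (K 2))))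
        (Fo 30 (V 1) (Pt 3 (V 30) (Ar 11 (Pl (mulE 2 (V 15)) (V 30)))))"
  define o3 where "o3 = Pt 4 (pickE 18 (Ar 12 (K 1))) (K 1)"
  define o4 where "o4 = Sq (Fo 30 (V 1)
          (Pt 19 (V 30) (andE (orE (Ar 3 (V 30)) (Ar 18 (V 30))) (notE (Ar 17 (V 30)))))) (cpy 3 19)"
  have fr: "snd (exec d u) 12 = snd u 12" if "d \<in> {o0, o1, o2, o3, o4}" for d u
    using that by (intro exec_frame) (auto simp: o0_def o1_def o2_def o3_def o4_def)
  let ?s = "setv 8 0 s"
  have ex: "exec (ops c) s = (if g 0 = 0 \<and> g 1 < c then exec o0 ?s else if g 0 = 1 then exec o1 ?s
      else if g 0 = 2 then exec o2 ?s else if g 0 = 3 then exec o3 ?s else if g 0 = 4 then exec o4 ?s else s)"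
    unfolding ops_def o0_def[symmetric] o1_def[symmetric] o2_def[symmetric] o3_def[symmetric] o4_def[symmetric]
    by (simp add: fr g_def)
  have bs: "base ?s S T" using b by simp
  have n1: "fst s 1 = n" "fst s 2 = 2 * n" using b by (simp_all add: base_def good_def)
  have pk: "ev (pickE k (Ar 12 (K 1))) ?s = pick A (g 1)" if "rep s k A" for k A
    by (rule ev_pickE) (use n1 that in \<open>auto simp: g_def\<close>)
  have e0: "exec o0 ?s = seta 4 (snd s 13 (g 1)) 1 ?s" by (simp add: o0_def g_def)
  have e1: "exec o1 ?s = seta 3 (pick (nb (Rmax S T)) (g 1)) 1 ?s" by (simp only: o1_def exec.simps pk[OF M] ev.simps)
  have e3: "exec o3 ?s = seta 4 (pick (nb S) (g 1)) 1 ?s" by (simp only: o3_def exec.simps pk[OF NS] ev.simps)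
  have ins3: "base (seta 3 x 1 ?s) (insert x S) T" and ins4: "base (seta 4 x 1 ?s) S (insert x T)" for x
    using b by (auto simp: base_def good_def rep_def)
  let ?P = "\<lambda>l. \<exists>q. matches g (nb (Rmin S T)) (level S T l) q"
  have lv: "ev (leastE 39 40 (V 2) (levE c)) ?s = lst (fst ?s 2) ?P"
  proof (rule ev_leastE)
    fix l j assume l: "l < fst ?s 2"
    let ?u = "setv 39 l (setv 40 j ?s)"
    have gu: "good ?u" using b by (simp add: base_def)
    have fu: "fst ?u 1 = n" using n1 by simp
    have "ev (matchE c (\<lambda>q. Ar 11 (Pl (mulE 2 (V 39)) (V q)))) (setq c q ?u) \<noteq> 0
        \<longleftrightarrow> matches g (nb (Rmin S T)) (level S T l) q" if q: "\<forall>i<c. q i < n" for q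
    proof -
      have "ev (Ar 11 (Pl (mulE 2 (V 39)) (V (60 + i)))) (setq c q ?u) \<noteq> 0 \<longleftrightarrow> q i \<in> level S T l"
        if "i < c" for i using H l n1 q that by simp
      then show ?thesis
        using ev_matchE[OF gu, of q "nb (Rmin S T)" "\<lambda>q. Ar 11 (Pl (mulE 2 (V 39)) (V q))"] q r
        by (simp add: g_def)
    qed
    then have "ev (levE c) ?u \<noteq> 0 \<longleftrightarrow> (\<exists>q. (\<forall>i<c. q i < n) \<and> matches g (nb (Rmin S T)) (level S T l) q)"
      unfolding levE_def ev_exQ fu by blast
    also have "\<dots> \<longleftrightarrow> ?P l" by (auto simp: matches_def)
    finally show "ev (levE c) ?u \<noteq> 0 \<longleftrightarrow> ?P l" .
  qed auto
  define L where "L = lst (2 * n) ?P - g 2"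
  \<comment> \<open>The search returns at most \<open>2 * n\<close> and the offset only lowers it,
    so row \<open>L\<close> has been computed.\<close>
  have L: "L \<le> 2 * n" using lst_le[of "2 * n" ?P] by (simp add: L_def)
  define u where "u = setv 15 L ?s"
  have e2: "exec o2 ?s = exec (Fo 30 (V 1) (Pt 3 (V 30) (Ar 11 (Pl (mulE 2 (V 15)) (V 30))))) u"
    unfolding o2_def using lv n1 by (simp add: u_def L_def g_def)
  have "snd (exec o2 ?s) 3 v = snd s 11 (2 * n * L + v)" if "v < n" for v
    unfolding e2 by (rule exec_tab0) (use n1 that in \<open>auto simp: u_def\<close>)
  then have r2: "rep (exec o2 ?s) 3 (level S T L)" using H L by (simp add: rep_def)
  have b2: "base (exec o2 ?s) (level S T L) T"
    using r2 b good_frame[of ?s o2] rep_frame[of ?s 4 T o2] by (simp add: base_def o2_def)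
  define w where "w = exec (Fo 30 (V 1)
          (Pt 19 (V 30) (andE (orE (Ar 3 (V 30)) (Ar 18 (V 30))) (notE (Ar 17 (V 30)))))) ?s"
  have "snd w 19 v = of_bool ((snd s 3 v \<noteq> 0 \<or> snd s 18 v \<noteq> 0) \<and> snd s 17 v = 0)" if "v < n" for v
    unfolding w_def by (rule exec_tab0) (use n1 that in auto)
  then have rw: "rep w 19 (lnext (Rmax S T) S)"
    using b M NS by (auto simp: rep_def base_def lnext_def)
  have bw: "base w S T" unfolding w_def by (rule base_frame[OF bs]) auto
  have e4: "exec o4 ?s = exec (cpy 3 19) w" by (simp add: o4_def w_def)
  have b4: "base (exec o4 ?s) (lnext (Rmax S T) S) T"
    unfolding e4 using bw cpy_correct[OF _ rw, of 3] good_frame[of w "cpy 3 19"] rep_frame[of w 4 T "cpy 3 19"]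
    by (simp add: base_def)
  have st: "step g (S, T) = (if g 0 = 0 \<and> g 1 < c then (S, insert (snd s 13 (g 1)) T)
     else if g 0 = 1 then (insert (pick (nb (Rmax S T)) (g 1)) S, T)
     else if g 0 = 2 then (level S T L, T)
     else if g 0 = 3 then (S, insert (pick (nb S) (g 1)) T)
     else if g 0 = 4 then (lnext (Rmax S T) S, T) else (S, T))"
    using F[of "g 1"] by (simp add: step_def Let_def L_def g_def)
  show ?thesis
    unfolding g_def[symmetric] ex st using ins3 ins4 b2 b4 b e0 e1 e3 by simp
qed

lemma stepc_correct:
  assumes b: "base s S T" and sp: "sep S T S" and n: "n > 0"
    and v: "fst s 7 = Kk" "fst s 5 = Gm" "fst s 9 = X" "X \<le> Kk" "0 < Gm"
    and g: "\<And>i. i < 3 + c + c * c \<Longrightarrow> X div Gm ^ i mod Gm = g i"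
  shows "base (exec (stepc c) s) (fst (step g (S, T))) (snd (step g (S, T)))"
    "fst (exec (stepc c) s) 9 = X div Gm ^ (3 + c + c * c)"
    "fst (exec (stepc c) s) 7 = Kk" "fst (exec (stepc c) s) 5 = Gm"
proof -
  define s1 where "s1 = exec (rdg c) s"
  define s2 where "s2 = exec (prep c) s1"
  have ex: "exec (stepc c) s = exec (ops c) s2" by (simp only: stepc_def exec.simps(3) s1_def s2_def)
  have b1: "base s1 S T" unfolding s1_def by (rule base_frame[OF b]) auto
  note d = rdg_correct[OF v, folded s1_def]
  note p = prep_correct[OF b1 sp n, folded s2_def]
  have "step (snd s2 12) = step g" by (rule step_cong) (use d(2) g p(2) in simp)
  then show "base (exec (stepc c) s) (fst (step g (S, T))) (snd (step g (S, T)))"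
    unfolding ex using ops_correct[OF p(1,3,4,5)] p(2,6,7) by simp
  show "fst (exec (stepc c) s) 9 = X div Gm ^ (3 + c + c * c)"
    unfolding ex using d(1) by (simp add: exec_frame s2_def prep_def)
  show "fst (exec (stepc c) s) 7 = Kk" "fst (exec (stepc c) s) 5 = Gm"
    using v by (simp_all add: ex s2_def s1_def exec_frame prep_def)
qed

end

text \<open>One number \<open>X\<close> has to serve every state that represents the pair. The
  function \<open>h\<close> absorbs the shift of the loop counter when the first round is split
  off.\<close>

lemma (in target) win_run:
  assumes "win k S T" "n > 0"
  shows "\<exists>X < (t + c + 6) ^ ((3 + c + c * c) * k). \<forall>s h. base s S T \<longrightarrow> fst s 7 = Kk \<longrightarrow> fst s 5 = t + c + 6 \<longrightarrow>
    fst s 9 = X \<longrightarrow> (t + c + 6) ^ ((3 + c + c * c) * k) \<le> Kk \<longrightarrow>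
    rep (iter (\<lambda>i w. exec (stepc c) (setv 43 (h i) w)) k s) 3 C"
  using assms(1)
proof (induction k arbitrary: S T)
  case 0
  then show ?case by (auto simp: base_def)
next
  case (Suc k)
  let ?b = "t + c + 6" and ?m = "3 + c + c * c"
  obtain g where g: "\<And>i. g i < ?b" "sep S T S"
    and w: "win k (fst (step g (S, T))) (snd (step g (S, T)))"
    using Suc.prems by (auto simp: win.simps(2))
  obtain y where y: "y < ?b ^ ?m" "\<And>x i. i < ?m \<Longrightarrow> (y + ?b ^ ?m * x) div ?b ^ i mod ?b = g i"
    "\<And>x. (y + ?b ^ ?m * x) div ?b ^ ?m = x"
    using digits_exist[of g ?b ?m] g(1) by blast
  obtain X where X: "X < ?b ^ (?m * k)" and run: "\<And>s h. base s (fst (step g (S, T))) (snd (step g (S, T))) \<Longrightarrow>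
      fst s 7 = Kk \<Longrightarrow> fst s 5 = ?b \<Longrightarrow> fst s 9 = X \<Longrightarrow> ?b ^ (?m * k) \<le> Kk \<Longrightarrow>
      rep (iter (\<lambda>i w. exec (stepc c) (setv 43 (h i) w)) k s) 3 C"
    using Suc.IH[OF w] by blast
  let ?X = "y + ?b ^ ?m * X"
  have XX: "?X < ?b ^ (?m * Suc k)"
  proof -
    have "?X < ?b ^ ?m * Suc X" using y(1) by simp
    also have "\<dots> \<le> ?b ^ ?m * ?b ^ (?m * k)" using X by (intro mult_le_mono2) simp
    finally show ?thesis by (simp only: power_add[symmetric] mult_Suc_right)
  qed
  have "rep (iter (\<lambda>i w. exec (stepc c) (setv 43 (h i) w)) (Suc k) s) 3 C"
    if s: "base s S T" "fst s 7 = Kk" "fst s 5 = ?b" "fst s 9 = ?X" "?b ^ (?m * Suc k) \<le> Kk" for s h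
  proof -
    let ?s = "exec (stepc c) (setv 43 (h 0) s)"
    have le: "?X \<le> Kk" using XX s(5) by simp
    have k: "?b ^ (?m * k) \<le> Kk"
      by (rule order.trans[OF _ s(5)]) (intro power_increasing, auto)
    have st: "base ?s (fst (step g (S, T))) (snd (step g (S, T)))"
      "fst ?s 9 = X" "fst ?s 7 = Kk" "fst ?s 5 = ?b"
      using stepc_correct[of "setv 43 (h 0) s" S T Kk ?b ?X g] s g(2) assms(2) le y(2,3) by simp_all
    show ?thesis unfolding iter_front by (rule run[OF st(1,3,4,2) k])
  qed
  with XX show ?case by blast
qed

section \<open>The complete search\<close>

text \<open>Every candidate is verified, so wrong guesses are harmless. Connectivity reuses
  \<open>bfs\<close> on a matrix of order \<open>2 * n\<close> whose second half is empty.\<close>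

definition checkc :: "nat \<Rightarrow> (nat \<Rightarrow> nat \<Rightarrow> nat) list \<Rightarrow> cmd" where
  "checkc c Phi = Sq (Fo 23 (V 2) (Fo 24 (V 2) (Pt 6 (Pl (mulE 2 (V 23)) (V 24))
       (andL [ltE (V 23) (V 1), ltE (V 24) (V 1), Ar 3 (V 23), Ar 3 (V 24), adjE 23 24]))))
    (Sq (Fo 23 (V 2) (Pt 8 (V 23) (eqE (V 23) (V 42))))
    (Sq bfs
    (As 0 (orE (V 0) (andL [Ar 3 (V 42),
       notE (exE 44 (V 1) (andE (Ar 3 (V 44)) (notE (Ar 7 (V 44))))),
       leE (Su 44 (V 1) (nbE 3 44 45)) (V 3),
       leE (V 4) (Su 44 (V 1) (Su 8 (nz (Ar 3 (V 44))) (Ar 1 (V 44)))),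
       notE (exQ c (andE (andL [Ar 3 (V (60 + i)). i \<leftarrow> [0..<c]])
         (orL [typeE c (\<lambda>i j. K (\<phi> i j)). \<phi> \<leftarrow> Phi])))])))))"

definition tryc :: "nat \<Rightarrow> (nat \<Rightarrow> nat \<Rightarrow> nat) list \<Rightarrow> cmd" where
  "tryc c Phi = Sq (As 9 (V 41)) (Sq (Fo 30 (V 1) (Pt 3 (V 30) (eqE (V 30) (V 42))))
    (Sq (Fo 30 (V 1) (Pt 4 (V 30) (K 0))) (Sq (Fo 43 (V 6) (stepc c)) (checkc c Phi))))"

definition mainc :: "nat \<Rightarrow> (nat \<Rightarrow> nat \<Rightarrow> nat) list \<Rightarrow> cmd" where
  "mainc c Phi = Sq (As 0 (K 0)) (Fo 41 (V 7) (Fo 42 (V 1) (tryc c Phi)))"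

lemma stepc_frame:
  "x \<in> wv (stepc c) \<Longrightarrow> 8 \<le> x \<and> x < 41" "k \<in> wa (stepc c) \<Longrightarrow> 3 \<le> k"
  by (auto simp: stepc_def prep_def)

lemma checkc_frame: "wv (checkc c Phi) = {0, 8, 20, 21, 22, 23, 24}" "wa (checkc c Phi) = {6, 7, 8}"
  by (auto simp: checkc_def bfs_frame)

lemma tryc_frame:
  "x \<in> wv (tryc c Phi) \<Longrightarrow> x = 0 \<or> 8 \<le> x \<and> x < 41 \<or> x = 43" "k \<in> wa (tryc c Phi) \<Longrightarrow> 3 \<le> k"
  using stepc_frame[of x c] stepc_frame[of _ c] by (auto simp: tryc_def checkc_frame)

section \<open>Correctness of the search\<close>

context branching
begin

definition env :: "(nat \<Rightarrow> nat) \<Rightarrow> nat \<Rightarrow> nat \<Rightarrow> nat \<Rightarrow> st \<Rightarrow> bool" where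
  "env \<omega> t w Kk s \<longleftrightarrow> good s \<and> (\<forall>v<n. snd s 1 v = \<omega> v) \<and> fst s 3 = t \<and> fst s 4 = w \<and>
     fst s 5 = t + c + 6 \<and> fst s 6 = 6 * t + 1 \<and> fst s 7 = Kk"

lemma env_frame:
  assumes "env \<omega> t w Kk s" "\<And>x. x \<in> {1..7} \<Longrightarrow> x \<notin> wv d" "1 \<notin> wa d" "2 \<notin> wa d"
  shows "env \<omega> t w Kk (exec d s)"
  using assms by (simp add: env_def good_frame exec_frame)

lemma env_setv: "env \<omega> t w Kk s \<Longrightarrow> x \<notin> {1..7} \<Longrightarrow> env \<omega> t w Kk (setv x i s)"
  by (auto simp: env_def)

definition issol :: "(nat \<Rightarrow> nat) \<Rightarrow> nat \<Rightarrow> nat \<Rightarrow> nat set \<Rightarrow> bool" where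
  "issol \<omega> t w C \<longleftrightarrow> C \<subseteq> {..<n} \<and> conn C \<and> card (nb C) \<le> t \<and> free C \<and> w \<le> sum \<omega> C"

lemma checkc_correct:
  assumes e: "env \<omega> t w Kk s" and v0: "fst s 42 = v0" "v0 < n" and R: "rep s 3 S" and Sn: "S \<subseteq> {..<n}"
  shows "fst (exec (checkc c Phi) s) 0 = of_bool (fst s 0 \<noteq> 0 \<or> v0 \<in> S \<and> issol \<omega> t w S)"
proof -
  let ?N = "2 * n"
  have g: "good s" "fst s 1 = n" "fst s 2 = ?N" "fst s 3 = t" "fst s 4 = w" "\<And>v. v < n \<Longrightarrow> snd s 1 v = \<omega> v"
    using e by (simp_all add: env_def good_def)
  define s1 where "s1 = exec (Fo 23 (V 2) (Fo 24 (V 2) (Pt 6 (Pl (mulE 2 (V 23)) (V 24))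
       (andL [ltE (V 23) (V 1), ltE (V 24) (V 1), Ar 3 (V 23), Ar 3 (V 24), adjE 23 24])))) s"
  define s2 where "s2 = exec (Fo 23 (V 2) (Pt 8 (V 23) (eqE (V 23) (V 42)))) s1"
  define s3 where "s3 = exec bfs s2"
  have E: "snd s1 6 (?N * x + y) = of_bool (x < n \<and> y < n \<and> x \<in> S \<and> y \<in> S \<and> adj x y)"
    if "x < ?N" "y < ?N" for x y
    unfolding s1_def
  proof (rule exec_mat)
    fix i j s' assume s': "\<And>z. z \<noteq> 23 \<Longrightarrow> z \<noteq> 24 \<Longrightarrow> z \<noteq> 8 \<Longrightarrow> fst s' z = fst s z" "fst s' 23 = i" "fst s' 24 = j"
      "\<And>l. l \<noteq> 6 \<Longrightarrow> snd s' l = snd s l"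
    have g': "good s'" using g(1) s' by (simp add: good_def)
    have "ev (adjE 23 24) s' \<noteq> 0 \<longleftrightarrow> adj i j" if "i < n" "j < n"
      using ev_adjE[OF g', of 23 24] s' that by simp
    then show "ev (andL [ltE (V 23) (V 1), ltE (V 24) (V 1), Ar 3 (V 23), Ar 3 (V 24), adjE 23 24]) s'
        = of_bool (i < n \<and> j < n \<and> i \<in> S \<and> j \<in> S \<and> adj i j)"
      using s' g R by (auto simp: rep_def)
  qed (use g that in auto)
  have f1: "fst s1 1 = n" "fst s1 2 = ?N" "fst s1 42 = v0" using g v0 by (simp_all add: s1_def exec_frame)
  have SR: "snd s2 8 x = of_bool (x = v0)" if "x < ?N" for x
    unfolding s2_def by (rule exec_tab0) (use f1 that in auto)
  have f2: "fst s2 2 = ?N" "snd s2 6 = snd s1 6" using f1 by (simp_all add: s2_def exec_frame)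
  define D where "D = snd s3 7"
  have d: "dist_ok ?N (snd s1 6) (snd s2 8) D"
    using bfs_correct[OF f2(1)] f2(2) by (simp add: s3_def D_def)
  have reach: "D v \<noteq> 0 \<longleftrightarrow> (v0, v) \<in> rtrancl (arcs_in S)" if v: "v < n" and vS: "v0 \<in> S" for v
  proof
    assume "D v \<noteq> 0"
    let ?Y = "{x. (v0, x) \<in> rtrancl (arcs_in S)}"
    have cl: "y \<in> ?Y" if "x \<in> ?Y" "(x, y) \<in> mat ?N (snd s1 6)" for x y
    proof -
      have "(x, y) \<in> arcs_in S" using that(2) E[of x y] by (auto simp: mat_def arcs_in_def)
      then show ?thesis using that(1) by (auto intro: rtrancl_into_rtrancl)
    qed
    then have "{(x, y) \<in> mat ?N (snd s1 6). x \<in> ?Y \<and> y \<notin> ?Y} = {}" by blast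
    then have "dout (mat ?N (snd s1 6)) ?Y = 0" by (simp only: dout_def card.empty)
    moreover have "x \<in> ?Y" if "x < ?N" "snd s2 8 x \<noteq> 0" for x using SR[OF that(1)] that(2) by simp
    ultimately have "v \<in> ?Y" using dist_reach[OF d, of ?Y v] \<open>D v \<noteq> 0\<close> v by auto
    then show "(v0, v) \<in> rtrancl (arcs_in S)" by simp
  next
    assume "(v0, v) \<in> rtrancl (arcs_in S)"
    then show "D v \<noteq> 0"
    proof (induction rule: rtrancl_induct)
      case base
      have "D v0 = 1" using d SR[of v0] v0(2) unfolding dist_ok_def by auto
      then show ?case by simp
    next
      case (step x y)
      then have xy: "x \<in> S" "y \<in> S" "adj x y" "x < ?N" "y < ?N" "x < n" "y < n"
        using Sn by (auto simp: arcs_in_def)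
      then have "snd s1 6 (?N * x + y) \<noteq> 0" using E[of x y] by simp
      with d xy step.IH show ?case unfolding dist_ok_def by blast
    qed
  qed
  have f3: "good s3" "rep s3 3 S" "fst s3 42 = v0" "fst s3 0 = fst s 0" "fst s3 1 = n" "fst s3 3 = t" "fst s3 4 = w"
    "snd s3 1 = snd s 1" "snd s3 7 = D" "snd s3 3 = snd s 3"
    using g v0 R by (simp_all add: s3_def s2_def s1_def exec_frame bfs_frame good_frame rep_frame D_def)
  have c1: "(\<exists>v<n. snd s 3 v \<noteq> 0 \<and> D v = 0) \<longleftrightarrow> \<not> conn S" if "v0 \<in> S"
  proof -
    have "(\<exists>v<n. snd s 3 v \<noteq> 0 \<and> D v = 0) \<longleftrightarrow> \<not> (\<forall>v\<in>S. (v0, v) \<in> rtrancl (arcs_in S))"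
    proof -
      have "(\<exists>v<n. snd s 3 v \<noteq> 0 \<and> D v = 0) \<longleftrightarrow> (\<exists>v<n. v \<in> S \<and> (v0, v) \<notin> rtrancl (arcs_in S))"
        using reach[OF _ that] R unfolding rep_def by blast
      also have "\<dots> \<longleftrightarrow> (\<exists>v\<in>S. (v0, v) \<notin> rtrancl (arcs_in S))" using Sn by blast
      finally show ?thesis by blast
    qed
    also have "(\<forall>v\<in>S. (v0, v) \<in> rtrancl (arcs_in S)) \<longleftrightarrow> conn S"
      using connI[OF that] that by (auto simp: conn_def)
    finally show ?thesis .
  qed
  have c2: "ev (Su 44 (V 1) (nbE 3 44 45)) s3 = card (nb S)"
  proof -
    have "ev (nbE 3 44 45) (setv 44 i s3) = of_bool (i \<in> nb S)" if "i < n" for i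
      using ev_nbE[of "setv 44 i s3" 3 S 44 45] f3 Sn that by simp
    then have "ev (Su 44 (V 1) (nbE 3 44 45)) s3 = (\<Sum>i<n. of_bool (i \<in> nb S))" using f3 by simp
    also have "\<dots> = card {i. i < n \<and> i \<in> nb S}" by (rule sum_of_bool)
    also have "{i. i < n \<and> i \<in> nb S} = nb S" by (auto simp: nb_def)
    finally show ?thesis .
  qed
  have c3: "ev (Su 44 (V 1) (Su 8 (nz (Ar 3 (V 44))) (Ar 1 (V 44)))) s3 = sum \<omega> S"
  proof -
    have "ev (Su 8 (nz (Ar 3 (V 44))) (Ar 1 (V 44))) (setv 44 i s3) = (if i \<in> S then \<omega> i else 0)"
      if "i < n" for i using f3 g(6)[OF that] R that by (simp add: rep_def)
    then have "ev (Su 44 (V 1) (Su 8 (nz (Ar 3 (V 44))) (Ar 1 (V 44)))) s3 = (\<Sum>i<n. if i \<in> S then \<omega> i else 0)"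
      using f3 by simp
    also have "\<dots> = sum \<omega> ({..<n} \<inter> S)" by (simp add: sum.inter_restrict)
    also have "{..<n} \<inter> S = S" using Sn by auto
    finally show ?thesis .
  qed
  let ?b = "andE (andL [Ar 3 (V (60 + i)). i \<leftarrow> [0..<c]]) (orL [typeE c (\<lambda>i j. K (\<phi> i j)). \<phi> \<leftarrow> Phi])"
  have c4: "ev (exQ c ?b) s3 \<noteq> 0 \<longleftrightarrow> \<not> free S"
  proof -
    have "ev ?b (setq c q s3) \<noteq> 0 \<longleftrightarrow> (\<forall>i<c. q i \<in> S) \<and> (\<exists>\<phi>\<in>set Phi. has_type q \<phi>)" if q: "\<forall>i<c. q i < n" for q
    proof -
      have "ev (typeE c (\<lambda>i j. K (\<phi> i j))) (setq c q s3) \<noteq> 0 \<longleftrightarrow> has_type q \<phi>" for \<phi>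
        by (rule ev_typeE[OF f3(1)]) (use q in auto)
      moreover have "(\<forall>i<c. snd s 3 (q i) \<noteq> 0) \<longleftrightarrow> (\<forall>i<c. q i \<in> S)" using R q by (auto simp: rep_def)
      ultimately show ?thesis using f3 by (simp add: atLeast0LessThan Ball_def Bex_def)
    qed
    then have "ev (exQ c ?b) s3 \<noteq> 0 \<longleftrightarrow>
        (\<exists>q. (\<forall>i<c. q i < n) \<and> (\<forall>i<c. q i \<in> S) \<and> (\<exists>\<phi>\<in>set Phi. has_type q \<phi>))"
      unfolding ev_exQ f3(5) by blast
    also have "\<dots> \<longleftrightarrow> \<not> free S" unfolding free_def using Sn by blast
    finally show ?thesis .
  qed
  have ex: "exec (checkc c Phi) s = exec (As 0 (orE (V 0) (andL [Ar 3 (V 42),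
       notE (exE 44 (V 1) (andE (Ar 3 (V 44)) (notE (Ar 7 (V 44))))),
       leE (Su 44 (V 1) (nbE 3 44 45)) (V 3),
       leE (V 4) (Su 44 (V 1) (Su 8 (nz (Ar 3 (V 44))) (Ar 1 (V 44)))), notE (exQ c ?b)]))) s3"
    by (simp only: checkc_def exec.simps(3) s1_def s2_def s3_def)
  have c0: "snd s 3 v0 \<noteq> 0 \<longleftrightarrow> v0 \<in> S" using R v0 by (simp add: rep_def)
  have "fst (exec (checkc c Phi) s) 0 = of_bool (fst s 0 \<noteq> 0 \<or> (v0 \<in> S \<and>
      \<not> (\<exists>v<n. snd s 3 v \<noteq> 0 \<and> D v = 0) \<and> card (nb S) \<le> t \<and> w \<le> sum \<omega> S \<and> free S))"
    unfolding ex using f3 c0 c4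
    by (simp del: ev.simps(6) add: c2[unfolded One_nat_def] c3[unfolded One_nat_def])
  also have "\<dots> = of_bool (fst s 0 \<noteq> 0 \<or> v0 \<in> S \<and> issol \<omega> t w S)"
    using c1 Sn by (auto simp: issol_def)
  finally show ?thesis .
qed

lemma tryc_start:
  assumes e: "env \<omega> t w Kk s" and v0: "fst s 42 = v0" "v0 < n"
  obtains u where "exec (tryc c Phi) s = exec (checkc c Phi) (iter (\<lambda>i w. exec (stepc c) (setv 43 i w)) (6 * t + 1) u)"
    "env \<omega> t w Kk (iter (\<lambda>i w. exec (stepc c) (setv 43 i w)) (6 * t + 1) u)"
    "fst (iter (\<lambda>i w. exec (stepc c) (setv 43 i w)) (6 * t + 1) u) 42 = v0"
    "fst (iter (\<lambda>i w. exec (stepc c) (setv 43 i w)) (6 * t + 1) u) 0 = fst s 0"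
    "base u {v0} {}" "fst u 7 = Kk" "fst u 5 = t + c + 6" "fst u 9 = fst s 41"
proof -
  define s1 where "s1 = setv 9 (fst s 41) s"
  define s2 where "s2 = exec (Fo 30 (V 1) (Pt 3 (V 30) (eqE (V 30) (V 42)))) s1"
  define u where "u = exec (Fo 30 (V 1) (Pt 4 (V 30) (K 0))) s2"
  have e1: "env \<omega> t w Kk s1" using env_setv[OF e] by (simp add: s1_def)
  have e2: "env \<omega> t w Kk s2" unfolding s2_def by (rule env_frame[OF e1]) auto
  have eu: "env \<omega> t w Kk u" unfolding u_def by (rule env_frame[OF e2]) auto
  have n: "fst s1 1 = n" "fst s1 42 = v0" "fst s2 1 = n" using e1 e2 v0 by (simp_all add: env_def good_def s1_def)
  have "snd s2 3 v = of_bool (v = v0)" if "v < n" for v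
    unfolding s2_def by (rule exec_tab0) (use n that in auto)
  moreover have "snd u 3 = snd s2 3" by (simp add: u_def exec_frame)
  moreover have "snd u 4 v = 0" if "v < n" for v
    unfolding u_def by (rule exec_tab0) (use n that in auto)
  ultimately have bu: "base u {v0} {}" using eu by (simp add: base_def rep_def env_def)
  let ?f = "\<lambda>i w. exec (stepc c) (setv 43 i w)"
  have u: "fst u 42 = v0" "fst u 0 = fst s 0" "fst u 9 = fst s 41"
    using v0 by (simp_all add: u_def s2_def s1_def exec_frame)
  have it: "env \<omega> t w Kk (iter ?f k u) \<and> fst (iter ?f k u) 42 = v0 \<and> fst (iter ?f k u) 0 = fst s 0" for k
  proof (rule iter_inv[of "\<lambda>_ x. env \<omega> t w Kk x \<and> fst x 42 = v0 \<and> fst x 0 = fst s 0"])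
    fix i x assume x: "env \<omega> t w Kk x \<and> fst x 42 = v0 \<and> fst x 0 = fst s 0"
    then have "env \<omega> t w Kk (setv 43 i x)" using env_setv by auto
    then have a: "env \<omega> t w Kk (?f i x)" by (rule env_frame) (use stepc_frame[of _ c] in fastforce)+
    have b: "fst (?f i x) 42 = fst (setv 43 i x) 42"
      by (rule exec_frame(1)) (use stepc_frame(1)[of 42 c] in auto)
    have d: "fst (?f i x) 0 = fst (setv 43 i x) 0"
      by (rule exec_frame(1)) (use stepc_frame(1)[of 0 c] in auto)
    show "env \<omega> t w Kk (?f i x) \<and> fst (?f i x) 42 = v0 \<and> fst (?f i x) 0 = fst s 0"
      unfolding b d using a x by simp
  qed (use eu u in auto)
  have "fst u 6 = 6 * t + 1" using eu by (simp add: env_def)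
  then have "exec (tryc c Phi) s = exec (checkc c Phi) (iter ?f (6 * t + 1) u)"
    by (simp only: tryc_def exec.simps ev.simps s1_def s2_def u_def)
  moreover have "fst u 7 = Kk" "fst u 5 = t + c + 6" using eu by (simp_all add: env_def)
  ultimately show ?thesis using it[of "6 * t + 1"] bu u(3) by (intro that[of u]) blast+
qed

lemma rep_self: "rep s 3 {v. v < n \<and> snd s 3 v \<noteq> 0}"
  by (simp add: rep_def)

text \<open>After a wrong guess array 3 may represent any set of vertices; \<open>rep_self\<close>
  names that set and the check decides.\<close>

lemma tryc_sound:
  assumes e: "env \<omega> t w Kk s" and v0: "fst s 42 < n"
  shows "fst (exec (tryc c Phi) s) 0 \<noteq> 0 \<Longrightarrow> fst s 0 \<noteq> 0 \<or> (\<exists>C. issol \<omega> t w C)"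
    "fst s 0 \<noteq> 0 \<Longrightarrow> fst (exec (tryc c Phi) s) 0 \<noteq> 0" "fst (exec (tryc c Phi) s) 0 \<le> 1"
proof -
  obtain u where u: "exec (tryc c Phi) s = exec (checkc c Phi) u" "env \<omega> t w Kk u" "fst u 42 = fst s 42"
    "fst u 0 = fst s 0" by (rule tryc_start[OF e refl v0])
  have "fst (exec (checkc c Phi) u) 0 = of_bool (fst u 0 \<noteq> 0 \<or>
      fst s 42 \<in> {v. v < n \<and> snd u 3 v \<noteq> 0} \<and> issol \<omega> t w {v. v < n \<and> snd u 3 v \<noteq> 0})"
    by (rule checkc_correct[OF u(2,3) v0 rep_self]) auto
  then show "fst (exec (tryc c Phi) s) 0 \<noteq> 0 \<Longrightarrow> fst s 0 \<noteq> 0 \<or> (\<exists>C. issol \<omega> t w C)"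
    "fst s 0 \<noteq> 0 \<Longrightarrow> fst (exec (tryc c Phi) s) 0 \<noteq> 0" "fst (exec (tryc c Phi) s) 0 \<le> 1"
    unfolding u(1) using u(4) by (auto split: if_splits)
qed

text \<open>A solution of maximum weight is inclusion-maximal: weights are positive, and a larger
  connected, secluded, free set would still reach \<open>w\<close>.\<close>

lemma maximal_solution:
  assumes "issol \<omega> t w C0" and pos: "\<And>v. v < n \<Longrightarrow> \<omega> v > 0"
  obtains C where "issol \<omega> t w C" "target n adj c Phi C t"
proof -
  have fin: "finite {C. issol \<omega> t w C}"
    by (rule finite_subset[of _ "Pow {..<n}"]) (auto simp: issol_def)
  obtain C where C: "issol \<omega> t w C" and m: "\<And>D. issol \<omega> t w D \<Longrightarrow> sum \<omega> D \<le> sum \<omega> C"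
    using ex_has_greatest_nat[of "issol \<omega> t w" C0 "sum \<omega>" "Suc (sum \<omega> {..<n})"] assms(1)
      sum_mono2[of "{..<n}" _ \<omega>] by (auto simp: issol_def less_Suc_eq_le)
  have "\<not> free D" if D: "C \<subset> D" "D \<subseteq> {..<n}" "conn D" "card (nb D) \<le> t" for D
  proof
    assume "free D"
    obtain x where x: "x \<in> D" "x \<notin> C" using D(1) by blast
    have "0 < \<omega> x" using x D(2) by (intro pos) auto
    then have "sum \<omega> C < sum \<omega> D"
      by (rule_tac sum_strict_mono2[of D C x \<omega>]) (use D x finite_subset[OF D(2)] in auto)
    then have "issol \<omega> t w D" using D C \<open>free D\<close> by (simp add: issol_def)
    with m[of D] \<open>sum \<omega> C < sum \<omega> D\<close> show False by simp
  qed
  then have "target n adj c Phi C t"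
    using C branching_axioms by (simp add: target_def target_axioms_def issol_def)
  with C that show ?thesis by blast
qed

theorem mainc_correct:
  assumes e: "env \<omega> t w Kk s" and pos: "\<And>v. v < n \<Longrightarrow> \<omega> v > 0"
    and Kk: "(t + c + 6) ^ ((3 + c + c * c) * (6 * t + 1)) \<le> Kk"
  shows "fst (exec (mainc c Phi) s) 0 = of_bool (\<exists>C. issol \<omega> t w C)"
proof -
  define Sol where "Sol \<longleftrightarrow> (\<exists>C. issol \<omega> t w C)"
  \<comment> \<open>\<open>X\<close> and \<open>v0\<close> are loop indices at which a solution is
    certainly found, whatever happened before; the answer is never reset afterwards.\<close>
  obtain X v0 where Xv: "Sol \<longrightarrow> X < Kk \<and> v0 < n \<and> (\<forall>s. env \<omega> t w Kk s \<longrightarrow> fst s 41 = X \<longrightarrow> fst s 42 = v0 \<longrightarrow>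
      fst (exec (tryc c Phi) s) 0 \<noteq> 0)"
  proof (cases Sol)
    case True
    then obtain C where C: "issol \<omega> t w C" "target n adj c Phi C t" 
      unfolding Sol_def using maximal_solution pos by blast
    interpret target n adj c Phi C t by (rule C(2))
    obtain v0 where v0: "v0 \<in> C" using conn_C by (auto simp: conn_def)
    then have v0n: "v0 < n" using C_subset by auto
    have "inv {v0} {}" using v0 by (simp add: inv_def)
    then have "win (3 * (2 * t) + 1) {v0} {}" by (rule win_all) simp
    then obtain X where X: "X < (t + c + 6) ^ ((3 + c + c * c) * (6 * t + 1))"
      and run: "\<And>s h. base s {v0} {} \<Longrightarrow> fst s 7 = Kk \<Longrightarrow> fst s 5 = t + c + 6 \<Longrightarrow> fst s 9 = X \<Longrightarrow>
        rep (iter (\<lambda>i w. exec (stepc c) (setv 43 (h i) w)) (6 * t + 1) s) 3 C"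
      using win_run[of "6 * t + 1" "{v0}" "{}" Kk] v0n Kk by auto
    have "fst (exec (tryc c Phi) s) 0 \<noteq> 0" if s: "env \<omega> t w Kk s" "fst s 41 = X" "fst s 42 = v0" for s
    proof -
      let ?it = "\<lambda>u. iter (\<lambda>i w. exec (stepc c) (setv 43 i w)) (6 * t + 1) u"
      obtain u where u: "exec (tryc c Phi) s = exec (checkc c Phi) (?it u)" "env \<omega> t w Kk (?it u)"
        "fst (?it u) 42 = v0" "base u {v0} {}" "fst u 7 = Kk" "fst u 5 = t + c + 6" "fst u 9 = X"
        by (rule tryc_start[OF s(1,3) v0n]) (unfold s(2), blast)
      have "rep (?it u) 3 C" using run[OF u(4-7), of "\<lambda>i. i"] by simp
      from checkc_correct[OF u(2,3) v0n this C_subset]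
      show ?thesis unfolding u(1) using v0 C(1) by simp
    qed
    then show ?thesis using X Kk v0n by (intro that[of X v0]) auto
  qed (use that in blast)
  let ?in = "Fo 42 (V 1) (tryc c Phi)"
  define J where "J x \<longleftrightarrow> env \<omega> t w Kk x \<and> fst x 0 \<le> 1 \<and> (fst x 0 \<noteq> 0 \<longrightarrow> Sol)" for x :: st
  have tr: "J (exec (tryc c Phi) x)" "fst (exec (tryc c Phi) x) 41 = fst x 41"
    if "J x" "fst x 42 < n" for x
  proof -
    have "env \<omega> t w Kk (exec (tryc c Phi) x)"
      by (rule env_frame) (use that tryc_frame[of _ c Phi] in \<open>fastforce simp: J_def\<close>)+
    with tryc_sound[of \<omega> t w Kk x] that show "J (exec (tryc c Phi) x)" unfolding J_def Sol_def by blast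
    show "fst (exec (tryc c Phi) x) 41 = fst x 41"
      by (rule exec_frame) (use tryc_frame(1)[of 41 c Phi] in auto)
  qed
  have inner: "J (exec ?in x) \<and> (fst x 0 \<noteq> 0 \<or> (Sol \<and> fst x 41 = X) \<longrightarrow> fst (exec ?in x) 0 \<noteq> 0)" if x: "J x" for x
  proof -
    let ?f = "\<lambda>i y. exec (tryc c Phi) (setv 42 i y)"
    let ?I = "\<lambda>i y. J y \<and> fst y 41 = fst x 41 \<and>
      (fst x 0 \<noteq> 0 \<or> (Sol \<and> fst x 41 = X \<and> v0 < i) \<longrightarrow> fst y 0 \<noteq> 0)"
    have m: "?I n (iter ?f n x)"
    proof (rule iter_inv[of ?I])
      fix i y assume i: "i < n" and I: "?I i y"
      have J: "J (setv 42 i y)" using I env_setv by (auto simp: J_def)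
      have "fst (?f i y) 0 \<noteq> 0" if "fst x 0 \<noteq> 0 \<or> (Sol \<and> fst x 41 = X \<and> v0 < Suc i)"
      proof (cases "fst y 0 \<noteq> 0")
        case True
        then show ?thesis using tryc_sound(2)[of \<omega> t w Kk "setv 42 i y"] J i by (simp add: J_def)
      next
        case False
        then have "Sol" "fst x 41 = X" "v0 = i" using that I by (auto simp: less_Suc_eq)
        moreover have "env \<omega> t w Kk (setv 42 i y)" using J by (simp add: J_def)
        moreover have "fst (setv 42 i y) 41 = fst x 41" "fst (setv 42 i y) 42 = i" using I by simp_all
        ultimately show ?thesis using Xv by blast
      qed
      moreover have "J (?f i y)" by (rule tr(1)[OF J]) (use i in simp)
      moreover have "fst (?f i y) 41 = fst (setv 42 i y) 41" by (rule tr(2)[OF J]) (use i in simp)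
      moreover have "fst (setv 42 i y) 41 = fst x 41" using I by simp
      ultimately show "?I (Suc i) (?f i y)" by metis
    qed (use x in simp)
    have "fst x 1 = n" using x by (simp add: J_def env_def good_def)
    then have ei: "exec ?in x = iter ?f n x" by (simp only: exec.simps ev.simps)
    show ?thesis unfolding ei using m Xv by blast
  qed
  let ?f = "\<lambda>i y. exec ?in (setv 41 i y)"
  let ?I = "\<lambda>i y. J y \<and> (Sol \<and> X < i \<longrightarrow> fst y 0 \<noteq> 0)"
  define s0 where "s0 = setv 0 0 s"
  have m: "?I Kk (iter ?f Kk s0)"
  proof (rule iter_inv[of ?I])
    show "?I 0 s0" using env_setv[OF e, of 0] by (simp add: s0_def J_def)
  next
    fix i y assume I: "?I i y"
    have J: "J (setv 41 i y)" using I env_setv by (auto simp: J_def)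
    have "fst (setv 41 i y) 0 = fst y 0" "fst (setv 41 i y) 41 = i" by simp_all
    then show "?I (Suc i) (?f i y)" using inner[OF J] I unfolding less_Suc_eq by metis
  qed
  have "fst s0 7 = Kk" using e by (simp add: s0_def env_def)
  then have em: "exec (mainc c Phi) s = iter ?f Kk s0"
    by (simp only: mainc_def exec.simps ev.simps s0_def)
  have "fst (exec (mainc c Phi) s) 0 \<noteq> 0 \<longleftrightarrow> Sol" "fst (exec (mainc c Phi) s) 0 \<le> 1"
    unfolding em using m Xv unfolding J_def by blast+
  then show ?thesis unfolding Sol_def[symmetric] by (cases Sol) auto
qed

end

section \<open>Decoding the input\<close>

definition mulK :: "nat \<Rightarrow> ex \<Rightarrow> ex" where "mulK m e = Su 8 (K m) e"

primrec plL :: "ex list \<Rightarrow> ex" where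
  "plL [] = K 0" | "plL (a # as) = Pl a (plL as)"

text \<open>The content of the machine register with number \<open>a\<close>, found by searching through all arrays.\<close>

definition readE :: "nat \<Rightarrow> ex \<Rightarrow> ex" where
  "readE nR a = plL [Su 14 (V 10) (Su 8 (eqE (Pl (K (nR + k)) (mulK 21 (V 14))) a) (Ar k (V 14))). k \<leftarrow> [0..<21]]"

text \<open>From index \<open>V 10\<close> on, array 0 receives a copy of the input in its original
  numbering.\<close>

definition cellE :: "ex \<Rightarrow> ex" where "cellE e = Ar 0 (Pl (V 10) e)"

text \<open>Register 0 arrives as \<open>J * n\<close>, so \<open>n\<close> is recovered by
  counting. Variable 10 exceeds every address that the decoding reads.\<close>

definition initA :: "nat \<Rightarrow> nat \<Rightarrow> cmd" where
  "initA J nR = Sq (As 1 (Su 9 (V 0) (leE (mulK J (Pl (V 9) (K 1))) (V 0)))) (Sq (As 2 (Pl (V 1) (V 1)))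
     (As 10 (Pl (Pl (mulE 0 (V 0)) (mulK nR (V 0))) (K 5))))"

text \<open>Input register \<open>a\<close> was moved to \<open>a * N\<close> if it was low, where
  \<open>N\<close> is the content of register 0, and stayed in place otherwise.\<close>

definition addrE :: "nat \<Rightarrow> ex" where
  "addrE nR = Pl (Su 8 (ltE (V 11) (K nR)) (mulE 0 (V 11))) (Su 8 (leE (K nR) (V 11)) (V 11))"

text \<open>Entries in column \<open>n - 3\<close> are read from their transposes: their own
  registers may be multiples of \<open>N\<close> and overwritten by the relocation.\<close>

definition entryE :: ex where
  "entryE = andE (notE (eqE (V 23) (V 24)))
     (orE (andE (eqE (Pl (V 24) (K 3)) (V 1)) (cellE (Pl (K 3) (Pl (V 1) (Pl (mulE 1 (V 24)) (V 23))))))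
       (andE (notE (eqE (Pl (V 24) (K 3)) (V 1))) (cellE (Pl (K 3) (Pl (V 1) (Pl (mulE 1 (V 23)) (V 24)))))))"

definition initB :: "nat \<Rightarrow> nat \<Rightarrow> cmd" where
  "initB c nR = Sq (Fo 11 (V 10) (Pt 0 (Pl (V 10) (V 11)) (readE nR (addrE nR))))
    (Sq (As 3 (cellE (K 1))) (Sq (As 4 (cellE (K 2))) (Sq (As 5 (Pl (V 3) (K (c + 6))))
    (Sq (As 6 (Pl (mulK 6 (V 3)) (K 1)))
    (Sq (Fo 11 (V 1) (Pt 1 (V 11) (cellE (Pl (K 3) (V 11)))))
    (Fo 23 (V 2) (Fo 24 (V 2) (Pt 2 (Pl (mulE 2 (V 23)) (V 24)) entryE))))))))"

text \<open>Variable 6 already holds \<open>6 * t + 1\<close>, so the loop makes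
  \<open>7 * t + c + c + c * c + 10\<close> doublings, the exponent in
  \<open>guesses\<close>.\<close>

definition initC :: "nat \<Rightarrow> cmd" where
  "initC c = Sq (As 12 (K 1)) (Fo 13 (Pl (V 6) (Pl (V 3) (K (c + c + c * c + 9)))) (As 12 (Pl (V 12) (V 12))))"

definition initD :: cmd where
  "initD = Sq (As 7 (K 1)) (Fo 13 (V 12) (As 7 (Pl (V 7) (V 7))))"

section \<open>Correctness of the decoding\<close>

lemma ev_mulK [simp]: "(\<And>i. ev e (setv 8 i s) = ev e s) \<Longrightarrow> ev (mulK m e) s = m * ev e s"
  by (simp add: mulK_def)

lemma ev_plL [simp]: "ev (plL as) s = sum_list (map (\<lambda>a. ev a s) as)"
  by (induction as) auto

text \<open>An address at or above \<open>nR\<close> is uniquely \<open>nR + k + 21 * i\<close> with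
  \<open>k < 21\<close>, so exactly one summand survives.\<close>

lemma ev_readE:
  assumes a: "\<And>i j. ev a (setv 8 j (setv 14 i s)) = A" "\<And>i. ev a (setv 14 i s) = A"
    and arr: "\<And>k i. k < 21 \<Longrightarrow> i < fst s 10 \<Longrightarrow> snd s k i = M (nR + k + 21 * i)"
    and A: "nR \<le> A" "A < fst s 10"
  shows "ev (readE nR a) s = M A"
proof -
  define i0 where "i0 = (A - nR) div 21"
  define k0 where "k0 = (A - nR) mod 21"
  have A0: "A = nR + k0 + 21 * i0" "k0 < 21" "i0 < fst s 10"
    using A by (auto simp: i0_def k0_def)
  have eq: "nR + k + 21 * i = A \<longleftrightarrow> k = k0 \<and> i = i0" if "k < 21" for k i
  proof
    assume e: "nR + k + 21 * i = A"
    then have "k + 21 * i = k0 + 21 * i0" using A0(1) by simp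
    then have "(k + 21 * i) mod 21 = (k0 + 21 * i0) mod 21" by (rule arg_cong)
    then have "k = k0" using that A0(2) by simp
    with \<open>k + 21 * i = k0 + 21 * i0\<close> show "k = k0 \<and> i = i0" by simp
  qed (use A0 in simp)
  have "ev (Su 14 (V 10) (Su 8 (eqE (Pl (K (nR + k)) (mulK 21 (V 14))) a) (Ar k (V 14)))) s
      = (if k = k0 then M A else 0)" if k: "k < 21" for k
  proof -
    have "ev (Su 8 (eqE (Pl (K (nR + k)) (mulK 21 (V 14))) a) (Ar k (V 14))) (setv 14 i s)
        = (if i = i0 then (if k = k0 then M A else 0) else 0)" if "i < fst s 10" for i
    proof -
      have "ev (eqE (Pl (K (nR + k)) (mulK 21 (V 14))) a) (setv 14 i s) = of_bool (k = k0 \<and> i = i0)"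
        using eq[OF k, of i] by (simp add: a)
      moreover have "ev (Su 8 b (Ar k (V 14))) (setv 14 i s) = ev b (setv 14 i s) * snd s k i" for b by simp
      ultimately have "ev (Su 8 (eqE (Pl (K (nR + k)) (mulK 21 (V 14))) a) (Ar k (V 14))) (setv 14 i s)
        = of_bool (k = k0 \<and> i = i0) * snd s k i" by (simp only:)
      then show ?thesis using arr[OF k that] A0(1) by (simp del: ev.simps(6) ev_macros)
    qed
    then have "ev (Su 14 (V 10) (Su 8 (eqE (Pl (K (nR + k)) (mulK 21 (V 14))) a) (Ar k (V 14)))) s
        = (\<Sum>i<fst s 10. if i = i0 then (if k = k0 then M A else 0) else 0)"
      unfolding ev.simps(6)[of 14] ev.simps(1) by (intro sum.cong) auto
    also have "\<dots> = (if k = k0 then M A else 0)" using A0(3) by simp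
    finally show ?thesis .
  qed
  then have "ev (readE nR a) s = (\<Sum>k\<leftarrow>[0..<21]. if k = k0 then M A else 0)"
    unfolding readE_def ev_plL map_map comp_def by (intro arg_cong[of _ _ sum_list] map_cong refl) (simp del: upt_rec_numeral)
  also have "\<dots> = (\<Sum>k<21. if k = k0 then M A else 0)"
    by (simp add: sum_list_distinct_conv_sum_set atLeast0LessThan del: upt_rec_numeral)
  also have "\<dots> = M A" using A0(2) by simp
  finally show ?thesis .
qed

text \<open>Source and target may share array \<open>k\<close>: the part below \<open>h\<close> is
  never written, so values may be computed from it.\<close>

lemma exec_copy:
  assumes "\<And>i s'. i < ev b s \<Longrightarrow> (\<And>z. z \<noteq> x \<Longrightarrow> fst s' z = fst s z) \<Longrightarrow> fst s' x = i \<Longrightarrow>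
     (\<And>l. l \<noteq> k \<Longrightarrow> snd s' l = snd s l) \<Longrightarrow> (\<And>j. j < h \<Longrightarrow> snd s' k j = snd s k j) \<Longrightarrow>
     P i \<Longrightarrow> ev e s' = g i" and h: "fst s p = h" "p \<noteq> x" and j: "j < ev b s" "P j"
  shows "snd (exec (Fo x b (Pt k (Pl (V p) (V x)) e)) s) k (h + j) = g j"
proof -
  let ?f = "\<lambda>i s. exec (Pt k (Pl (V p) (V x)) e) (setv x i s)"
  let ?I = "\<lambda>m s'. (\<forall>z. z \<noteq> x \<longrightarrow> fst s' z = fst s z) \<and> (\<forall>l. l \<noteq> k \<longrightarrow> snd s' l = snd s l) \<and>
    (\<forall>j<h. snd s' k j = snd s k j) \<and> (\<forall>j<m. P j \<longrightarrow> snd s' k (h + j) = g j)"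
  have "?I (ev b s) (iter ?f (ev b s) s)"
  proof (rule iter_inv[of ?I])
    fix i s' assume i: "i < ev b s" and I: "?I i s'"
    have "ev e (setv x i s') = g i" if "P i"
      using assms(1)[OF i, of "setv x i s'"] I that by auto
    then show "?I (Suc i) (?f i s')" using I h by (auto simp: less_Suc_eq)
  qed auto
  then show ?thesis using j by (simp add: exec.simps(4))
qed

lemma initA_correct:
  assumes "fst s 0 = J * n" "0 < J"
  shows "fst (exec (initA J nR) s) 1 = n" "fst (exec (initA J nR) s) 2 = 2 * n"
    "fst (exec (initA J nR) s) 10 = J * n * (J * n) + nR * (J * n) + 5"
    "snd (exec (initA J nR) s) = snd s" "fst (exec (initA J nR) s) 0 = J * n"
proof -
  have "J * (i + 1) \<le> J * n \<longleftrightarrow> i < n" for i using assms(2) by (simp only: mult_le_cancel1) auto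
  then have "{i. i < J * n \<and> J * (i + 1) \<le> J * n} = {i. i < J * n \<and> i < n}" by simp
  also have "\<dots> = {..<n}" using less_le_trans[of _ n "J * n"] assms(2) by (cases J) auto
  finally have c: "card {i. i < J * n \<and> J * (i + 1) \<le> J * n} = n" by simp
  have "ev (leE (mulK J (Pl (V 9) (K 1))) (V 0)) (setv 9 i s) = of_bool (J * (i + 1) \<le> J * n)" for i
    by (subst ev_macros, subst ev_mulK) (simp_all add: assms(1))
  then have v: "ev (Su 9 (V 0) (leE (mulK J (Pl (V 9) (K 1))) (V 0))) s = n"
    unfolding ev.simps(6) ev.simps(1) assms(1) by (simp only: sum_of_bool c)
  let ?a = "exec (initA J nR) s"
  have e: "?a = setv 10 (J * n * (J * n) + nR * (J * n) + 5) (setv 2 (2 * n) (setv 1 n s))"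
    unfolding initA_def exec.simps(1,3) v by (simp add: assms(1) mult_2)
  show "fst ?a 1 = n" "fst ?a 2 = 2 * n" "fst ?a 10 = J * n * (J * n) + nR * (J * n) + 5"
    "snd ?a = snd s" "fst ?a 0 = J * n" unfolding e using assms(1) by simp_all
qed

lemma initB_correct:
  fixes c :: nat
  assumes s: "fst s 0 = N0" "fst s 1 = n" "fst s 2 = 2 * n" "fst s 10 = N0 * N0 + nR * N0 + 5"
    and arr: "\<forall>k<21. \<forall>i. snd s k i = M (nR + k + 21 * i)" and N0: "nR \<le> N0" "4 \<le> nR" "4 * n \<le> N0"
    and cell: "\<And>a. cell a = M (if a < nR then a * N0 else a)"
  defines "u \<equiv> exec (initB c nR) s"
  shows "fst u 3 = cell 1" "fst u 4 = cell 2" "fst u 5 = cell 1 + c + 6" "fst u 6 = 6 * cell 1 + 1"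
    "v < n \<Longrightarrow> snd u 1 v = cell (3 + v)" "fst u 1 = n" "fst u 2 = 2 * n"
    "x < n \<Longrightarrow> y < n \<Longrightarrow> snd u 2 (2 * n * x + y) \<noteq> 0 \<longleftrightarrow> x \<noteq> y \<and>
      (if y + 3 = n then cell (3 + n + n * y + x) \<noteq> 0 else cell (3 + n + n * x + y) \<noteq> 0)"
proof -
  let ?L = "N0 * N0 + nR * N0 + 5"
  define s1 where "s1 = exec (Fo 11 (V 10) (Pt 0 (Pl (V 10) (V 11)) (readE nR (addrE nR)))) s"
  define s2 where "s2 = setv 6 (6 * cell 1 + 1) (setv 5 (cell 1 + (c + 6)) (setv 4 (cell 2) (setv 3 (cell 1) s1)))"
  define s3 where "s3 = exec (Fo 11 (V 1) (Pt 1 (V 11) (cellE (Pl (K 3) (V 11))))) s2"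
  have copy: "snd s1 0 (?L + a) = cell a" if a: "0 < a" "a < ?L" for a
    unfolding s1_def
  \<comment> \<open>Cell 0 is left out: register 0 is a program variable and lies outside the
    arrays.\<close>
  proof (rule exec_copy[where P = "\<lambda>a. 0 < a"])
    fix i s' assume i: "i < ev (V 10) s" "0 < i" and s': "\<And>z. z \<noteq> 11 \<Longrightarrow> fst s' z = fst s z" "fst s' 11 = i"
      "\<And>l. l \<noteq> 0 \<Longrightarrow> snd s' l = snd s l" "\<And>j. j < ?L \<Longrightarrow> snd s' 0 j = snd s 0 j"
    let ?A = "if i < nR then i * N0 else i"
    have 1: "nR \<le> ?A" using i N0 by (cases i) auto
    have "?A < ?L"
    proof (cases "i < nR")
      case True
      then have "i * N0 \<le> nR * N0" by (intro mult_le_mono1) simp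
      then show ?thesis unfolding if_P[OF True] by linarith
    qed (use i(1) s(4) in simp)
    then have 2: "?A < fst s' 10" using s(4) s'(1)[of 10] by simp
    have "snd s' k j = M (nR + k + 21 * j)" if "k < 21" "j < fst s' 10" for k j
      using s' s that arr by (cases "k = 0") auto
    from ev_readE[of "addrE nR" s' ?A M nR, OF _ _ this 1 2]
    show "ev (readE nR (addrE nR)) s' = cell i" using s' s by (simp add: addrE_def cell mult.commute)
  qed (use a s in simp_all)
  have f1: "fst s1 1 = n" "fst s1 2 = 2 * n" "fst s1 10 = ?L"
    using s by (simp_all add: s1_def exec_frame)
  have e2: "exec (As 6 (Pl (mulK 6 (V 3)) (K 1))) (exec (As 5 (Pl (V 3) (K (c + 6))))
      (exec (As 4 (cellE (K 2))) (exec (As 3 (cellE (K 1))) s1))) = s2"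
    using copy[of 1] copy[of 2] f1 by (simp add: s2_def cellE_def)
  have f2: "fst s2 1 = n" "fst s2 2 = 2 * n" "fst s2 10 = ?L" "snd s2 = snd s1"
    using f1 by (simp_all add: s2_def)
  have f3: "fst s3 1 = n" "fst s3 2 = 2 * n" "fst s3 10 = ?L" "snd s3 0 = snd s1 0" "fst s3 3 = cell 1"
    "fst s3 4 = cell 2" "fst s3 5 = cell 1 + c + 6" "fst s3 6 = 6 * cell 1 + 1"
    using f2 by (simp_all add: s3_def exec_frame s2_def)
  have u: "u = exec (Fo 23 (V 2) (Fo 24 (V 2) (Pt 2 (Pl (mulE 2 (V 23)) (V 24)) entryE))) s3"
    by (simp only: u_def initB_def exec.simps(3) s1_def[symmetric] e2 s3_def[symmetric])
  have nL: "3 + n + n * n \<le> ?L" "3 + n \<le> ?L"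
  proof -
    have "n * n \<le> N0 * N0" using N0 by (intro mult_le_mono) auto
    moreover have "4 * N0 \<le> nR * N0" using N0 by (intro mult_le_mono1)
    ultimately show "3 + n + n * n \<le> ?L" "3 + n \<le> ?L" using N0 by linarith+
  qed
  have W: "snd s3 1 v = cell (3 + v)" if "v < n" for v
    unfolding s3_def
  proof (rule exec_tab0)
    fix i s' assume "i < ev (V 1) s2" "\<And>z. z \<noteq> 11 \<Longrightarrow> fst s' z = fst s2 z" "fst s' 11 = i"
      "\<And>l. l \<noteq> 1 \<Longrightarrow> snd s' l = snd s2 l"
    then show "ev (cellE (Pl (K 3) (V 11))) s' = cell (3 + i)"
      using f2 nL copy[of "3 + i"] by (simp add: cellE_def)
  qed (use that f2 in simp)
  show "fst u 3 = cell 1" "fst u 4 = cell 2" "fst u 5 = cell 1 + c + 6" "fst u 6 = 6 * cell 1 + 1"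
    "fst u 1 = n" "fst u 2 = 2 * n" "v < n \<Longrightarrow> snd u 1 v = cell (3 + v)"
    using f3 W by (simp_all add: u exec_frame)
  assume xy: "x < n" "y < n"
  let ?C = "\<lambda>a. snd s1 0 (?L + a)"
  have "snd u 2 (2 * n * x + y) = of_bool (x \<noteq> y \<and>
      (if y + 3 = n then ?C (3 + (n + (n * y + x))) \<noteq> 0 else ?C (3 + (n + (n * x + y))) \<noteq> 0))"
    unfolding u
  proof (rule exec_mat)
    fix i j s' assume "\<And>z. z \<noteq> 23 \<Longrightarrow> z \<noteq> 24 \<Longrightarrow> z \<noteq> 8 \<Longrightarrow> fst s' z = fst s3 z"
      "fst s' 23 = i" "fst s' 24 = j" "\<And>l. l \<noteq> 2 \<Longrightarrow> snd s' l = snd s3 l"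
    then show "ev entryE s' = of_bool (i \<noteq> j \<and>
      (if j + 3 = n then ?C (3 + (n + (n * j + i))) \<noteq> 0 else ?C (3 + (n + (n * i + j))) \<noteq> 0))"
      using f3 by (simp add: entryE_def cellE_def)
  qed (use f3 xy in auto)
  moreover have "?C (3 + (n + (n * a + b))) = cell (3 + n + n * a + b)" if "a < n" "b < n" for a b
  proof -
    have "n * a + b < n * Suc a" using that by simp
    also have "\<dots> \<le> n * n" using that by (intro mult_le_mono2) simp
    finally show ?thesis using copy[of "3 + (n + (n * a + b))"] nL by (simp add: add.assoc)
  qed
  ultimately show "snd u 2 (2 * n * x + y) \<noteq> 0 \<longleftrightarrow> x \<noteq> y \<and>
      (if y + 3 = n then cell (3 + n + n * y + x) \<noteq> 0 else cell (3 + n + n * x + y) \<noteq> 0)"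
    using xy by simp
qed

lemma exec_double:
  assumes "x \<noteq> y" shows "fst (exec (Fo x b (As y (Pl (V y) (V y)))) s) y = 2 ^ ev b s * fst s y"
proof -
  let ?f = "\<lambda>i s. exec (As y (Pl (V y) (V y))) (setv x i s)"
  have "fst (iter ?f m s) y = 2 ^ m * fst s y" for m
    by (induction m) (use assms in auto)
  then show ?thesis by (simp add: exec.simps(4))
qed

definition initc :: "nat \<Rightarrow> nat \<Rightarrow> nat \<Rightarrow> cmd" where
  "initc c J nR = Sq (initA J nR) (Sq (initB c nR) (Sq (initC c) initD))"

definition guesses :: "nat \<Rightarrow> nat \<Rightarrow> nat" where
  "guesses c t = 2 ^ 2 ^ (7 * t + c + c + c * c + 10)"

text \<open>The base and both factors of the exponent are rounded up by
  \<open>m \<le> 2 ^ m\<close>; the result can be computed by doubling alone.\<close>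

lemma guesses_suffice: "(t + c + 6) ^ ((3 + c + c * c) * (6 * t + 1)) \<le> guesses c t"
proof -
  let ?E = "(3 + c + c * c) * (6 * t + 1)"
  have l: "m \<le> 2 ^ m" for m :: nat by (rule less_imp_le) simp
  have "(t + c + 6) ^ ?E \<le> (2 ^ (t + c + 6)) ^ ?E" by (intro power_mono l) simp
  also have "\<dots> = 2 ^ ((t + c + 6) * ?E)" by (simp add: power_mult)
  also have "(t + c + 6) * ?E \<le> 2 ^ (t + c + 6) * (2 ^ (3 + c + c * c) * 2 ^ (6 * t + 1))"
    by (intro mult_le_mono l)
  also have "\<dots> = 2 ^ ((t + c + 6) + ((3 + c + c * c) + (6 * t + 1)))" by (simp only: power_add)
  also have "(t + c + 6) + ((3 + c + c * c) + (6 * t + 1)) = 7 * t + c + c + c * c + 10" by simp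
  finally show ?thesis unfolding guesses_def by (simp add: power_increasing)
qed

theorem (in branching) initc_env:
  assumes s: "fst s 0 = N0" "N0 = J * n" "nR < J" "4 \<le> nR" "0 < n"
    and arr: "\<forall>k<21. \<forall>i. snd s k i = M (nR + k + 21 * i)"
    and cell: "\<And>a. cell a = M (if a < nR then a * N0 else a)"
    and c: "cell 1 = t" "cell 2 = w" "\<And>v. v < n \<Longrightarrow> cell (3 + v) = \<omega> v"
    "\<And>x y. x < n \<Longrightarrow> y < n \<Longrightarrow> x \<noteq> y \<Longrightarrow> y + 3 \<noteq> n \<Longrightarrow> cell (3 + n + n * x + y) \<noteq> 0 \<longleftrightarrow> adj x y"
  shows "env \<omega> t w (guesses c t) (exec (initc c J nR) s)"
proof -
  define s1 where "s1 = exec (initA J nR) s"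
  define s2 where "s2 = exec (initB c nR) s1"
  define s3 where "s3 = exec (initC c) s2"
  define s4 where "s4 = exec initD s3"
  have f1: "fst s1 0 = N0" "fst s1 1 = n" "fst s1 2 = 2 * n" "fst s1 10 = N0 * N0 + nR * N0 + 5" "snd s1 = snd s"
    using initA_correct[of s J n nR] s unfolding s1_def by simp_all
  have N: "nR \<le> N0" "4 * n \<le> N0"
  proof -
    show "nR \<le> N0" using s by (cases n) auto
    show "4 * n \<le> N0" unfolding s(2) using s by (intro mult_le_mono1) simp
  qed
  have arr1: "\<forall>k<21. \<forall>i. snd s1 k i = M (nR + k + 21 * i)" using arr f1(5) by simp
  note B = initB_correct[OF f1(1-4) arr1 N(1) s(4) N(2) cell, where c = c, folded s2_def]
  have f2: "fst s2 1 = n" "fst s2 2 = 2 * n" "fst s2 3 = t" "fst s2 4 = w" "fst s2 5 = t + c + 6" "fst s2 6 = 6 * t + 1"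
    "\<And>v. v < n \<Longrightarrow> snd s2 1 v = \<omega> v"
    by (simp_all only: B(1-7) c(1-3))
  have m: "snd s2 2 (2 * n * x + y) \<noteq> 0 \<longleftrightarrow> adj x y" if xy: "x < n" "y < n" for x y
  proof (cases "x = y")
    case True
    then show ?thesis using B(8)[OF xy] adj_irrefl by simp
  next
    case False
    then have "snd s2 2 (2 * n * x + y) \<noteq> 0 \<longleftrightarrow> (if y + 3 = n then adj y x else adj x y)"
      using B(8)[OF xy] c(4)[OF xy] c(4)[OF xy(2,1)] by auto
    then show ?thesis using adj_sym by auto
  qed
  have "fst s3 12 = 2 ^ (7 * t + c + c + c * c + 10)"
    unfolding s3_def initC_def exec.simps(3)
    by (subst exec_double) (use f2 in \<open>simp_all add: algebra_simps\<close>)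
  moreover have "fst s4 7 = 2 ^ fst s3 12"
    unfolding s4_def initD_def exec.simps(3) by (subst exec_double) simp_all
  ultimately have K: "fst s4 7 = guesses c t" by (simp add: guesses_def)
  have fr: "fst s4 x = fst s2 x" if "x \<notin> {7, 12, 13}" for x
    using that by (simp add: s4_def s3_def initD_def initC_def exec_frame)
  have fr': "snd s4 = snd s2"
    by (rule ext) (simp add: s4_def s3_def initD_def initC_def exec_frame)
  have "env \<omega> t w (guesses c t) s4"
    unfolding env_def good_def using f2 m K by (simp add: fr fr')
  then show ?thesis by (simp only: initc_def exec.simps(3) s4_def s3_def s2_def s1_def)
qed

section \<open>Static bounds and total running time\<close>

lemma bok_macros [simp]:
  "bok Q (nz e)" "bok Q (notE e)" "bok Q (leE a b)" "bok Q (ltE a b)" "bok Q (eqE a b)"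
  by (simp_all add: nz_def notE_def leE_def ltE_def eqE_def)

lemma okE_macros [simp]:
  "okE Q (nz e) = okE Q e" "okE Q (notE e) = okE Q e" "okE Q (andE a b) = (okE Q a \<and> okE Q b)"
  "okE Q (orE a b) = (okE Q a \<and> okE Q b)" "okE Q (leE a b) = (okE Q a \<and> okE Q b)"
  "okE Q (ltE a b) = (okE Q a \<and> okE Q b)" "okE Q (eqE a b) = (okE Q a \<and> okE Q b)"
  "okE Q (exE x b a) = (x \<notin> Q \<and> bok Q b \<and> okE Q b \<and> okE Q a)"
  "okE Q (leastE x y b a) = (x \<notin> Q \<and> y \<notin> Q \<and> bok Q b \<and> okE Q b \<and> okE Q a)"
  "okE Q (mulE p e) = (8 \<notin> Q \<and> p \<in> Q \<and> okE Q e)" "okE Q (mulK m e) = (8 \<notin> Q \<and> okE Q e)"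
  by (auto simp: nz_def notE_def andE_def orE_def leE_def ltE_def eqE_def exE_def leastE_def mulE_def mulK_def)

lemma okE_lists [simp]:
  "okE Q (andL as) = (\<forall>a\<in>set as. okE Q a)" "okE Q (orL as) = (\<forall>a\<in>set as. okE Q a)"
  "okE Q (plL as) = (\<forall>a\<in>set as. okE Q a)"
  by (induction as) auto

lemma okC_IfC [simp]: "okC Q (IfC e c) = (8 \<notin> Q \<and> okE Q e \<and> okC Q c)"
  by (auto simp: IfC_def)

lemma okE_exQ [simp]: "1 \<in> Q \<Longrightarrow> Q \<subseteq> {..<60} \<Longrightarrow> okE Q (exQ m b) = okE Q b"
  by (induction m) auto

lemma maE_macros [simp]:
  "maE (nz e) = maE e" "maE (notE e) = maE e" "maE (andE a b) = max (maE a) (maE b)"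
  "maE (orE a b) = max (maE a) (maE b)" "maE (leE a b) = max (maE a) (maE b)"
  "maE (ltE a b) = max (maE a) (maE b)" "maE (eqE a b) = max (maE a) (maE b)"
  "maE (exE x b a) = max (maE b) (maE a)" "maE (leastE x y b a) = max (maE b) (maE a)"
  "maE (mulE p e) = maE e" "maE (mulK m e) = maE e"
  by (auto simp: nz_def notE_def andE_def orE_def leE_def ltE_def eqE_def exE_def leastE_def mulE_def mulK_def)

lemma maE_lists [simp]:
  "maE (andL as) \<le> m \<longleftrightarrow> (\<forall>a\<in>set as. maE a \<le> m)" "maE (orL as) \<le> m \<longleftrightarrow> (\<forall>a\<in>set as. maE a \<le> m)"
  "maE (plL as) \<le> m \<longleftrightarrow> (\<forall>a\<in>set as. maE a \<le> m)"
  by (induction as) auto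

lemma ma_IfC [simp]: "ma (IfC e c) = max (maE e) (ma c)"
  by (simp add: IfC_def)

lemma maE_exQ [simp]: "maE (exQ m b) = maE b"
  by (induction m) auto

text \<open>Sizes of the graph, base, number of steps and number of guesses; together with constants
  they bound all loops of the main program.\<close>

definition Qm :: "nat set" where "Qm = {1, 2, 5, 6, 7}"

lemma Qm_simps [simp]: "x \<in> Qm \<longleftrightarrow> x = 1 \<or> x = 2 \<or> x = 5 \<or> x = 6 \<or> x = 7" "Qm \<subseteq> {..<60}"
  by (auto simp: Qm_def)

lemma static_bfs: "okC Qm bfs" "ma bfs \<le> 20"
  by (simp_all add: bfs_def)

lemma static_mcut: "okC Qm mcut" "ma mcut \<le> 20"
  using static_bfs by (simp_all add: mcut_def splitg_def augment_def trace_def)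

lemma static_adj: "okE Qm (adjE x y)" "maE (adjE x y) \<le> 20"
  by (simp_all add: adjE_def)

lemma static_nbE: "u \<notin> Qm \<Longrightarrow> okE Qm (nbE k x u)" "k \<le> 20 \<Longrightarrow> maE (nbE k x u) \<le> 20"
  using static_adj by (simp_all add: nbE_def)

lemma static_copy: "okC Qm (nbs k l)" "okC Qm (cpy k l)"
    "k \<le> 20 \<Longrightarrow> l \<le> 20 \<Longrightarrow> ma (nbs k l) \<le> 20" "k \<le> 20 \<Longrightarrow> l \<le> 20 \<Longrightarrow> ma (cpy k l) \<le> 20"
  by (simp_all add: nbs_def cpy_def static_nbE)

lemma static_pick: "okE Qm j \<Longrightarrow> okE Qm (pickE k j)" "k \<le> 20 \<Longrightarrow> maE j \<le> 20 \<Longrightarrow> maE (pickE k j) \<le> 20"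
  by (simp_all add: pickE_def)

lemma static_type:
  "(\<And>i j. okE Qm (pat i j)) \<Longrightarrow> okE Qm (typeE c pat)"
  "(\<And>i j. maE (pat i j) \<le> 20) \<Longrightarrow> maE (typeE c pat) \<le> 20"
  using static_adj by (auto simp: typeE_def digE_def)

lemma static_match:
  "(\<And>x. okE Qm (hx x)) \<Longrightarrow> okE Qm (matchE c hx)"
  "(\<And>x. maE (hx x) \<le> 20) \<Longrightarrow> maE (matchE c hx) \<le> 20"
  by (simp_all add: matchE_def static_type)

lemma static_prep: "okC Qm (prep c)" "ma (prep c) \<le> 20"
  by (simp_all add: static_mcut static_copy static_pick static_match
      prep_def roots_def rmax_def levels_def nextlevel_def lexf_def lexE_def)

lemma static_step: "okC Qm (stepc c)" "ma (stepc c) \<le> 20"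
proof -
  show "okC Qm (stepc c)"
    unfolding stepc_def rdg_def ops_def levE_def okC.simps okC_IfC okE.simps okE_macros bok.simps bok_macros
    by (intro conjI static_prep static_pick static_copy) (simp_all add: static_match static_pick)
  have "ma (ops c) \<le> 20"
    unfolding ops_def levE_def ma.simps ma_IfC maE.simps maE_macros maE_exQ max.bounded_iff
    by (intro conjI static_pick static_copy static_match) (simp_all del: max.bounded_iff)
  then show "ma (stepc c) \<le> 20"
    unfolding stepc_def rdg_def ma.simps maE.simps maE_macros max.bounded_iff
    by (intro conjI static_prep) simp_all
qed

lemma static_check: "okC Qm (checkc c Phi)" "ma (checkc c Phi) \<le> 20"
proof -
  show "okC Qm (checkc c Phi)"
    unfolding checkc_def okC.simps okE.simps okE_macros okE_lists bok.simps
    by (intro conjI static_bfs) (auto simp: static_adj static_nbE static_type)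
  show "ma (checkc c Phi) \<le> 20"
    unfolding checkc_def ma.simps maE.simps maE_macros maE_exQ max.bounded_iff maE_lists
    by (intro conjI static_bfs) (auto simp: static_adj static_nbE static_type)
qed

lemma static_mainc: "okC Qm (mainc c Phi)" "ma (mainc c Phi) \<le> 20"
  by (simp_all add: static_step static_check mainc_def tryc_def)

lemma static_read:
  "8 \<notin> Q \<Longrightarrow> 14 \<notin> Q \<Longrightarrow> 10 \<in> Q \<Longrightarrow> okE Q a \<Longrightarrow> okE Q (readE nR a)" "maE a \<le> 20 \<Longrightarrow> maE (readE nR a) \<le> 20"
  by (auto simp: readE_def simp del: upt_rec_numeral)

text \<open>Each phase has its own set of fixed variables, since it computes loop bounds of later
  phases.\<close>

lemma static_init:
  "okC {0} (initA J nR)" "okC {0, 1, 2, 10} (initB c nR)" "okC {3, 6} (initC c)" "okC {12} initD"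
  "ma (initc c J nR) \<le> 20"
  by (simp_all add: static_read initA_def initB_def initC_def initD_def initc_def cellE_def entryE_def addrE_def)

lemma readE_sizes:
  "mvE a = mvE b \<Longrightarrow> mvE (readE nR a) = mvE (readE 0 b)" "dpE a = dpE b \<Longrightarrow> dpE (readE nR a) = dpE (readE 0 b)"
proof -
  have "mvE (plL (map f xs)) = mvE (plL (map g xs))" if "\<And>k. mvE (f k) = mvE (g k)" for f g and xs :: "nat list"
    by (induction xs) (simp_all add: that)
  then show "mvE a = mvE b \<Longrightarrow> mvE (readE nR a) = mvE (readE 0 b)"
    unfolding readE_def by (simp add: eqE_def notE_def mulK_def del: upt_rec_numeral)
  have "dpE (plL (map f xs)) = dpE (plL (map g xs))" if "\<And>k. dpE (f k) = dpE (g k)" for f g and xs :: "nat list"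
    by (induction xs) (simp_all add: that)
  then show "dpE a = dpE b \<Longrightarrow> dpE (readE nR a) = dpE (readE 0 b)"
    unfolding readE_def by (simp add: eqE_def notE_def mulK_def del: upt_rec_numeral)
qed

text \<open>This breaks a circularity: \<open>R\<close> is chosen from the number of variables and
  temporaries, but the code mentions \<open>R\<close> and \<open>J\<close> as constants.\<close>

lemma initc_sizes: "mv (initc c J nR) = mv (initc c 0 0)" "dp (initc c J nR) = dp (initc c 0 0)"
proof -
  have "mvE (addrE nR) = mvE (addrE 0)" "dpE (addrE nR) = dpE (addrE 0)"
    by (simp_all add: addrE_def ltE_def leE_def nz_def notE_def)
  note r = readE_sizes(1)[OF this(1), of nR] readE_sizes(2)[OF this(2), of nR]
  have a: "mv (initA J nR) = mv (initA 0 0)" "dp (initA J nR) = dp (initA 0 0)"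
    by (simp_all add: initA_def mulK_def leE_def notE_def)
  have "mv (initB c nR) = mv (initB c 0)" "dp (initB c nR) = dp (initB c 0)"
    by (simp_all only: initB_def mv.simps dp.simps r)
  with a show "mv (initc c J nR) = mv (initc c 0 0)" "dp (initc c J nR) = dp (initc c 0 0)"
    by (simp_all only: initc_def mv.simps dp.simps)
qed

text \<open>A single bound \<open>B\<close>, a constant multiple of
  \<open>n * n * guesses c t\<close>, dominates the loop bounds of all phases.\<close>

theorem running_time:
  assumes J: "0 < J"
  shows "\<exists>C D. \<forall>s n t. fst s 0 = J * n \<longrightarrow> 0 < n \<longrightarrow>
    (let u = exec (initc c J nR) s in fst u 1 = n \<and> fst u 2 = 2 * n \<and> fst u 3 = t \<and> fst u 5 = t + c + 6 \<and>
       fst u 6 = 6 * t + 1 \<and> fst u 7 = guesses c t) \<longrightarrow>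
    tm (Sq (initc c J nR) (mainc c Phi)) 21 s \<le> C * (n * n * guesses c t) ^ D"
proof -
  obtain C1 D1 where 1: "\<And>B s. bd {0} B s \<Longrightarrow> tm (initA J nR) 21 s \<le> C1 * (B + 1) ^ D1"
    using tm_poly[OF static_init(1)] unfolding poly_time_def by metis
  obtain C2 D2 where 2: "\<And>B s. bd {0, 1, 2, 10} B s \<Longrightarrow> tm (initB c nR) 21 s \<le> C2 * (B + 1) ^ D2"
    using tm_poly[OF static_init(2)] unfolding poly_time_def by metis
  obtain C3 D3 where 3: "\<And>B s. bd {3, 6} B s \<Longrightarrow> tm (initC c) 21 s \<le> C3 * (B + 1) ^ D3"
    using tm_poly[OF static_init(3)] unfolding poly_time_def by metis
  obtain C4 D4 where 4: "\<And>B s. bd {12} B s \<Longrightarrow> tm initD 21 s \<le> C4 * (B + 1) ^ D4"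
    using tm_poly[OF static_init(4)] unfolding poly_time_def by metis
  obtain C5 D5 where 5: "\<And>B s. bd Qm B s \<Longrightarrow> tm (mainc c Phi) 21 s \<le> C5 * (B + 1) ^ D5"
    using tm_poly[OF static_mainc(1)] unfolding poly_time_def by metis
  define D where "D = D1 + D2 + D3 + D4 + D5"
  define C0 where "C0 = J * J + nR * J + 8"
  have "tm (Sq (initc c J nR) (mainc c Phi)) 21 s \<le> (C1 + C2 + C3 + C4 + C5) * C0 ^ D * (n * n * guesses c t) ^ D"
    if s: "fst s 0 = J * n" "0 < n" and u: "fst (exec (initc c J nR) s) 1 = n" "fst (exec (initc c J nR) s) 2 = 2 * n"
      "fst (exec (initc c J nR) s) 3 = t" "fst (exec (initc c J nR) s) 5 = t + c + 6"
      "fst (exec (initc c J nR) s) 6 = 6 * t + 1" "fst (exec (initc c J nR) s) 7 = guesses c t" for s n t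
  proof -
    define s1 where "s1 = exec (initA J nR) s"
    define s2 where "s2 = exec (initB c nR) s1"
    define s3 where "s3 = exec (initC c) s2"
    define s4 where "s4 = exec initD s3"
    have s4: "exec (initc c J nR) s = s4" by (simp only: initc_def exec.simps(3) s4_def s3_def s2_def s1_def)
    define P where "P = n * n * guesses c t"
    define B where "B = (J * J + nR * J + 7) * P"
    have gp: "0 < guesses c t" by (simp add: guesses_def)
    have P: "n * n \<le> P" "guesses c t \<le> P" "n \<le> P" "1 \<le> P"
    proof -
      show "n * n \<le> P" "guesses c t \<le> P" unfolding P_def using gp s(2) by simp_all
      then show "n \<le> P" using le_square[of n] le_trans by blast
      then show "1 \<le> P" using s(2) by simp
    qed
    let ?X = "7 * t + c + c + c * c + 10"
    have X: "?X \<le> 2 ^ ?X" "2 ^ ?X \<le> guesses c t"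
      unfolding guesses_def by (rule less_imp_le, rule less_exp)+
    have B7: "7 * P \<le> B" unfolding B_def by (simp add: add_mult_distrib)
    have BJ: "J * n * (J * n) + nR * (J * n) + 5 \<le> B"
    proof -
      have "J * n * (J * n) \<le> J * J * P" using mult_le_mono2[OF P(1), of "J * J"] by (simp add: ac_simps)
      moreover have "nR * (J * n) \<le> nR * J * P" using mult_le_mono2[OF P(3), of "nR * J"] by (simp add: ac_simps)
      ultimately have "J * n * (J * n) + nR * (J * n) + 5 \<le> J * J * P + nR * J * P + 7 * P"
        using P(4) by linarith
      then show ?thesis by (simp only: B_def add_mult_distrib)
    qed
    have BJ': "J * n \<le> B"
    proof -
      have "J * n * 1 \<le> J * n * (J * n)" using J s(2) by (intro mult_le_mono2) simp
      then show ?thesis using BJ by linarith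
    qed
    have v1: "fst s1 0 = J * n" "fst s1 1 = n" "fst s1 2 = 2 * n"
      "fst s1 10 = J * n * (J * n) + nR * (J * n) + 5"
      using initA_correct[OF s(1) J, of nR] unfolding s1_def by simp_all
    have v2: "fst s2 3 = t" "fst s2 6 = 6 * t + 1"
      using u(3,5) unfolding s4 by (simp_all add: s4_def s3_def initC_def initD_def exec_frame)
    have v3: "fst s3 12 = 2 ^ ?X"
      unfolding s3_def initC_def exec.simps(3)
      by (subst exec_double) (use v2 in \<open>simp_all add: algebra_simps\<close>)
    have b1: "bd {0} B s" using BJ' s by (simp add: bd_def)
    have b2: "bd {0, 1, 2, 10} B s1" using BJ BJ' v1 P B7 by (simp add: bd_def)
    have "2 ^ ?X \<le> B" using X(2) P(2) B7 P(4) by linarith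
    moreover from this X(1) have XB: "?X \<le> B" by (rule order.trans[rotated])
    ultimately have b4: "bd {12} B s3" unfolding bd_def v3[symmetric] by blast
    have b3: "bd {3, 6} B s2" using v2 XB by (simp add: bd_def)
    have b5: "bd Qm B s4"
    proof -
      have "fst s4 1 \<le> B" "fst s4 2 \<le> B" "fst s4 5 \<le> B" "fst s4 6 \<le> B" "fst s4 7 \<le> B"
        using u[unfolded s4] XB P(2-3) B7 by linarith+
      then show ?thesis by (simp add: bd_def Qm_def)
    qed
    have mono: "C' * (B + 1) ^ D' \<le> C' * (B + 1) ^ D" if "D' \<le> D" for C' D'
      using that by (intro mult_le_mono2 power_increasing) auto
    have "tm (Sq (initc c J nR) (mainc c Phi)) 21 s
        = tm (initA J nR) 21 s + (tm (initB c nR) 21 s1 + (tm (initC c) 21 s2 + tm initD 21 s3)) + tm (mainc c Phi) 21 s4"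
      by (simp only: tm.simps(3) initc_def exec.simps(3) s4_def s3_def s2_def s1_def)
    also have "\<dots> \<le> C1 * (B + 1) ^ D + (C2 * (B + 1) ^ D + (C3 * (B + 1) ^ D + C4 * (B + 1) ^ D)) + C5 * (B + 1) ^ D"
      by (intro add_mono order.trans[OF 1[OF b1] mono] order.trans[OF 2[OF b2] mono]
          order.trans[OF 3[OF b3] mono] order.trans[OF 4[OF b4] mono] order.trans[OF 5[OF b5] mono])
        (simp_all add: D_def)
    also have "\<dots> = (C1 + C2 + C3 + C4 + C5) * (B + 1) ^ D" by (simp only: add_mult_distrib add.assoc)
    also have "\<dots> \<le> (C1 + C2 + C3 + C4 + C5) * (C0 * P) ^ D"
    proof (intro mult_le_mono2 power_mono)
      show "B + 1 \<le> C0 * P" using P(4) by (simp add: B_def C0_def add_mult_distrib)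
    qed simp
    finally show ?thesis by (simp only: P_def power_mult_distrib mult.assoc)
  qed
  then show ?thesis unfolding Let_def by blast
qed

section \<open>Relocating the input\<close>

text \<open>
  The prelude multiplies register 0 by \<open>2 ^ R\<close>, so that its new content \<open>N\<close> exceeds \<open>R\<close>, and then
  moves register \<open>i\<close> to register \<open>i * N\<close> for \<open>0 < i < R\<close>. This frees the registers below \<open>R\<close>; the
  input registers overwritten by this are redundant by symmetry of the adjacency matrix.
\<close>

definition save :: "nat \<Rightarrow> ram_instr list" where
  "save j = concat (map (\<lambda>i. [Add (Suc i) i 0, Store (Suc i) (Suc (Suc i))]) [0..<j])"

definition prelude :: "nat \<Rightarrow> nat \<Rightarrow> ram_instr list" where
  "prelude R l = JumpZero 0 l # replicate R (Add 0 0 0) @ Store 0 1 # save (R - 2)"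

text \<open>The state in which registers 1 to \<open>j + 1\<close> have been moved and registers 0
  to \<open>j\<close> hold the pointers used for it.\<close>

definition saved :: "nat \<Rightarrow> nat \<Rightarrow> ram_memory \<Rightarrow> ram_memory" where
  "saved N j M a = (if a \<le> j then (a + 1) * N
     else if N dvd a \<and> a div N \<le> j + 1 then M (a div N) else M a)"

lemma less_exp_mult: "0 < n \<Longrightarrow> R < 2 ^ R * (n :: nat)"
  using less_exp[of R] mult_le_mono2[of 1 n "2 ^ R"] by linarith

lemma length_save [simp]: "length (save j) = 2 * j"
  by (induction j) (simp_all add: save_def)

section \<open>Correctness of the prelude\<close>

context layout
begin

lemma steps_double:
  assumes "placed P p (replicate j (Add 0 0 0))"
  shows "steps P j (p, M) (p + j, M(0 := 2 ^ j * M 0))"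
  using assms
proof (induction j arbitrary: p M)
  case (Suc j)
  then have a: "placed P p [Add 0 0 0]" "placed P (Suc p) (replicate j (Add 0 0 0))"
    using placed_append[of P p "[Add 0 0 0]" "replicate j (Add 0 0 0)"] by auto
  have e: "2 ^ j * (M 0 + M 0) = 2 ^ Suc j * M 0" by simp
  show ?case
    by (rule steps_Cons[OF a(1)]) (use Suc.IH[OF a(2), of "M(0 := M 0 + M 0)"] e in
      \<open>simp del: fun_upd_apply power_Suc add: fun_upd_same\<close>)
qed (simp add: steps_0)

text \<open>The register moved last becomes the next pointer, obtained from the previous pointer by
  adding \<open>N\<close>; so the move works without scratch registers.\<close>

lemma steps_save:
  assumes "placed P p (save j)" "j + 1 < N" "M 0 = N"
  shows "steps P (2 * j) (p, saved N 0 M) (p + 2 * j, saved N j M)"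
  using assms
proof (induction j)
  case (Suc j)
  have sv: "save (Suc j) = save j @ [Add (Suc j) j 0, Store (Suc j) (Suc (Suc j))]" by (simp add: save_def)
  have pl: "placed P p (save j)" "placed P (p + 2 * j) [Add (Suc j) j 0]"
    "placed P (Suc (p + 2 * j)) [Store (Suc j) (Suc (Suc j))]"
    using Suc.prems(1) unfolding sv by (simp_all add: placed_append placed_Cons)
  have 1: "steps P (2 * j) (p, saved N 0 M) (p + 2 * j, saved N j M)" using Suc pl by simp
  define M' where "M' = (saved N j M)(Suc j := (j + 2) * N)"
  have "saved N j M j + saved N j M 0 = (j + 2) * N" by (simp add: saved_def)
  then have 2: "ram_exec (Add (Suc j) j 0) (p + 2 * j, saved N j M) = (Suc (p + 2 * j), M')"
    by (simp add: M'_def)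
  have nd: "\<not> N dvd a" if "0 < a" "a < N" for a using that by (auto dest: dvd_imp_le)
  \<comment> \<open>Register \<open>j + 2\<close> still holds its input, since it is positive, at
    most \<open>N - 1\<close> and thus no multiple of \<open>N\<close>.\<close>
  have "M' (Suc (Suc j)) = M (Suc (Suc j))" using nd[of "Suc (Suc j)"] Suc.prems(2) by (simp add: M'_def saved_def)
  then have 3: "ram_exec (Store (Suc j) (Suc (Suc j))) (Suc (p + 2 * j), M')
      = (Suc (Suc (p + 2 * j)), M'((j + 2) * N := M (Suc (Suc j))))" by (simp add: M'_def)
  have "M'((j + 2) * N := M (Suc (Suc j))) = saved N (Suc j) M"
  proof
    fix a
    have big: "Suc j < (j + 2) * N" using Suc.prems(2) by (simp add: algebra_simps)
    have N0: "0 < N" using Suc.prems(2) by simp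
    consider "a = (j + 2) * N" | "a \<noteq> (j + 2) * N" "a = Suc j" | "a \<noteq> (j + 2) * N" "a \<noteq> Suc j" by blast
    then show "(M'((j + 2) * N := M (Suc (Suc j)))) a = saved N (Suc j) M a"
    proof cases
      case 1
      then show ?thesis using big N0 by (simp add: saved_def)
    next
      case 3
      have "N dvd a \<and> a div N \<le> Suc j + 1 \<longleftrightarrow> N dvd a \<and> a div N \<le> j + 1"
      proof -
        have "a div N \<noteq> j + 2" if "N dvd a" using dvd_div_mult_self[OF that] 3(1) by metis
        then show ?thesis by auto
      qed
      then show ?thesis using 3 by (auto simp: M'_def saved_def)
    qed (simp add: M'_def saved_def)
  qed
  then have "steps P 2 (p + 2 * j, saved N j M) (p + 2 * Suc j, saved N (Suc j) M)"
    using steps_trans[OF steps_one[OF pl(2), of "saved N j M", unfolded 2] steps_one[OF pl(3), of M', unfolded 3]]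
    by (simp add: numeral_2_eq_2)
  from steps_trans[OF 1 this] show ?case by simp
qed (simp add: steps_0)

lemma prelude_correct:
  assumes p: "placed P 0 (prelude R l)" and R: "2 \<le> R" and M: "M 0 = n" "0 < n"
  shows "steps P (length (prelude R l)) (0, M) (length (prelude R l), saved (2 ^ R * n) (R - 2) (M(0 := 2 ^ R * n)))"
proof -
  let ?N = "2 ^ R * n"
  have pl: "placed P 0 [JumpZero 0 l]" "placed P 1 (replicate R (Add 0 0 0))" "placed P (R + 1) [Store 0 1]"
    "placed P (R + 2) (save (R - 2))"
    using p placed_append[of P 0 "[JumpZero 0 l]" "replicate R (Add 0 0 0) @ Store 0 1 # save (R - 2)"]
      placed_append[of P 1 "replicate R (Add 0 0 0)" "Store 0 1 # save (R - 2)"]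
      placed_append[of P "R + 1" "[Store 0 1]" "save (R - 2)"] by (simp_all add: prelude_def)
  have RN: "R < ?N" by (rule less_exp_mult[OF M(2)])
  have 1: "steps P 1 (0, M) (1, M)" using steps_one[OF pl(1), of M] M by simp
  let ?M = "M(0 := ?N)"
  have 2: "steps P R (1, M) (R + 1, ?M)" using steps_double[OF pl(2), of M] M by simp
  have "?M(?N := ?M 1) = saved ?N 0 ?M"
  proof
    fix a
    have N0: "1 < ?N" using RN R by linarith
    show "(?M(?N := ?M 1)) a = saved ?N 0 ?M a"
    proof (cases "?N dvd a")
      case True
      then obtain q where "a = ?N * q" by blast
      then show ?thesis using N0 by (cases q; cases "q - 1") (auto simp: saved_def)
    next
      case False
      then have "a \<noteq> 0" "a \<noteq> ?N" by (metis dvd_0_right, metis dvd_refl)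
      with False show ?thesis by (simp add: saved_def)
    qed
  qed
  then have 3: "steps P 1 (R + 1, ?M) (R + 2, saved ?N 0 ?M)" using steps_one[OF pl(3), of ?M] by simp
  have 4: "steps P (2 * (R - 2)) (R + 2, saved ?N 0 ?M) (R + 2 + 2 * (R - 2), saved ?N (R - 2) ?M)"
    using pl(4) by (rule steps_save) (use RN R in simp_all)
  have "1 + R + 1 + 2 * (R - 2) = length (prelude R l)" "R + 2 + 2 * (R - 2) = length (prelude R l)"
    by (simp_all add: prelude_def)
  then show ?thesis using steps_trans[OF steps_trans[OF steps_trans[OF 1 2] 3] 4] by simp
qed

end

lemma length_concat_rows: "length (concat (map (\<lambda>u. map (f u) [0..<n]) [0..<m])) = n * m"
  by (induction m) simp_all

lemma nth_concat_rows:
  assumes "x < m" "y < n"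
  shows "concat (map (\<lambda>u. map (f u) [0..<n]) [0..<m]) ! (n * x + y) = f x y"
  using assms(1)
proof (induction m)
  case (Suc m)
  note len = length_concat_rows[of f n m]
  show ?case
  proof (cases "x = m")
    case False
    then have "n * Suc x \<le> n * m" using Suc.prems by (intro mult_le_mono2) simp
    then have "n * x + y < n * m" using assms(2) by simp
    then show ?thesis using Suc False by (simp add: nth_append len)
  qed (use assms(2) in \<open>simp add: nth_append len\<close>)
qed simp

lemma encode_instance_simps:
  "encode_instance n G \<omega> t w 0 = n" "encode_instance n G \<omega> t w 1 = t" "encode_instance n G \<omega> t w 2 = w"
  "v < n \<Longrightarrow> encode_instance n G \<omega> t w (3 + v) = \<omega> v"
  "x < n \<Longrightarrow> y < n \<Longrightarrow> encode_instance n G \<omega> t w (3 + n + n * x + y) = of_bool (x \<rightarrow>\<^bsub>with_proj G\<^esub> y)"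
proof -
  let ?f = "\<lambda>u v. if u \<rightarrow>\<^bsub>with_proj G\<^esub> v then 1 else (0::nat)"
  let ?r = "concat (map (\<lambda>u. map (?f u) [0..<n]) [0..<n])"
  have e: "encode_instance n G \<omega> t w a = (if a < 3 + n + n * n then ([n, t, w] @ map \<omega> [0..<n] @ ?r) ! a else 0)" for a
    unfolding encode_instance_def Let_def length_append length_concat_rows by (simp add: add.assoc)
  show "encode_instance n G \<omega> t w 0 = n" "encode_instance n G \<omega> t w 1 = t" "encode_instance n G \<omega> t w 2 = w"
    "v < n \<Longrightarrow> encode_instance n G \<omega> t w (3 + v) = \<omega> v"
    unfolding e by (simp_all add: nth_append numeral_2_eq_2 numeral_3_eq_3)
  assume xy: "x < n" "y < n"
  have "n * Suc x \<le> n * n" using xy by (intro mult_le_mono2) simp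
  then have "3 + n + n * x + y < 3 + n + n * n" using xy(2) by simp
  moreover have "3 + n + n * x + y = length [n, t, w] + (length (map \<omega> [0..<n]) + (n * x + y))" by simp
  ultimately show "encode_instance n G \<omega> t w (3 + n + n * x + y) = of_bool (x \<rightarrow>\<^bsub>with_proj G\<^esub> y)"
    unfolding e by (simp only: nth_append_length_plus if_True nth_concat_rows[OF xy]) simp
qed

text \<open>Above the low registers, only multiples of \<open>N\<close> can be lost. For a matrix
  entry this makes \<open>n\<close> divide \<open>y + 3\<close>, so \<open>y = n - 3\<close> or
  \<open>n \<le> 2\<close>; in the latter case the address is below \<open>N\<close>.\<close>

lemma saved_encode:
  fixes n R :: nat and G \<omega> t w
  defines "N \<equiv> 2 ^ R * n" and "E \<equiv> encode_instance n G \<omega> t w"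
  defines "M \<equiv> saved N (R - 2) (E(0 := N))"
  defines "cell \<equiv> \<lambda>a. M (if a < R then a * N else a)"
  assumes R: "4 \<le> R" and n: "0 < n"
  shows "M 0 = N" "cell 1 = t" "cell 2 = w" "v < n \<Longrightarrow> cell (3 + v) = \<omega> v"
    "x < n \<Longrightarrow> y < n \<Longrightarrow> y + 3 \<noteq> n \<Longrightarrow> cell (3 + n + n * x + y) \<noteq> 0 \<longleftrightarrow> x \<rightarrow>\<^bsub>with_proj G\<^esub> y"
proof -
  have R16: "16 \<le> (2::nat) ^ R" using power_increasing[OF R, of "2::nat"] by simp
  have RN: "R < N" unfolding N_def by (rule less_exp_mult[OF n])
  have N16: "16 * n \<le> N" unfolding N_def using R16 by simp
  have c: "cell a = E a" if a: "0 < a" "a < R \<or> \<not> N dvd a" for a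
  proof (cases "a < R")
    case True
    have "R - 2 < a * N" using RN a(1) by (cases a) auto
    moreover have "a \<le> Suc (R - 2)" using True R by simp
    ultimately show ?thesis using True RN a(1) by (simp add: cell_def M_def saved_def)
  next
    case False
    moreover from this have "\<not> a \<le> R - 2" using R by simp
    ultimately show ?thesis using a by (simp add: cell_def M_def saved_def)
  qed
  show "M 0 = N" by (simp add: M_def saved_def)
  show "cell 1 = t" "cell 2 = w" using c[of 1] c[of 2] R by (simp_all add: E_def encode_instance_simps[unfolded One_nat_def])
  show "cell (3 + v) = \<omega> v" if "v < n"
  proof -
    have "3 + v < N" using that N16 by linarith
    then have "\<not> N dvd 3 + v" by (auto dest: dvd_imp_le)
    then show ?thesis using c[of "3 + v"] that by (simp add: E_def encode_instance_simps)
  qed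
  assume xy: "x < n" "y < n" "y + 3 \<noteq> n"
  have "\<not> N dvd 3 + n + n * x + y"
  proof
    assume d: "N dvd 3 + n + n * x + y"
    then have "n dvd 3 + n + n * x + y" unfolding N_def by (rule dvd_mult_right)
    then have "n dvd (n + n * x) + (3 + y)" by (simp add: ac_simps)
    then have "n dvd 3 + y" by (subst (asm) dvd_add_right_iff) simp_all
    then obtain q where q: "3 + y = n * q" by blast
    have "n \<le> 2"
    proof (rule ccontr)
      assume "\<not> n \<le> 2"
      moreover have "q \<noteq> 0" "q \<noteq> 1" using q xy(3) by (intro notI; simp)+
      then have "n * 2 \<le> n * q" by (intro mult_le_mono2) simp
      ultimately show False using q xy(2) by linarith
    qed
    moreover have "n * x \<le> 2 * 1" using \<open>n \<le> 2\<close> xy(1) by (intro mult_le_mono) auto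
    ultimately have "3 + n + n * x + y < N" using xy(2) N16 n by linarith
    then show False using d by (auto dest: dvd_imp_le)
  qed
  then show "cell (3 + n + n * x + y) \<noteq> 0 \<longleftrightarrow> x \<rightarrow>\<^bsub>with_proj G\<^esub> y"
    using c[of "3 + n + n * x + y"] xy by (simp add: E_def encode_instance_simps)
qed

theorem program_exists:
  assumes "0 < c"
  shows "\<exists>P C D. \<forall>n G adj \<omega> t w. branching adj c \<longrightarrow> (\<forall>x<n. \<forall>y<n. x \<rightarrow>\<^bsub>with_proj G\<^esub> y \<longleftrightarrow> adj x y) \<longrightarrow>
    (\<forall>v<n. 0 < \<omega> v) \<longrightarrow> (\<exists>k \<le> C * (max 1 n * max 1 n * guesses c t) ^ D.
      ram_answers P (encode_instance n G \<omega> t w) k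
        (\<exists>U. branching.issol n adj c Phi \<omega> t w U))"
proof -
  define nV where "nV = Suc (max (mv (initc c 0 0)) (mv (mainc c Phi)))"
  define R where "R = nV + max (dp (initc c 0 0)) (dp (mainc c Phi)) + 4"
  define J where "J = (2 :: nat) ^ R"
  define prog where "prog = Sq (initc c J R) (mainc c Phi)"
  interpret L: layout nV 21 R by unfold_locales (simp_all add: R_def)
  define p0 where "p0 = length (prelude R 0)"
  define body where "body = L.comp prog 0 p0"
  define P where "P = prelude R (p0 + length body) @ body"
  have lp: "length (prelude R l) = p0" for l by (simp add: p0_def prelude_def)
  have lP: "length P = p0 + length body" by (simp add: P_def lp)
  have R4: "4 \<le> R" by (simp add: R_def)
  have RJ: "R < J" unfolding J_def by (rule less_exp)
  have pp: "L.placed P 0 (prelude R (p0 + length body))" "L.placed P p0 body"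
    unfolding L.placed_def P_def
    by (rule exI[of _ "[]"], rule exI[of _ body], simp,
        rule exI[of _ "prelude R (p0 + length body)"], rule exI[of _ "[]"], simp add: lp)
  have sizes: "mv prog < nV" "ma prog < 21" "nV + 0 + dp prog \<le> R"
    using initc_sizes[of c J R] static_init(5)[of c J R] static_mainc(2)[of c Phi]
    by (simp_all add: prog_def nV_def R_def)
  obtain C D where CD: "\<And>s n t. fst s 0 = J * n \<Longrightarrow> 0 < n \<Longrightarrow>
      fst (exec (initc c J R) s) 1 = n \<Longrightarrow> fst (exec (initc c J R) s) 2 = 2 * n \<Longrightarrow>
      fst (exec (initc c J R) s) 3 = t \<Longrightarrow> fst (exec (initc c J R) s) 5 = t + c + 6 \<Longrightarrow>
      fst (exec (initc c J R) s) 6 = 6 * t + 1 \<Longrightarrow> fst (exec (initc c J R) s) 7 = guesses c t \<Longrightarrow>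
      tm prog 21 s \<le> C * (n * n * guesses c t) ^ D"
    using running_time[of J c R Phi] RJ unfolding Let_def prog_def by blast
  have "\<exists>k \<le> (p0 + 1 + C) * (max 1 n * max 1 n * guesses c t) ^ D.
      ram_answers P (encode_instance n G \<omega> t w) k (\<exists>U. branching.issol n adj c Phi \<omega> t w U)"
    if br: "branching adj c" and ad: "\<forall>x<n. \<forall>y<n. x \<rightarrow>\<^bsub>with_proj G\<^esub> y \<longleftrightarrow> adj x y"
      and pos: "\<forall>v<n. 0 < \<omega> v" for n G adj \<omega> t w
  proof -
    interpret branching n adj c Phi by (rule br)
    let ?E = "encode_instance n G \<omega> t w"
    let ?X = "max 1 n * max 1 n * guesses c t"
    have X: "1 \<le> ?X ^ D" by (simp add: guesses_def)
    show ?thesis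
    proof (cases "n = 0")
      \<comment> \<open>Without vertices there is no connected set; the prelude jumps to the end and
        register 0 already holds the answer 0.\<close>
      case True
      have "L.placed P 0 [JumpZero 0 (p0 + length body)]"
        using pp(1) L.placed_append[of P 0 "[JumpZero 0 (p0 + length body)]"
          "replicate R (Add 0 0 0) @ Store 0 1 # save (R - 2)"]
        unfolding prelude_def append_Cons append_Nil by blast
      from L.steps_one[OF this, of ?E] have "L.steps P 1 (0, ?E) (length P, ?E)"
        using True by (simp add: encode_instance_simps lP)
      then have "(ram_step P ^^ 1) (0, ?E) = (length P, ?E)" unfolding L.steps_def .
      moreover have "(\<exists>U. issol \<omega> t w U) = False"
      proof -
        have False if "issol \<omega> t w U" for U
        proof -
          have "U \<subseteq> {..<n}" "U \<noteq> {}" using that by (simp_all add: issol_def conn_def)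
          then show False using True by simp
        qed
        then show ?thesis by blast
      qed
      moreover have "?E 0 = 0" using True by (simp add: encode_instance_simps)
      ultimately have "ram_answers P ?E 1 (\<exists>U. issol \<omega> t w U)" unfolding ram_answers_def by simp
      moreover have "1 \<le> (p0 + 1 + C) * ?X ^ D" using X by simp
      ultimately show ?thesis by blast
    next
      case False
      then have n: "0 < n" by simp
      define N where "N = 2 ^ R * n"
      define M where "M = saved N (R - 2) (?E(0 := N))"
      define cell where "cell a = M (if a < R then a * N else a)" for a
      note S = saved_encode[OF R4 n, where G = G and \<omega> = \<omega> and t = t and w = w, folded N_def, folded M_def, folded cell_def]
      have NJ: "N = J * n" by (simp add: N_def J_def)
      \<comment> \<open>The memory itself is read as a state: the relocated input is the initial
        content of the interleaved arrays.\<close>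
      define s :: st where "s = (M, \<lambda>k i. M (R + k + 21 * i))"
      have st1: "L.steps P p0 (0, ?E) (p0, M)"
        using L.prelude_correct[OF pp(1), of ?E n] R4 n unfolding lp by (simp add: encode_instance_simps M_def N_def)
      have "L.rel 0 (\<lambda>_. 0) s M" by (simp add: L.rel_def s_def)
      from L.comp_correct[OF pp(2)[unfolded body_def] sizes this]
      obtain M' where M': "L.steps P (tm prog 21 s) (p0, M) (p0 + length body, M')" "L.rel 0 (\<lambda>_. 0) (exec prog s) M'"
        unfolding body_def by blast
      have en: "env \<omega> t w (guesses c t) (exec (initc c J R) s)"
      proof (rule initc_env)
        show "fst s 0 = N" using S(1) by (simp add: s_def)
      next
        fix x y assume xy: "x < n" "y < n" "y + 3 \<noteq> n"
        show "cell (3 + n + n * x + y) \<noteq> 0 \<longleftrightarrow> adj x y" unfolding S(5)[OF xy] using ad xy by blast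
      qed (use NJ RJ R4 n S(1-4) cell_def in \<open>simp_all add: s_def\<close>)
      have "fst (exec prog s) 0 = of_bool (\<exists>U. issol \<omega> t w U)"
        unfolding prog_def exec.simps(3) by (rule mainc_correct[OF en _ guesses_suffice]) (use pos in blast)
      moreover have "M' 0 = fst (exec prog s) 0" using M'(2) by (rule L.rel_varD) (simp add: nV_def)
      ultimately have "ram_answers P ?E (p0 + tm prog 21 s) (\<exists>U. issol \<omega> t w U)"
        using L.steps_trans[OF st1 M'(1)] by (simp add: ram_answers_def L.steps_def lP)
      moreover have "p0 + tm prog 21 s \<le> (p0 + 1 + C) * ?X ^ D"
      proof -
        have "tm prog 21 s \<le> C * (n * n * guesses c t) ^ D"
          by (rule CD) (use en NJ S(1) n in \<open>simp_all add: env_def good_def s_def\<close>)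
        also have "n * n * guesses c t = ?X" using n by (simp add: max_def)
        finally have "tm prog 21 s \<le> C * ?X ^ D" .
        moreover have "(p0 + 1) * 1 \<le> (p0 + 1) * ?X ^ D" by (intro mult_le_mono2 X)
        ultimately show ?thesis unfolding add_mult_distrib by linarith
      qed
      ultimately show ?thesis by blast
    qed
  qed
  then show ?thesis by blast
qed

section \<open>Induced subgraphs and isomorphism\<close>

lemma wf_with_proj: "wf_digraph (with_proj H) \<longleftrightarrow> parcs H \<subseteq> pverts H \<times> pverts H"
  unfolding wf_digraph_def with_proj_simps subset_iff mem_Times_iff by blast

lemma induced_subgraph_iff:
  assumes "wf_digraph (with_proj G)"
  shows "induced_subgraph (with_proj H) (with_proj G) \<longleftrightarrow>
    pverts H \<subseteq> pverts G \<and> parcs H = parcs G \<inter> pverts H \<times> pverts H"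
proof -
  have "{e \<in> parcs G. fst e \<in> pverts H \<and> snd e \<in> pverts H} = parcs G \<inter> pverts H \<times> pverts H" by auto
  then show ?thesis
    unfolding induced_subgraph_def subgraph_def compatible_def with_proj_simps wf_with_proj[of H]
    using assms by blast
qed

text \<open>Arcs of pair digraphs are pairs of vertices, so the action on arcs is forced by the
  action on vertices.\<close>

lemma digraph_iso_iff:
  assumes Y: "wf_digraph (with_proj Y)" and F: "wf_digraph (with_proj F)"
  shows "digraph_iso (with_proj Y) (with_proj F) \<longleftrightarrow> (\<exists>h. bij_betw h (pverts Y) (pverts F) \<and>
    (\<forall>x\<in>pverts Y. \<forall>y\<in>pverts Y. (x, y) \<in> parcs Y \<longleftrightarrow> (h x, h y) \<in> parcs F))"
proof
  assume "digraph_iso (with_proj Y) (with_proj F)"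
  then obtain f where f: "pre_digraph.digraph_isomorphism (with_proj Y) f" "with_proj F = app_iso f (with_proj Y)"
    unfolding digraph_iso_def by blast
  let ?h = "iso_verts f"
  have eqs: "pverts F = ?h ` pverts Y" "parcs F = iso_arcs f ` parcs Y" "iso_tail f = fst" "iso_head f = snd"
    using f(2) by (simp_all add: with_proj_def app_iso_def)
  have a: "iso_arcs f (x, y) = (?h x, ?h y)" if "(x, y) \<in> parcs Y" for x y
    using f(1) that eqs(3,4) unfolding pre_digraph.digraph_isomorphism_def
    by (auto simp: prod_eq_iff)
  have inj: "inj_on ?h (pverts Y)" using f(1) unfolding pre_digraph.digraph_isomorphism_def by simp
  have "(x, y) \<in> parcs Y \<longleftrightarrow> (?h x, ?h y) \<in> parcs F" if xy: "x \<in> pverts Y" "y \<in> pverts Y" for x y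
  proof
    assume "(x, y) \<in> parcs Y"
    then show "(?h x, ?h y) \<in> parcs F" unfolding eqs(2) using a[of x y] by (metis imageI)
  next
    assume "(?h x, ?h y) \<in> parcs F"
    then obtain x' y' where k: "(x', y') \<in> parcs Y" "(?h x, ?h y) = iso_arcs f (x', y')"
      unfolding eqs(2) by auto
    then have "?h x = ?h x'" "?h y = ?h y'" "x' \<in> pverts Y" "y' \<in> pverts Y"
      using a[of x' y'] Y by (auto simp: wf_with_proj)
    then show "(x, y) \<in> parcs Y" using k(1) inj xy by (metis inj_onD)
  qed
  moreover have "bij_betw ?h (pverts Y) (pverts F)" using inj eqs(1) by (simp add: bij_betw_def)
  ultimately show "\<exists>h. bij_betw h (pverts Y) (pverts F) \<and>
    (\<forall>x\<in>pverts Y. \<forall>y\<in>pverts Y. (x, y) \<in> parcs Y \<longleftrightarrow> (h x, h y) \<in> parcs F)" by blast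
next
  assume "\<exists>h. bij_betw h (pverts Y) (pverts F) \<and>
    (\<forall>x\<in>pverts Y. \<forall>y\<in>pverts Y. (x, y) \<in> parcs Y \<longleftrightarrow> (h x, h y) \<in> parcs F)"
  then obtain h where b: "bij_betw h (pverts Y) (pverts F)"
    and h: "\<And>x y. x \<in> pverts Y \<Longrightarrow> y \<in> pverts Y \<Longrightarrow> (x, y) \<in> parcs Y \<longleftrightarrow> (h x, h y) \<in> parcs F" by blast
  let ?f = "\<lparr>iso_verts = h, iso_arcs = map_prod h h, iso_head = snd, iso_tail = fst\<rparr>"
  have Ks: "parcs Y \<subseteq> pverts Y \<times> pverts Y" and Fs: "parcs F \<subseteq> pverts F \<times> pverts F"
    using Y F by (simp_all add: wf_with_proj)
  have inj: "inj_on h (pverts Y)" and im: "h ` pverts Y = pverts F" using b by (auto simp: bij_betw_def)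
  have "inj_on (map_prod h h) (parcs Y)"
    using map_prod_inj_on[OF inj inj] Ks by (rule inj_on_subset)
  then have "pre_digraph.digraph_isomorphism (with_proj Y) ?f"
    unfolding pre_digraph.digraph_isomorphism_def using Y inj by auto
  moreover have "parcs F = map_prod h h ` parcs Y"
  proof
    show "parcs F \<subseteq> map_prod h h ` parcs Y"
    proof
      fix e assume e: "e \<in> parcs F"
      obtain a b where ab: "e = (a, b)" by (cases e)
      with e Fs im obtain x y where "x \<in> pverts Y" "y \<in> pverts Y" "a = h x" "b = h y" by blast
      then show "e \<in> map_prod h h ` parcs Y" using h[of x y] e ab by force
    qed
    show "map_prod h h ` parcs Y \<subseteq> parcs F" using h Ks by auto
  qed
  then have "with_proj F = app_iso ?f (with_proj Y)" using im by (simp add: with_proj_def app_iso_def)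
  ultimately show "digraph_iso (with_proj Y) (with_proj F)" unfolding digraph_iso_def by blast
qed

definition digitF :: "'a pair_pre_digraph \<Rightarrow> 'a \<Rightarrow> 'a \<Rightarrow> nat" where
  "digitF F x y = (if x = y then 2 else if (x, y) \<in> parcs F then 1 else 0)"

text \<open>Surjections instead of bijections allow one tuple length \<open>c\<close> for all
  members; smaller graphs are listed with repetitions.\<close>

definition patterns :: "nat \<Rightarrow> 'a pair_pre_digraph set \<Rightarrow> (nat \<Rightarrow> nat \<Rightarrow> nat) set" where
  "patterns c \<F> = (\<Union>F\<in>\<F>. (\<lambda>f i j. digitF F (f i) (f j)) ` {f \<in> {..<c} \<rightarrow>\<^sub>E pverts F. f ` {..<c} = pverts F})"

lemma finite_patterns: "finite \<F> \<Longrightarrow> (\<And>F. F \<in> \<F> \<Longrightarrow> finite (pverts F)) \<Longrightarrow> finite (patterns c \<F>)"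
proof -
  assume a: "finite \<F>" "\<And>F. F \<in> \<F> \<Longrightarrow> finite (pverts F)"
  have "finite {f \<in> {..<c} \<rightarrow>\<^sub>E pverts F. f ` {..<c} = pverts F}" if "F \<in> \<F>" for F
  proof (rule finite_subset)
    show "finite ({..<c} \<rightarrow>\<^sub>E pverts F)" by (rule finite_PiE) (simp_all add: a(2)[OF that])
  qed blast
  then show ?thesis unfolding patterns_def using a(1) by blast
qed

text \<open>A tuple of such a type identifies two positions exactly if the surjection does, so it
  factors through an isomorphism onto the forbidden graph; conversely an isomorphic copy pulls the
  surjection back.\<close>

lemma (in branching) free_iff_induced_free:
  assumes G: "pair_graph G" "pverts G = {..<n}" and adj: "\<And>x y. adj x y \<longleftrightarrow> (x, y) \<in> parcs G"
    and Phi: "set Phi = patterns c \<F>"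
    and \<F>: "\<And>F. F \<in> \<F> \<Longrightarrow> pair_graph F \<and> pverts F \<noteq> {} \<and> card (pverts F) \<le> c"
    and U: "pverts H \<subseteq> {..<n}" "parcs H = parcs G \<inter> pverts H \<times> pverts H"
  shows "induced_free \<F> H \<longleftrightarrow> free (pverts H)"
proof -
  have wfH: "wf_digraph (with_proj H)" using U(2) by (auto simp: wf_with_proj)
  have wfF: "wf_digraph (with_proj F)" "finite (pverts F)" "\<And>x. (x, x) \<notin> parcs F" if "F \<in> \<F>" for F
  proof -
    interpret pair_graph F using \<F>[OF that] by simp
    show "wf_digraph (with_proj F)" by (rule wf_digraph_axioms)
    show "finite (pverts F)" by (rule pair_finite_verts)
    show "(x, x) \<notin> parcs F" for x using pair_no_loops[of "(x, x)"] by auto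
  qed
  have "(\<exists>(Y :: nat pair_pre_digraph) F. F \<in> \<F> \<and> induced_subgraph (with_proj Y) (with_proj H) \<and>
      digraph_iso (with_proj Y) (with_proj F)) \<longleftrightarrow>
    (\<exists>q. (\<forall>i<c. q i \<in> pverts H) \<and> (\<exists>\<phi>\<in>set Phi. has_type q \<phi>))"
  proof
    assume "\<exists>(Y :: nat pair_pre_digraph) F. F \<in> \<F> \<and> induced_subgraph (with_proj Y) (with_proj H) \<and>
      digraph_iso (with_proj Y) (with_proj F)"
    then obtain Y :: "nat pair_pre_digraph" and F where F: "F \<in> \<F>"
      and ind: "induced_subgraph (with_proj Y) (with_proj H)" and iso: "digraph_iso (with_proj Y) (with_proj F)" by blast
    have Y: "pverts Y \<subseteq> pverts H" "parcs Y = parcs H \<inter> pverts Y \<times> pverts Y"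
      using ind unfolding induced_subgraph_iff[OF wfH] by auto
    have wfK: "wf_digraph (with_proj Y)" using Y(2) by (auto simp: wf_with_proj)
    obtain h where b: "bij_betw h (pverts Y) (pverts F)"
      and h: "\<And>x y. x \<in> pverts Y \<Longrightarrow> y \<in> pverts Y \<Longrightarrow> (x, y) \<in> parcs Y \<longleftrightarrow> (h x, h y) \<in> parcs F"
      using iso unfolding digraph_iso_iff[OF wfK wfF(1)[OF F]] by blast
    obtain g where g: "g ` {..<c} = pverts F"
    proof -
      obtain e where e: "bij_betw e {..<card (pverts F)} (pverts F)"
        using ex_bij_betw_nat_finite[OF wfF(2)[OF F]] by (auto simp: atLeast0LessThan)
      obtain z where z: "z \<in> pverts F" using \<F>[OF F] by blast
      \<comment> \<open>Surplus positions repeat the vertex \<open>z\<close>.\<close>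
      let ?g = "\<lambda>i. if i < card (pverts F) then e i else z"
      have eF: "e ` {..<card (pverts F)} = pverts F" using e by (simp add: bij_betw_def)
      have "?g ` {..<c} = pverts F"
      proof
        show "?g ` {..<c} \<subseteq> pverts F" using eF z by auto
        show "pverts F \<subseteq> ?g ` {..<c}"
        proof
          fix y assume "y \<in> pverts F"
          then obtain i where "i < card (pverts F)" "y = e i" using eF by blast
          moreover from this have "i < c" using \<F>[OF F] by simp
          ultimately show "y \<in> ?g ` {..<c}" by (intro image_eqI[of _ _ i]) simp_all
        qed
      qed
      then show ?thesis by (rule that)
    qed
    define f where "f = restrict g {..<c}"
    have f: "f \<in> {..<c} \<rightarrow>\<^sub>E pverts F" "f ` {..<c} = pverts F" using g by (auto simp: f_def)
    define q where "q i = the_inv_into (pverts Y) h (f i)" for i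
    have q: "q i \<in> pverts Y" "h (q i) = f i" if "i < c" for i
    proof -
      have "f i \<in> h ` pverts Y" using f(1) that b by (auto simp: bij_betw_def)
      then show "q i \<in> pverts Y" "h (q i) = f i"
        using b by (auto simp: q_def bij_betw_def f_the_inv_into_f intro!: the_inv_into_into)
    qed
    have "digit (q i) (q j) = digitF F (f i) (f j)" if "i < c" "j < c" for i j
    proof -
      have "q i = q j \<longleftrightarrow> f i = f j" using q that b by (metis bij_betw_imp_inj_on inj_onD)
      moreover have "adj (q i) (q j) \<longleftrightarrow> (f i, f j) \<in> parcs F"
        using h[of "q i" "q j"] q that Y U unfolding adj by auto
      ultimately show ?thesis by (simp add: digit_def digitF_def)
    qed
    then have "has_type q (\<lambda>i j. digitF F (f i) (f j))" by (simp add: has_type_def)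
    moreover have "(\<lambda>i j. digitF F (f i) (f j)) \<in> set Phi" unfolding Phi patterns_def using F f by blast
    ultimately show "\<exists>q. (\<forall>i<c. q i \<in> pverts H) \<and> (\<exists>\<phi>\<in>set Phi. has_type q \<phi>)" using q(1) Y(1) by blast
  next
    assume "\<exists>q. (\<forall>i<c. q i \<in> pverts H) \<and> (\<exists>\<phi>\<in>set Phi. has_type q \<phi>)"
    then obtain q F f where q: "\<And>i. i < c \<Longrightarrow> q i \<in> pverts H" and F: "F \<in> \<F>" and f: "f ` {..<c} = pverts F"
      and ht: "has_type q (\<lambda>i j. digitF F (f i) (f j))"
      unfolding Phi patterns_def by blast
    have dg: "digit (q i) (q j) = digitF F (f i) (f j)" if "i < c" "j < c" for i j
      using ht that by (simp add: has_type_def)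
    have eq: "q i = q j \<longleftrightarrow> f i = f j" if "i < c" "j < c" for i j
      using dg[OF that] by (auto simp: digit_def digitF_def split: if_splits)
    have ar: "adj (q i) (q j) \<longleftrightarrow> (f i, f j) \<in> parcs F" if "i < c" "j < c" for i j
      using dg[OF that] adj_irrefl wfF(3)[OF F] by (auto simp: digit_def digitF_def split: if_splits)
    define W where "W = q ` {..<c}"
    define Y :: "nat pair_pre_digraph" where "Y = \<lparr>pverts = W, parcs = parcs H \<inter> W \<times> W\<rparr>"
    have ind: "induced_subgraph (with_proj Y) (with_proj H)"
      unfolding induced_subgraph_iff[OF wfH] using q by (auto simp: Y_def W_def)
    have wfK: "wf_digraph (with_proj Y)" by (auto simp: wf_with_proj Y_def)
    \<comment> \<open>By \<open>eq\<close> the value does not depend on the chosen position.\<close>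
    define h where "h x = f (SOME i. i < c \<and> q i = x)" for x
    have hq: "h (q i) = f i" if "i < c" for i
    proof -
      have "(SOME j. j < c \<and> q j = q i) < c \<and> q (SOME j. j < c \<and> q j = q i) = q i"
        by (rule someI[of "\<lambda>j. j < c \<and> q j = q i" i]) (use that in simp)
      then show ?thesis unfolding h_def using eq that by blast
    qed
    have "bij_betw h W (pverts F)"
      unfolding bij_betw_def
    proof
      show "inj_on h W" by (auto simp: inj_on_def W_def hq eq)
      show "h ` W = pverts F" unfolding W_def image_image f[symmetric] by (rule image_cong) (simp_all add: hq)
    qed
    moreover have "(x, y) \<in> parcs Y \<longleftrightarrow> (h x, h y) \<in> parcs F" if "x \<in> W" "y \<in> W" for x y
    proof -
      obtain i j where ij: "i < c" "j < c" "x = q i" "y = q j" using \<open>x \<in> W\<close> \<open>y \<in> W\<close> by (auto simp: W_def)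
      then show ?thesis using ar[of i j] q[of i] q[of j] that U(2) by (auto simp: hq Y_def adj)
    qed
    ultimately have "digraph_iso (with_proj Y) (with_proj F)"
      unfolding digraph_iso_iff[OF wfK wfF(1)[OF F]] by (auto simp: Y_def)
    with F ind show "\<exists>(Y :: nat pair_pre_digraph) F. F \<in> \<F> \<and> induced_subgraph (with_proj Y) (with_proj H) \<and>
      digraph_iso (with_proj Y) (with_proj F)" by blast
  qed
  then show ?thesis unfolding induced_free_def free_def by blast
qed

lemma (in sgraph) connected_iff_conn:
  assumes H: "pverts H = U" "parcs H = arcs_in U"
  shows "Digraph_Component.connected (with_proj H) \<longleftrightarrow> conn U"
proof -
  have "parcs (mk_symmetric (with_proj H)) = arcs_in U"
    using adj_sym by (auto simp: parcs_mk_symmetric H arcs_in_def)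
  moreover have wf: "wf_digraph (with_proj (mk_symmetric (with_proj H)))"
    unfolding wf_with_proj calculation using H by (auto simp: arcs_in_def)
  ultimately have "x \<rightarrow>\<^sup>*\<^bsub>with_proj (mk_symmetric (with_proj H))\<^esub> y \<longleftrightarrow> (x, y) \<in> rtrancl (arcs_in U)"
    if "x \<in> U" "y \<in> U" for x y
    using wf_digraph.reachable_conv[OF wf, of x y] that H(1) by simp
  then show ?thesis unfolding Digraph_Component.connected_def strongly_connected_def conn_def
    using H(1) by simp
qed

theorem (in branching) connected_secluded_free_subgraph_iff:
  assumes G: "pair_graph G" "pverts G = {..<n}" and adj: "\<And>x y. adj x y \<longleftrightarrow> (x, y) \<in> parcs G"
    and Phi: "set Phi = patterns c \<F>"
    and \<F>: "\<And>F. F \<in> \<F> \<Longrightarrow> pair_graph F \<and> pverts F \<noteq> {} \<and> card (pverts F) \<le> c"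
  shows "connected_secluded_free_subgraph \<F> G \<omega> t w \<longleftrightarrow> (\<exists>U. issol \<omega> t w U)"
proof -
  interpret GG: pair_graph G by (rule G(1))
  have wfG: "wf_digraph (with_proj G)" by (rule GG.wf_digraph_axioms)
  have on: "open_neighborhood G U = nb U" for U
    using GG.in_arcsD2 G(2) by (auto simp: open_neighborhood_def nb_def adj)
  have *: "Digraph_Component.connected (with_proj H) \<and> secluded t G (pverts H) \<and> induced_free \<F> H \<and>
      w \<le> (\<Sum>v\<in>pverts H. \<omega> v) \<longleftrightarrow> issol \<omega> t w (pverts H)"
    if H: "pverts H \<subseteq> pverts G" "parcs H = parcs G \<inter> pverts H \<times> pverts H" for H :: "nat pair_pre_digraph"
  proof -
    have "parcs H = arcs_in (pverts H)" using H(2) by (auto simp: arcs_in_def adj)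
    from connected_iff_conn[OF refl this] free_iff_induced_free[OF G adj Phi \<F> _ H(2)] H(1) G(2)
    show ?thesis by (simp add: issol_def secluded_def on)
  qed
  show ?thesis
  proof
    assume "connected_secluded_free_subgraph \<F> G \<omega> t w"
    then show "\<exists>U. issol \<omega> t w U"
      unfolding connected_secluded_free_subgraph_def induced_subgraph_iff[OF wfG] using * by blast
  next
    assume "\<exists>U. issol \<omega> t w U"
    then obtain U where U: "issol \<omega> t w U" by blast
    let ?H = "\<lparr>pverts = U, parcs = parcs G \<inter> U \<times> U\<rparr> :: nat pair_pre_digraph"
    have "pverts ?H \<subseteq> pverts G" "parcs ?H = parcs G \<inter> pverts ?H \<times> pverts ?H"
      using U G(2) by (simp_all add: issol_def)
    with *[OF this] U show "connected_secluded_free_subgraph \<F> G \<omega> t w"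
      unfolding connected_secluded_free_subgraph_def induced_subgraph_iff[OF wfG]
      by (intro exI[of _ ?H]) auto
  qed
qed

section \<open>The time bound\<close>

text \<open>The graph without vertices is induced in every graph. The case is separate since a
  nonempty tuple cannot map onto an empty vertex set.\<close>

lemma empty_pattern:
  assumes F: "F \<in> \<F>" "pair_graph F" "pverts F = {}" and G: "pair_graph G"
  shows "\<not> connected_secluded_free_subgraph \<F> G \<omega> t w"
proof -
  interpret FF: pair_graph F by (rule F(2))
  have wF: "wf_digraph (with_proj F)" by (rule FF.wf_digraph_axioms)
  have "\<not> induced_free \<F> H" if "induced_subgraph (with_proj H) (with_proj G)" for H :: "'b pair_pre_digraph"
  proof -
    let ?Y = "\<lparr>pverts = {}, parcs = {}\<rparr> :: 'b pair_pre_digraph"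
    have wY: "wf_digraph (with_proj ?Y)" by (simp add: wf_with_proj)
    have "wf_digraph (with_proj H)" using that by (simp add: induced_subgraph_def subgraph_def)
    then have "induced_subgraph (with_proj ?Y) (with_proj H)" by (simp add: induced_subgraph_iff)
    moreover have "digraph_iso (with_proj ?Y) (with_proj F)"
      unfolding digraph_iso_iff[OF wY wF] using F(3) by (simp add: bij_betw_def)
    ultimately show ?thesis unfolding induced_free_def using F(1) by blast
  qed
  then show ?thesis unfolding connected_secluded_free_subgraph_def by blast
qed

text \<open>From \<open>t = 2\<close> on the logarithm is at least 1, so a linear function is within
  the bound.\<close>

lemma linear_bigo: "(\<lambda>t. real (7 * t + b)) \<in> O(\<lambda>t. real t * log 2 (real t))"
proof (rule bigoI[of _ "real (7 + b)"])
  have "norm (real (7 * t + b)) \<le> real (7 + b) * norm (real t * log 2 (real t))" if t: "2 \<le> t" for t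
  proof -
    have "log 2 2 \<le> log 2 (real t)" using t by (subst log_le_cancel_iff) auto
    then have l: "1 \<le> log 2 (real t)" by simp
    have "7 * t + b \<le> (7 + b) * t" using t by (cases t) (auto simp: algebra_simps)
    then have "real (7 * t + b) \<le> real (7 + b) * real t" unfolding of_nat_mult[symmetric] of_nat_le_iff .
    also have "\<dots> \<le> real (7 + b) * (real t * log 2 (real t))"
      using mult_left_mono[OF l, of "real t"] by (intro mult_left_mono) auto
    finally show ?thesis using l by simp
  qed
  then show "\<forall>\<^sub>F t in at_top. norm (real (7 * t + b)) \<le> real (7 + b) * norm (real t * log 2 (real t))"
    unfolding eventually_at_top_linorder by blast
qed

text \<open>Factor \<open>C\<close> and degree \<open>D\<close> move into the top exponent, because
  \<open>C + D * 2 ^ x\<close> is at most \<open>2 ^ (C + D + x)\<close>.\<close>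

lemma guesses_bound:
  "C * (m * m * guesses c t) ^ D \<le> 2 ^ 2 ^ 2 ^ (7 * t + (c + c + c * c + 10 + C + D)) * m ^ (2 * D)"
proof -
  let ?X = "7 * t + c + c + c * c + 10" let ?Z = "7 * t + (c + c + c * c + 10 + C + D)"
  have l: "a \<le> 2 ^ a" for a :: nat by (rule less_imp_le) simp
  have "C + 2 ^ ?X * D \<le> C * 2 ^ ?X + D * 2 ^ ?X" by (intro add_mono) simp_all
  also have "\<dots> = (C + D) * 2 ^ ?X" by (simp only: add_mult_distrib)
  also have "\<dots> \<le> 2 ^ (C + D) * 2 ^ ?X" by (intro mult_le_mono1 l)
  also have "\<dots> = 2 ^ ?Z" unfolding power_add[symmetric] by (rule arg_cong) simp
  also have "\<dots> \<le> 2 ^ 2 ^ ?Z" by (rule l)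
  finally have e: "C + 2 ^ ?X * D \<le> 2 ^ 2 ^ ?Z" .
  have "C * guesses c t ^ D \<le> 2 ^ C * guesses c t ^ D" by (intro mult_le_mono1 l)
  also have "\<dots> = 2 ^ (C + 2 ^ ?X * D)" by (simp only: guesses_def power_add power_mult)
  also have "\<dots> \<le> 2 ^ 2 ^ 2 ^ ?Z" by (rule power_increasing[OF e]) simp
  finally have "C * guesses c t ^ D * m ^ (2 * D) \<le> 2 ^ 2 ^ 2 ^ ?Z * m ^ (2 * D)" by (rule mult_le_mono1)
  moreover have "C * (m * m * guesses c t) ^ D = C * guesses c t ^ D * m ^ (2 * D)"
    by (simp only: power_mult_distrib power_mult power2_eq_square mult_ac)
  ultimately show ?thesis by (simp only:)
qed

theorem theorem1:
  fixes \<F> :: "'a pair_pre_digraph set"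
  assumes "finite \<F>"
    and "\<And>F. F \<in> \<F> \<Longrightarrow> pair_graph F"
  shows "\<exists>(P :: ram_program) (g :: nat \<Rightarrow> real) (d :: nat).
           g \<in> O(\<lambda>t. real t * log 2 (real t)) \<and>
           (\<forall>(n :: nat) (G :: nat pair_pre_digraph) (\<omega> :: nat \<Rightarrow> nat) (t :: nat) (w :: nat).
              pair_graph G \<longrightarrow> pverts G = {..<n} \<longrightarrow> (\<forall>v\<in>pverts G. \<omega> v > 0) \<longrightarrow> w > 0 \<longrightarrow>
              (\<exists>k :: nat.
                 real k \<le> 2 powr (2 powr (2 powr g t)) * real (max 1 n) ^ d \<and>
                 ram_answers P (encode_instance n G \<omega> t w) k
                   (connected_secluded_free_subgraph \<F> G \<omega> t w)))"
proof (cases "\<exists>F\<in>\<F>. pverts F = {}")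
  case True
  then obtain F where F: "F \<in> \<F>" "pverts F = {}" by blast
  have a: "ram_answers [Const 0 0] (encode_instance n G \<omega> t w) 1 (connected_secluded_free_subgraph \<F> G \<omega> t w)"
    if "pair_graph G" for n G \<omega> t w
    using empty_pattern[OF F(1) assms(2)[OF F(1)] F(2) that] by (simp add: ram_answers_def ram_step_def)
  have b: "real 1 \<le> 2 powr (2 powr (2 powr 0)) * real (max 1 n) ^ 0" for n
    using ge_one_powr_ge_zero[of 2 "2 powr (2 powr 0)"] by simp
  show ?thesis
    by (rule exI[of _ "[Const 0 0]"], rule exI[of _ "\<lambda>_. 0"], rule exI[of _ 0],
        intro conjI allI impI exI[of _ 1] a b) simp_all
next
  case False
  \<comment> \<open>The inserted 1 keeps \<open>c\<close> positive when \<open>\<F>\<close> is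
    empty.\<close>
  define c where "c = Max (insert 1 ((\<lambda>F. card (pverts F)) ` \<F>))"
  have c: "0 < c" "\<And>F. F \<in> \<F> \<Longrightarrow> card (pverts F) \<le> c"
  proof -
    have "1 \<le> c" unfolding c_def using assms(1) by (intro Max_ge) auto
    then show "0 < c" by simp
    show "card (pverts F) \<le> c" if "F \<in> \<F>" for F unfolding c_def using assms(1) that by (intro Max_ge) auto
  qed
  have fin: "finite (pverts F)" if "F \<in> \<F>" for F
  proof -
    interpret pair_graph F by (rule assms(2)[OF that])
    show ?thesis by (rule pair_finite_verts)
  qed
  have \<F>: "pair_graph F \<and> pverts F \<noteq> {} \<and> card (pverts F) \<le> c" if "F \<in> \<F>" for F
    using that assms(2) c(2) False by blast
  obtain Phi where Phi: "set Phi = patterns c \<F>"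
    using finite_list[OF finite_patterns[OF assms(1) fin]] by blast
  obtain P C D where P: "\<And>n G adj \<omega> t w. branching adj c \<Longrightarrow>
      (\<forall>x<n. \<forall>y<n. x \<rightarrow>\<^bsub>with_proj G\<^esub> y \<longleftrightarrow> adj x y) \<Longrightarrow> (\<forall>v<n. 0 < \<omega> v) \<Longrightarrow>
      \<exists>k \<le> C * (max 1 n * max 1 n * guesses c t) ^ D. ram_answers P (encode_instance n G \<omega> t w) k
        (\<exists>U. branching.issol n adj c Phi \<omega> t w U)"
    using program_exists[OF c(1), of Phi] by blast
  define b where "b = c + c + c * c + 10 + C + D"
  have bound: "\<exists>k. real k \<le> 2 powr (2 powr (2 powr real (7 * t + b))) * real (max 1 n) ^ (2 * D) \<and>
      ram_answers P (encode_instance n G \<omega> t w) k (connected_secluded_free_subgraph \<F> G \<omega> t w)"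
    if G: "pair_graph G" "pverts G = {..<n}" and pos: "\<forall>v\<in>pverts G. \<omega> v > 0" for n G \<omega> t w
  proof -
    let ?adj = "\<lambda>x y. (x, y) \<in> parcs G"
    interpret GG: pair_graph G by (rule G(1))
    interpret branching n ?adj c Phi
    proof
      show "?adj v u" if "?adj u v" for u v
        using GG.pair_sym_arcs that by (simp add: symmetric_def sym_def)
      show "\<not> ?adj v v" for v using GG.pair_no_loops[of "(v, v)"] by auto
    qed (rule c(1))
    have "\<forall>x<n. \<forall>y<n. x \<rightarrow>\<^bsub>with_proj G\<^esub> y \<longleftrightarrow> ?adj x y" by simp
    moreover have "\<forall>v<n. 0 < \<omega> v" using pos G(2) by simp
    ultimately obtain k where k: "k \<le> C * (max 1 n * max 1 n * guesses c t) ^ D"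
      and ans: "ram_answers P (encode_instance n G \<omega> t w) k (\<exists>U. issol \<omega> t w U)"
      using P[OF branching_axioms, of n G \<omega> t w] by blast
    have "k \<le> 2 ^ 2 ^ 2 ^ (7 * t + b) * max 1 n ^ (2 * D)"
      using order.trans[OF k guesses_bound] unfolding b_def .
    then have "real k \<le> real (2 ^ 2 ^ 2 ^ (7 * t + b) * max 1 n ^ (2 * D))" by (rule of_nat_mono)
    also have "\<dots> = 2 powr (2 powr (2 powr real (7 * t + b))) * real (max 1 n) ^ (2 * D)"
    proof -
      have p: "(2 :: real) ^ a = 2 powr real a" for a by (simp add: powr_realpow)
      have "real (2 ^ 2 ^ 2 ^ (7 * t + b)) = 2 powr (2 powr (2 powr real (7 * t + b)))"
        unfolding of_nat_power of_nat_numeral p ..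
      then show ?thesis by (simp only: of_nat_mult of_nat_power)
    qed
    finally have "real k \<le> 2 powr (2 powr (2 powr real (7 * t + b))) * real (max 1 n) ^ (2 * D)" .
    moreover have "connected_secluded_free_subgraph \<F> G \<omega> t w = (\<exists>U. issol \<omega> t w U)"
      by (rule connected_secluded_free_subgraph_iff[OF G refl Phi \<F>])
    ultimately show ?thesis using ans by (intro exI[of _ k] conjI) (simp_all only:)
  qed
  show ?thesis
    by (rule exI[of _ P], rule exI[of _ "\<lambda>t. real (7 * t + b)"], rule exI[of _ "2 * D"],
        intro conjI linear_bigo allI impI, rule bound)
qed

end
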